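(* Let $0<\lambda<W(e^{-1})$ be a fixed real number, and let $N$ be a positive integer. For any non-negative integer $k$ let $\omega_k=\arg(\lambda+\log\lambda+1+(2k+1)\pi i)$, so that $\omega_0=\omega$. Then, with $z=\lambda a$, the remainder term $R_N(a,\lambda)$ defined by \[ \Gamma(-a,z)=z^{-a}e^{-z}\left(\sum_{n=0}^{N-1}\frac{a^n b_n(-\lambda)}{(z+a)^{2n+1}}+R_N(a,\lambda)\right) \] has the expansion \[ \begin{aligned} R_N(a,\lambda)=\;&\frac{(-1)^N a^N}{(z+a)^{2N+1}}(\lambda+1)^{2N+1}\sum_{k=0}^\infty\frac{e^{(N+\frac12)\omega_k i}}{\sqrt{2\pi}\,i}\int_0^{+\infty}\frac{t^{N-\frac12}e^{-t|\lambda+\log\lambda+1-(2k+1)\pi i|}}{1+te^{i\omega_k}/a}\,\frac{dt}{\Gamma^\ast(te^{i(\omega_k-\pi)})}\\ &+\frac{(-1)^{N+1}a^N}{(z+a)^{2N+1}}(\lambda+1)^{2N+1}\sum_{k=0}^\infty\frac{e^{-(N+\frac12)\omega_k i}}{\sqrt{2\pi}\,i}\int_0^{+\infty}\frac{t^{N-\frac12}e^{-t|\lambda+\log\lambda+1+(2k+1)\pi i|}}{1+te^{-i\omega_k}/a}\,\frac{dt}{\Gamma^\ast(te^{-i(\omega_k-\pi)})} \end{aligned} \] for $|\arg a|<-\omega+\pi$.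
   Context: $\Gamma(\cdot,\cdot)$ is the (upper) incomplete gamma function, $a$ is a nonzero complex number, and all multivalued functions take their principal values. $W$ is the principal branch of the Lambert $W$-function ($W(e^{-1})=0.27846\ldots$). For $\lambda>0$, $\omega=\omega(\lambda)=\arg(\lambda+\log\lambda+1+\pi i)\in(0,\pi)$; the range $0<\lambda<W(e^{-1})$ corresponds to $\frac{\pi}{2}<\omega<\pi$. The coefficients are \[ b_n(-\lambda)=(\lambda+1)^n\left[\frac{d^n}{dt^n}\left(\frac{(\lambda+1)t}{\lambda e^t+t-\lambda}\right)^{n+1}\right]_{t=0},\qquad n\ge0, \] where the function in the bracket takes the value $1$ at its removable singularity $t=0$. The scaled gamma function is \[ \Gamma^\ast(z)=\frac{\Gamma(z)}{\sqrt{2\pi}\,z^{z-\frac12}e^{-z}},\qquad |\arg z|<\pi . \] *)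

theory Defs
  imports "HOL-Analysis.Analysis"
begin

(* Principal branch of the upper incomplete gamma function, i.e. the integral of
   t^(s-1) e^(-t) from z to +infinity along a path avoiding the cut (-infinity,0].
   The path taken is the horizontal ray t = z + u, u > 0, which never meets the cut when z
   is off the cut; values for z on the cut are not meaningful. *)
definition incGamma :: "complex \<Rightarrow> complex \<Rightarrow> complex" where
  "incGamma s z =
     (LBINT u:{0<..}. (z + complex_of_real u) powr (s - 1) * exp (- (z + complex_of_real u)))"

(* Principal real branch; only meaningful for x \<ge> -1/e. *)
definition lambertW :: "real \<Rightarrow> real" where
  "lambertW x = (THE w. w \<ge> -1 \<and> w * exp w = x)"

(* Only meaningful for z off the cut (-infinity,0]. *)
definition Gamma_star :: "complex \<Rightarrow> complex" where
  "Gamma_star z = Gamma z / (complex_of_real (sqrt (2 * pi)) * z powr (z - 1/2) * exp (- z))"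

(* Stated at the argument x = -\<lambda>, so that b_coeff n (-\<lambda>) has the bracket
   ((\<lambda>+1) t / (\<lambda> e^t + t - \<lambda>))^(n+1) with its removable singularity filled in. *)
definition b_coeff :: "nat \<Rightarrow> complex \<Rightarrow> complex" where
  "b_coeff n x =
     (1 - x) ^ n *
     (deriv ^^ n)
       (\<lambda>t. if t = 0 then 1 else ((1 - x) * t / (- x * exp t + t + x)) ^ (n + 1)) 0"

definition omega :: "real \<Rightarrow> nat \<Rightarrow> real" where
  "omega lam k =
     Arg (complex_of_real (lam + ln lam + 1) + complex_of_real ((2 * real k + 1) * pi) * \<i>)"

definition integrand_plus :: "nat \<Rightarrow> complex \<Rightarrow> real \<Rightarrow> nat \<Rightarrow> real \<Rightarrow> complex" where
  "integrand_plus N a lam k t =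
     complex_of_real
       (t powr (real N - 1/2) *
        exp (- t * cmod (complex_of_real (lam + ln lam + 1)
                         - complex_of_real ((2 * real k + 1) * pi) * \<i>)))
     / (1 + complex_of_real t * exp (\<i> * complex_of_real (omega lam k)) / a)
     * (1 / Gamma_star (complex_of_real t * exp (\<i> * complex_of_real (omega lam k - pi))))"

definition integrand_minus :: "nat \<Rightarrow> complex \<Rightarrow> real \<Rightarrow> nat \<Rightarrow> real \<Rightarrow> complex" where
  "integrand_minus N a lam k t =
     complex_of_real
       (t powr (real N - 1/2) *
        exp (- t * cmod (complex_of_real (lam + ln lam + 1)
                         + complex_of_real ((2 * real k + 1) * pi) * \<i>)))
     / (1 + complex_of_real t * exp (- \<i> * complex_of_real (omega lam k)) / a)
     * (1 / Gamma_star (complex_of_real t * exp (- \<i> * complex_of_real (omega lam k - pi))))"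

definition series_term_plus :: "nat \<Rightarrow> complex \<Rightarrow> real \<Rightarrow> nat \<Rightarrow> complex" where
  "series_term_plus N a lam k =
     exp (complex_of_real ((real N + 1/2) * omega lam k) * \<i>)
     / (complex_of_real (sqrt (2 * pi)) * \<i>)
     * (LBINT t:{0<..}. integrand_plus N a lam k t)"

definition series_term_minus :: "nat \<Rightarrow> complex \<Rightarrow> real \<Rightarrow> nat \<Rightarrow> complex" where
  "series_term_minus N a lam k =
     exp (- complex_of_real ((real N + 1/2) * omega lam k) * \<i>)
     / (complex_of_real (sqrt (2 * pi)) * \<i>)
     * (LBINT t:{0<..}. integrand_minus N a lam k t)"

end

theory Submission
  imports Defs "HOL-Complex_Analysis.Complex_Analysis" "HOL-Real_Asymp.Real_Asymp"
begin

text \<open>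
  For \<open>z = \<lambda>a\<close> with \<open>a\<close> not an integer, \<open>z\<^sup>a e\<^sup>z \<Gamma>(-a, z)\<close> splits into
  \<open>z\<^sup>a e\<^sup>z \<Gamma>(-a)\<close> and the series \<open>e\<^sup>z \<Sum>\<^sub>n (-z)\<^sup>n / (n! (a - n))\<close>.
  Writing \<open>h(s) = (\<lambda>s)\<^sup>s e\<^bsup>\<lambda>s\<^esup> / \<Gamma>(1 + s)\<close>, rearranging a double series which converges
  absolutely because \<open>\<lambda>e\<^sup>\<lambda> < 1/e\<close> turns the latter into the partial fraction series
  \<open>\<Sum>\<^sub>n (-1)\<^sup>n h(n) / (a - n)\<close>, and Lagrange inversion shows that the \<open>j\<close>-th coefficient of the
  asymptotic expansion is \<open>\<Sum>\<^sub>n (-1)\<^sup>n n\<^sup>j h(n)\<close>. So the remainder is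
  \<open>a\<^bsup>-N\<^esup> \<Sum>\<^sub>n (-1)\<^sup>n n\<^sup>N h(n) / (a - n) - \<pi> h(a) / sin(\<pi>a)\<close>, which is a sum of residues of
  \<open>s\<^sup>N h(s) / (sin(\<pi>s) (1 - s/a))\<close>.

  On the other side, \<open>1 / \<Gamma>\<^sup>*\<close> is up to elementary factors the function \<open>h\<close>, and the
  \<open>k\<close>-th term of each series is the integral of \<open>s\<^sup>N h(s) e\<^bsup>\<mp>(2k+1)\<pi>is\<^esup> / (1 - s/a)\<close> along the ray
  of direction \<open>e\<^bsup>\<mp>i(\<pi> - \<omega>\<^sub>k)\<^esup>\<close>. All the rays can be rotated to the one with \<open>k = 0\<close>, where the
  sum over \<open>k\<close> is geometric with value \<open>\<plusminus>1 / (2i sin(\<pi>s))\<close>; the two remaining integrals bound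
  the wedge that contains the poles.
\<close>

section \<open>The tree function\<close>

text \<open>The hypothesis \<open>lam * exp lam < exp (-1)\<close> acts twice: with n^n / n! \<le>
  e^n it makes the double series converge absolutely, and it makes \<open>lam + ln lam + 1\<close>
  negative, which puts all rays into the right half-plane, away from the cut of s powr s and the
  poles of Gamma. There s^s e^(-s) / Gamma(1 + s) has modulus at most 1, so that every estimate
  reduces to elementary factors. The obstacle is the point 0, where s powr s has its branch point
  and 1 / sin (pi s) a pole: one factor of s^N cancels the pole, which is one use of N > 0, and
  contours may only approach 0. The bound on Arg a says that a lies strictly between the two rays
  with k = 0. Each series on its own needs only one of these two sides, and the second series is
  minus the complex conjugate of the first one taken at \<open>cnj a\<close>. The Lagrange inversion
  is done with contour integrals: a coefficient is a Cauchy integral of 1 / f^(n+1) with f(t) = lam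
  e^t + t - lam, and integration by parts lowers the power of f.\<close>

lemma power_div_fact_le_exp: "real n ^ n / fact n \<le> exp (real n)"
proof -
  have "(\<lambda>k. real n ^ k / fact k) sums exp (real n)"
    using exp_converges[of "real n"] by (simp add: divide_inverse mult.commute)
  from sum_le_suminf[OF sums_summable[OF this], of "{n}"] sums_unique[OF this]
  show ?thesis by simp
qed

text \<open>Up to the sign (-1)^m this is the m-th finite difference of x^j at 0, which annihilates
  degrees below m. The induction absorbs a factor n into the binomial coefficient and expands (n +
  1)^i.\<close>

lemma alternating_binomial_power_sum:
  assumes "j \<le> m"
  shows "(\<Sum>n\<le>m. (-1) ^ n * of_nat (m choose n) * of_nat n ^ j)
           = (if j = m then (-1) ^ m * fact m else 0 :: complex)"
  using assms
proof (induction m arbitrary: j)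
  case 0
  then show ?case by simp
next
  case (Suc m)
  show ?case
  proof (cases j)
    case 0
    then show ?thesis using choose_alternating_sum[of "Suc m", where 'a = complex] by simp
  next
    case (Suc i)
    have shift: "(-1) ^ Suc n * of_nat (Suc m choose Suc n) * of_nat (Suc n) ^ j
        = - of_nat (Suc m) * ((-1) ^ n * of_nat (m choose n) * (\<Sum>q\<le>i. of_nat (i choose q) * of_nat n ^ q) :: complex)"
      for n :: nat
    proof -
      have f1: "of_nat (Suc n) * of_nat (Suc m choose Suc n) = (of_nat (Suc m) * of_nat (m choose n) :: complex)"
        by (metis Suc_times_binomial_eq mult.commute of_nat_mult)
      have f2: "of_nat (Suc n) ^ i = (\<Sum>q\<le>i. of_nat (i choose q) * of_nat n ^ q :: complex)"
        using binomial_ring[of "of_nat n :: complex" 1 i] by (simp add: add.commute)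
      have gen: "- 1 * s * v * (u * y) = - M * (s * w * z)" if "u * v = M * w" "y = z" for s u v w y z M :: complex
      proof -
        have "- 1 * s * v * (u * y) = - (s * (u * v) * y)" by (simp add: mult_ac)
        then show ?thesis unfolding that by (simp add: mult_ac)
      qed
      show ?thesis unfolding Suc power_Suc by (rule gen[OF f1 f2])
    qed
    have "(\<Sum>n\<le>Suc m. (-1) ^ n * of_nat (Suc m choose n) * of_nat n ^ j)
        = (\<Sum>n\<le>m. (-1) ^ Suc n * of_nat (Suc m choose Suc n) * of_nat (Suc n) ^ j :: complex)"
      unfolding sum.atMost_Suc_shift using Suc by simp
    also have "\<dots> = - of_nat (Suc m) * (\<Sum>n\<le>m. \<Sum>q\<le>i. of_nat (i choose q) * ((-1) ^ n * of_nat (m choose n) * of_nat n ^ q))"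
      unfolding shift sum_distrib_left by (simp add: mult_ac)
    also have "\<dots> = - of_nat (Suc m) * (\<Sum>q\<le>i. of_nat (i choose q) * (\<Sum>n\<le>m. (-1) ^ n * of_nat (m choose n) * of_nat n ^ q))"
      by (subst sum.swap) (simp add: sum_distrib_left)
    also have "\<dots> = - of_nat (Suc m) * (\<Sum>q\<le>i. of_nat (i choose q) * (if q = m then (-1) ^ m * fact m else 0))"
      using Suc Suc.prems by (simp add: Suc.IH)
    also have "\<dots> = (if j = Suc m then (-1) ^ Suc m * fact (Suc m) else 0)"
    proof (cases "i = m")
      case True
      then show ?thesis using Suc by (simp add: sum.delta if_distrib algebra_simps cong: if_cong)
    next
      case False
      then have "i < m" using Suc Suc.prems by simp
      then show ?thesis using Suc by (auto intro!: sum.neutral)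
    qed
    finally show ?thesis .
  qed
qed

lemma summable_power_mult_powser:
  assumes "0 \<le> r" "r < 1"
  shows "summable (\<lambda>n. real n ^ i * r ^ n)"
proof (cases "r = 0")
  case True
  then have "(\<lambda>n. real n ^ i * r ^ n) = (\<lambda>n. if n = 0 then 0 ^ i else 0)"
    by (auto simp: fun_eq_iff)
  then show ?thesis by (simp only: summable_If_finite[of "\<lambda>n. n = 0"]) simp
next
  case False
  with assms have "0 < r" by simp
  define s where "s = (1 + r) / 2"
  have s: "r < s" "s < 1" "0 < s" using assms by (auto simp: s_def)
  have "(\<lambda>n. real n ^ i * r ^ n) \<in> O(\<lambda>n. s ^ n)"
    using \<open>0 < r\<close> s by real_asymp
  then show ?thesis
    by (rule summable_comparison_test_bigo[rotated]) (use s in \<open>simp add: summable_geometric\<close>)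
qed

text \<open>The exponentials are expanded and the terms regrouped by total degree m = n + k. In
  norm, row n sums to at most C r^n with r = e |\<tau>| e^|\<tau>| < 1, which gives absolute
  convergence. The sequence \<open>c\<close> stays arbitrary because it is taken as (-1)^n and as
  (-1)^n / (a - n).\<close>

lemma exp_tree_series_rearrange:
  fixes c :: "nat \<Rightarrow> complex" and \<tau> :: complex
  assumes c: "\<And>n. norm (c n) \<le> C" and tau: "norm \<tau> * exp (norm \<tau>) < exp (-1)"
  shows "(\<lambda>m. \<tau> ^ m * (\<Sum>n\<le>m. c n * of_nat n ^ m / (fact n * fact (m - n))))
           sums (\<Sum>n. c n * (of_nat n * \<tau>) ^ n / fact n * exp (of_nat n * \<tau>))"
proof -
  define T where "T n = c n * (of_nat n * \<tau>) ^ n / fact n" for n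
  define F where "F = (\<lambda>(n, k). T n * ((of_nat n * \<tau>) ^ k / fact k))"
  have C: "0 \<le> C" using c[of 0] norm_ge_zero order_trans by blast
  define r where "r = exp 1 * (norm \<tau> * exp (norm \<tau>))"
  have r: "0 \<le> r" "r < 1"
    using tau by (auto simp: r_def exp_minus field_simps)
  have rows: "(\<lambda>k. (of_nat n * \<tau>) ^ k / fact k) sums exp (of_nat n * \<tau>)" for n
    using exp_converges[of "of_nat n * \<tau>"] by (simp add: scaleR_conv_of_real divide_inverse mult.commute)
  have nrows: "(\<lambda>k. norm (F (n, k))) sums (norm (T n) * exp (real n * norm \<tau>))" for n
    using sums_mult[OF exp_converges[of "real n * norm \<tau>"], of "norm (T n)"]
    by (simp add: F_def norm_mult norm_divide norm_power norm_inverse divide_inverse mult.commute)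
  have Tbound: "norm (T n) * exp (real n * norm \<tau>) \<le> C * r ^ n" for n
  proof -
    have "norm (T n) * exp (real n * norm \<tau>)
        = norm (c n) * (real n ^ n / fact n) * (norm \<tau> * exp (norm \<tau>)) ^ n"
      by (simp add: T_def norm_mult norm_divide norm_power power_mult_distrib exp_of_nat_mult)
    also have "\<dots> \<le> C * exp (real n) * (norm \<tau> * exp (norm \<tau>)) ^ n"
      by (intro mult_right_mono mult_mono c power_div_fact_le_exp) (auto simp: C)
    also have "\<dots> = C * r ^ n"
      using exp_of_nat_mult[of n "1::real"] by (simp add: r_def power_mult_distrib)
    finally show ?thesis .
  qed
  have sumT: "summable (\<lambda>n. norm (T n) * exp (real n * norm \<tau>))"
    by (rule summable_comparison_test'[where g = "\<lambda>n. C * r ^ n"])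
       (use r Tbound in \<open>auto intro!: summable_mult summable_geometric\<close>)
  have "(\<lambda>x. norm (F x)) summable_on UNIV \<times> UNIV"
  proof (rule summable_on_SigmaI)
    show "((\<lambda>k. norm (F (n, k))) has_sum (norm (T n) * exp (real n * norm \<tau>))) UNIV" for n
      using norm_summable_imp_has_sum[of "\<lambda>k. norm (F (n, k))"] nrows[of n]
      by (simp add: sums_iff)
    show "(\<lambda>n. norm (T n) * exp (real n * norm \<tau>)) summable_on UNIV"
      by (rule norm_summable_imp_summable_on) (use sumT in simp)
  qed auto
  then have FS: "F summable_on UNIV \<times> UNIV" by (rule abs_summable_summable)
  then obtain S where S: "(F has_sum S) (UNIV \<times> UNIV)" by (auto simp: summable_on_def)
  have rowsF: "((\<lambda>k. F (n, k)) has_sum (T n * exp (of_nat n * \<tau>))) UNIV" for n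
  proof (rule norm_summable_imp_has_sum)
    show "summable (\<lambda>k. norm (F (n, k)))" using nrows[of n] by (simp add: sums_iff)
    show "(\<lambda>k. F (n, k)) sums (T n * exp (of_nat n * \<tau>))"
      using sums_mult[OF rows[of n], of "T n"] by (simp add: F_def)
  qed
  have "((\<lambda>n. T n * exp (of_nat n * \<tau>)) has_sum S) UNIV"
    by (rule has_sum_SigmaD[OF S]) (rule rowsF)
  then have S1: "S = (\<Sum>n. T n * exp (of_nat n * \<tau>))"
    by (metis has_sum_imp_sums sums_unique)
  \<comment> \<open>The map (m, n) to (n, m - n) enumerates the pairs along the diagonals n + k =
    m.\<close>
  have "(F has_sum S) ((\<lambda>(m, n). (n, m - n)) ` (SIGMA m:UNIV. {..m}))"
  proof -
    have "(\<lambda>(m, n). (n, m - n)) ` (SIGMA m:UNIV. {..m}) = (UNIV \<times> UNIV :: (nat \<times> nat) set)"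
    proof (intro equalityI subsetI)
      fix x :: "nat \<times> nat"
      have "x = (\<lambda>(m, n). (n, m - n)) (fst x + snd x, fst x)" by simp
      then show "x \<in> (\<lambda>(m, n). (n, m - n)) ` (SIGMA m:UNIV. {..m})" by (rule image_eqI) simp
    qed simp
    with S show ?thesis by simp
  qed
  then have "((F \<circ> (\<lambda>(m, n). (n, m - n))) has_sum S) (SIGMA m:UNIV. {..m})"
    by (subst (asm) has_sum_reindex) (auto simp: inj_on_def)
  then have "((\<lambda>m. \<Sum>n\<le>m. F (n, m - n)) has_sum S) UNIV"
    by (rule has_sum_SigmaD) (auto intro!: has_sum_finiteI)
  then have "(\<lambda>m. \<Sum>n\<le>m. F (n, m - n)) sums S" by (rule has_sum_imp_sums)
  moreover have "(\<Sum>n\<le>m. F (n, m - n)) = \<tau> ^ m * (\<Sum>n\<le>m. c n * of_nat n ^ m / (fact n * fact (m - n)))" for m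
  proof -
    have "F (n, m - n) = \<tau> ^ m * (c n * of_nat n ^ m / (fact n * fact (m - n)))" if "n \<le> m" for n
    proof -
      have "(of_nat n * \<tau>) ^ n * (of_nat n * \<tau>) ^ (m - n) = (of_nat n * \<tau>) ^ m"
        using that by (simp flip: power_add)
      then show ?thesis by (simp add: F_def T_def power_mult_distrib field_simps)
    qed
    then show ?thesis by (simp add: sum_distrib_left)
  qed
  ultimately show ?thesis by (simp add: S1 T_def)
qed

text \<open>The coefficient of \<tau>^m in the rearranged series is an m-th finite difference of n^m
  divided by m!, hence (-1)^m, and a geometric series is left.\<close>

lemma tree_series_eq:
  fixes \<tau> :: complex
  assumes tau: "norm \<tau> * exp (norm \<tau>) < exp (-1)"
  shows "(\<Sum>n. (-1) ^ n * (of_nat n * \<tau>) ^ n / fact n * exp (of_nat n * \<tau>)) = 1 / (1 + \<tau>)"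
proof -
  have less1: "norm \<tau> < 1"
  proof (rule ccontr)
    assume "\<not> norm \<tau> < 1"
    then have "1 * exp (-1) \<le> norm \<tau> * exp (norm \<tau>)" by (intro mult_mono) auto
    with tau show False by simp
  qed
  have coeff: "(\<Sum>n\<le>m. (-1) ^ n * of_nat n ^ m / (fact n * fact (m - n))) = (-1 :: complex) ^ m" for m
  proof -
    have "(\<Sum>n\<le>m. (-1) ^ n * of_nat n ^ m / (fact n * fact (m - n)))
        = (\<Sum>n\<le>m. (-1) ^ n * of_nat (m choose n) * of_nat n ^ m) / (fact m :: complex)"
      unfolding sum_divide_distrib by (intro sum.cong) (auto simp: binomial_fact field_simps)
    then show ?thesis by (simp add: alternating_binomial_power_sum)
  qed
  have "(\<lambda>m. (- \<tau>) ^ m) sums (\<Sum>n. (-1) ^ n * (of_nat n * \<tau>) ^ n / fact n * exp (of_nat n * \<tau>))"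
    using exp_tree_series_rearrange[of "\<lambda>n. (-1) ^ n" 1, OF _ tau]
    by (simp add: coeff norm_power flip: power_mult_distrib)
  moreover have "(\<lambda>m. (- \<tau>) ^ m) sums (1 / (1 + \<tau>))"
    using geometric_sums[of "- \<tau>"] less1 by simp
  ultimately show ?thesis using sums_unique2 by blast
qed

lemma bounded_inverse_diff_nat:
  fixes a :: complex
  assumes "a \<notin> \<nat>"
  shows "\<exists>C. \<forall>n. norm (1 / (a - of_nat n)) \<le> C"
proof -
  have "(\<lambda>n. 1 / (a - of_nat n)) \<longlonglongrightarrow> 0"
  proof (rule tendsto_divide_0[OF tendsto_const])
    have "filterlim (\<lambda>n. - a + of_nat n) at_infinity sequentially"
      by (rule tendsto_add_filterlim_at_infinity[OF tendsto_const tendsto_of_nat])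
    then show "filterlim (\<lambda>n. a - of_nat n) at_infinity sequentially"
      unfolding filterlim_at_infinity[OF order.refl] by (simp add: norm_minus_commute)
  qed
  then have "Bseq (\<lambda>n. 1 / (a - of_nat n))" by (rule convergent_imp_Bseq[OF convergentI])
  then show ?thesis unfolding Bseq_def by blast
qed

text \<open>Both sides are power series in \<open>lam\<close>. The Cauchy product on the left has
  a^m where the rearranged right side has n^m. Since (a^m - n^m) / (a - n) is a polynomial in n of
  degree below m, the alternating binomial sum removes the difference.\<close>

lemma lower_gamma_series_eq_tree_series:
  fixes a :: complex and lam :: real
  assumes a: "a \<notin> \<nat>" and lam: "0 \<le> lam" "lam * exp lam < exp (-1)"
  shows "exp (lam * a) * (\<Sum>n. (- (lam * a)) ^ n / (fact n * (a - of_nat n)))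
       = (\<Sum>n. (-1) ^ n * (of_nat n * complex_of_real lam) ^ n / fact n * exp (of_nat n * complex_of_real lam) / (a - of_nat n))"
proof -
  obtain C where C: "\<And>n. norm (1 / (a - of_nat n)) \<le> C" using bounded_inverse_diff_nat[OF a] by blast
  have an: "a - of_nat n \<noteq> 0" for n using a by (metis of_nat_in_Nats eq_iff_diff_eq_0)
  define c where "c n = (-1) ^ n / (a - of_nat n)" for n
  have c: "norm (c n) \<le> C" for n using C[of n] by (simp add: c_def norm_divide norm_power)
  have S: "(\<lambda>m. of_real lam ^ m * (\<Sum>n\<le>m. c n * of_nat n ^ m / (fact n * fact (m - n))))
           sums (\<Sum>n. c n * (of_nat n * complex_of_real lam) ^ n / fact n * exp (of_nat n * complex_of_real lam))"
  proof (rule exp_tree_series_rearrange)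
    show "norm (c n) \<le> C" for n by (rule c)
    show "norm (complex_of_real lam) * exp (norm (complex_of_real lam)) < exp (-1)" using lam by simp
  qed
  have key: "(\<Sum>n\<le>m. c n * of_nat n ^ m / (fact n * fact (m - n))) = (\<Sum>n\<le>m. c n * a ^ m / (fact n * fact (m - n)))" for m
  proof -
    have "(\<Sum>n\<le>m. c n * a ^ m / (fact n * fact (m - n))) - (\<Sum>n\<le>m. c n * of_nat n ^ m / (fact n * fact (m - n)))
       = (\<Sum>n\<le>m. (-1) ^ n * of_nat (m choose n) * ((a ^ m - of_nat n ^ m) / (a - of_nat n))) / fact m"
      unfolding sum_subtractf[symmetric] sum_divide_distrib
    proof (intro sum.cong refl)
      have gen: "s / d * A / (p * q) - s / d * B / (p * q) = s * (f / (p * q)) * ((A - B) / d) / f"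
        if "d \<noteq> 0" "f \<noteq> 0" "p \<noteq> 0" "q \<noteq> 0" for s d A B p q f :: complex
        using that by (simp add: field_simps)
      fix n assume "n \<in> {..m}"
      then have "of_nat (m choose n) = (fact m / (fact n * fact (m - n)) :: complex)"
        by (simp add: binomial_fact)
      then show "c n * a ^ m / (fact n * fact (m - n)) - c n * of_nat n ^ m / (fact n * fact (m - n))
          = (-1) ^ n * of_nat (m choose n) * ((a ^ m - of_nat n ^ m) / (a - of_nat n)) / fact m"
        using gen[OF an fact_nonzero fact_nonzero fact_nonzero] by (simp only: c_def)
    qed
    also have "(\<Sum>n\<le>m. (-1) ^ n * of_nat (m choose n) * ((a ^ m - of_nat n ^ m) / (a - of_nat n))) = 0"
    proof (cases m)
      case 0
      then show ?thesis by simp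
    next
      case (Suc q)
      have "(a ^ m - of_nat n ^ m) / (a - of_nat n) = (\<Sum>p<m. a ^ (q - p) * of_nat n ^ p)" for n
      proof -
        have "a ^ m - of_nat n ^ m = - (of_nat n ^ m - a ^ m)" by simp
        also have "\<dots> = (a - of_nat n) * (\<Sum>p<m. of_nat n ^ p * a ^ (q - p))"
          unfolding Suc diff_power_eq_sum by (simp only: minus_mult_left minus_diff_eq)
        finally show ?thesis using an[of n] by (simp add: mult.commute)
      qed
      then have "(\<Sum>n\<le>m. (-1) ^ n * of_nat (m choose n) * ((a ^ m - of_nat n ^ m) / (a - of_nat n)))
         = (\<Sum>n\<le>m. \<Sum>p<m. a ^ (q - p) * ((-1) ^ n * of_nat (m choose n) * of_nat n ^ p))"
        by (simp add: sum_distrib_left mult_ac)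
      also have "\<dots> = (\<Sum>p<m. a ^ (q - p) * (\<Sum>n\<le>m. (-1) ^ n * of_nat (m choose n) * of_nat n ^ p))"
        by (subst sum.swap) (simp add: sum_distrib_left)
      also have "\<dots> = 0" by (intro sum.neutral) (simp add: alternating_binomial_power_sum)
      finally show ?thesis .
    qed
    finally show ?thesis by simp
  qed
  define A where "A n = (lam * a) ^ n / fact n" for n :: nat
  define B where "B n = (- (lam * a)) ^ n / (fact n * (a - of_nat n))" for n :: nat
  have A: "(\<lambda>n. A n) sums exp (lam * a)" "summable (\<lambda>n. norm (A n))"
    using exp_converges[of "lam * a"] summable_norm_exp[of "lam * a"]
    by (simp_all add: A_def scaleR_conv_of_real divide_inverse mult.commute)
  have B: "summable (\<lambda>n. norm (B n))"
  proof (rule summable_comparison_test')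
    show "summable (\<lambda>n. C * norm (A n))" using A by (intro summable_mult)
    show "norm (norm (B n)) \<le> C * norm (A n)" if "n \<ge> 0" for n
      using mult_left_mono[OF C[of n], of "norm (A n)"]
      by (simp add: A_def B_def norm_mult norm_divide norm_power mult.commute)
  qed
  have "(\<lambda>m. \<Sum>n\<le>m. B n * A (m - n)) sums ((\<Sum>n. B n) * (\<Sum>n. A n))"
    by (rule Cauchy_product_sums[OF B A(2)])
  moreover have "(\<Sum>n\<le>m. B n * A (m - n)) = of_real lam ^ m * (\<Sum>n\<le>m. c n * of_nat n ^ m / (fact n * fact (m - n)))" for m
  proof -
    have "B n * A (m - n) = of_real lam ^ m * (c n * a ^ m / (fact n * fact (m - n)))" if "n \<le> m" for n
    proof -
      have "(lam * a) ^ n * (lam * a) ^ (m - n) = (lam * a) ^ m"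
        using that by (simp flip: power_add)
      moreover have "(- (lam * a)) ^ n = (-1) ^ n * (lam * a) ^ n" by (rule power_minus)
      ultimately show ?thesis using an[of n] by (simp add: A_def B_def c_def power_mult_distrib mult_ac)
    qed
    then show ?thesis unfolding key by (simp add: sum_distrib_left)
  qed
  ultimately have "(\<Sum>n. c n * (of_nat n * complex_of_real lam) ^ n / fact n * exp (of_nat n * complex_of_real lam)) = (\<Sum>n. B n) * (\<Sum>n. A n)"
    using S sums_unique2 by simp
  then show ?thesis using sums_unique[OF A(1)] by (simp add: B_def c_def mult_ac)
qed

section \<open>The incomplete gamma function\<close>

lemma set_integrable_power_times_exp:
  fixes c :: real
  assumes "c > 0"
  shows "set_integrable lborel {0<..} (\<lambda>t. t ^ n * exp (- c * t))"
proof -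
  \<comment> \<open>With parameter Suc n the modulus of the Gamma integrand is t^n e^(-c t).\<close>
  have "(\<lambda>t. complex_of_real t powr (of_nat (Suc n) - 1) / of_real (exp (c * t))) absolutely_integrable_on {0<..}"
    by (rule absolutely_integrable_Gamma_integral) (use assms in auto)
  then have "set_integrable lebesgue {0<..} (\<lambda>t. norm (complex_of_real t powr (of_nat (Suc n) - 1) / of_real (exp (c * t))))"
    by (rule set_integrable_norm)
  also have "?this \<longleftrightarrow> set_integrable lebesgue {0<..} (\<lambda>t. t ^ n * exp (- c * t))"
    by (intro set_integrable_cong)
       (auto simp: norm_mult norm_power norm_inverse exp_minus divide_inverse)
  finally have "integrable lebesgue (\<lambda>t. indicator {0<..} t *\<^sub>R (t ^ n * exp (- c * t)))"
    by (simp add: set_integrable_def)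
  then show ?thesis unfolding set_integrable_def
    by (subst (asm) integrable_completion) auto
qed

lemma set_integrable_continuous_dominated:
  fixes f :: "real \<Rightarrow> complex" and g :: "real \<Rightarrow> real"
  assumes "continuous_on {0<..} f" "set_integrable lborel {0<..} g"
    "\<And>t. t > 0 \<Longrightarrow> norm (f t) \<le> g t"
  shows "set_integrable lborel {0<..} f"
proof (rule set_integrable_bound[OF assms(2)])
  show "set_borel_measurable lborel {0<..} f"
    unfolding set_borel_measurable_def measurable_lborel2
    by (rule borel_measurable_continuous_on_indicator[OF _ assms(1)]) simp
  show "AE t in lborel. t \<in> {0<..} \<longrightarrow> norm (f t) \<le> norm (g t)"
    using assms(3) by (intro AE_I2 impI) (force intro: order.trans[OF _ abs_ge_self])
qed

lemma set_integral_tendsto_dominated: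
  fixes f :: "nat \<Rightarrow> real \<Rightarrow> complex" and w :: "real \<Rightarrow> real"
  assumes "\<And>j. set_borel_measurable lborel {0<..} (f j)" "set_borel_measurable lborel {0<..} g"
    and "set_integrable lborel {0<..} w"
    and "\<And>t. t > 0 \<Longrightarrow> (\<lambda>j. f j t) \<longlonglongrightarrow> g t"
    and "\<And>j t. t > 0 \<Longrightarrow> norm (f j t) \<le> w t"
  shows "(\<lambda>j. LBINT t:{0<..}. f j t) \<longlonglongrightarrow> (LBINT t:{0<..}. g t)"
  unfolding set_lebesgue_integral_def
proof (rule integral_dominated_convergence[where w = "\<lambda>t. indicator {0<..} t *\<^sub>R w t"])
  show "AE t in lborel. (\<lambda>j. indicator {0<..} t *\<^sub>R f j t) \<longlonglongrightarrow> indicator {0<..} t *\<^sub>R g t"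
    using assms(4) by (intro AE_I2) (auto simp: indicator_def)
  show "AE t in lborel. norm (indicator {0<..} t *\<^sub>R f j t) \<le> indicator {0<..} t *\<^sub>R w t" for j
    using assms(5) by (intro AE_I2) (auto simp: indicator_def)
qed (use assms(1-3) in \<open>simp_all add: set_borel_measurable_def set_integrable_def\<close>)

text \<open>A growth of exp (norm w / 2) leaves half of the decay of exp (- w) far out on a
  horizontal ray. The constant is uniform in s as well as in w, because the exponent varies when
  integer values of a are reached as limits.\<close>

lemma norm_powr_le_exp_half:
  assumes "0 < m" "m \<le> 1"
  obtains K where "K > 0" "\<And>s w. norm s \<le> B \<Longrightarrow> m \<le> norm w \<Longrightarrow> norm (w powr s :: complex) \<le> K * exp (norm w / 2)"
proof -
  \<comment> \<open>Chosen so that |B| / c \<le> 1/2: multiplied by |B|, the inequality ln y \<le> y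
    / c + ln c then costs only y / 2 plus a constant. The summand 1 keeps c positive when B =
    0.\<close>
  define c where "c = 2 * \<bar>B\<bar> + 1"
  define L where "L = \<bar>B\<bar> * (\<bar>ln m\<bar> + \<bar>ln c\<bar>) + \<bar>B\<bar> * pi"
  have "norm (w powr s) \<le> exp L * exp (norm w / 2)" if s: "norm s \<le> B" and w: "m \<le> norm w" for s w :: complex
  proof -
    have w0: "w \<noteq> 0" "norm w > 0" using w assms by auto
    have c: "c \<ge> 1" "\<bar>B\<bar> \<le> c / 2" by (auto simp: c_def)
    have "ln (norm w) = ln (norm w / c) + ln c" using w0 c by (subst ln_div) auto
    also have "\<dots> \<le> norm w / c + \<bar>ln c\<bar>"
      using ln_le_minus_one[of "norm w / c"] w0 c by simp
    finally have 1: "ln (norm w) \<le> norm w / c + \<bar>ln c\<bar>" .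
    have 2: "ln (norm w) \<ge> - \<bar>ln m\<bar>"
      using w assms ln_mono[of m "norm w"] by linarith
    have "norm w / c \<ge> 0" using c by simp
    then have "\<bar>ln (norm w)\<bar> \<le> norm w / c + (\<bar>ln m\<bar> + \<bar>ln c\<bar>)" using 1 2 by linarith
    moreover have "\<bar>Re s\<bar> \<le> \<bar>B\<bar>" "\<bar>Im s\<bar> \<le> \<bar>B\<bar>" using s abs_Re_le_cmod[of s] abs_Im_le_cmod[of s] by linarith+
    ultimately have 3: "\<bar>Re s * ln (norm w)\<bar> \<le> \<bar>B\<bar> * (norm w / c + (\<bar>ln m\<bar> + \<bar>ln c\<bar>))"
      unfolding abs_mult by (intro mult_mono) auto
    have "\<bar>B\<bar> * (norm w / c) \<le> norm w / 2"
      using c mult_right_mono[of "\<bar>B\<bar>" "c / 2" "norm w / c"] by simp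
    with 3 have 4: "Re s * ln (norm w) \<le> norm w / 2 + \<bar>B\<bar> * (\<bar>ln m\<bar> + \<bar>ln c\<bar>)"
      unfolding distrib_left by linarith
    have "\<bar>Im (Ln w)\<bar> \<le> pi" using mpi_less_Im_Ln[OF w0(1)] Im_Ln_le_pi[OF w0(1)] by linarith
    then have "\<bar>Im s * Im (Ln w)\<bar> \<le> \<bar>B\<bar> * pi"
      unfolding abs_mult using \<open>\<bar>Im s\<bar> \<le> \<bar>B\<bar>\<close> by (intro mult_mono) auto
    then have 5: "- (Im s * Im (Ln w)) \<le> \<bar>B\<bar> * pi" by linarith
    have "norm (w powr s) = exp (Re s * ln (norm w) - Im s * Im (Ln w))"
      using w0 by (simp add: powr_def)
    also have "\<dots> \<le> exp (L + norm w / 2)" using 4 5 by (simp add: L_def)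
    finally show ?thesis by (simp add: exp_add)
  qed
  then show thesis using that[of "exp L"] by simp
qed

section \<open>The lower incomplete gamma function as a power series\<close>

definition lower_gamma_coeff :: "complex \<Rightarrow> nat \<Rightarrow> complex" where
  "lower_gamma_coeff s n = (-1) ^ n / (fact n * (s + of_nat n))"

text \<open>The factor w^(-s) gamma(s, w) of the lower incomplete gamma function, entire in w. The
  series replaces the integral over (0, w), which diverges for Re s \<le> 0, whereas s = - a with Re
  a > 0 is the case of interest.\<close>

definition lower_gamma_series :: "complex \<Rightarrow> complex \<Rightarrow> complex" where
  "lower_gamma_series s w = (\<Sum>n. lower_gamma_coeff s n * w ^ n)"

lemma summable_lower_gamma: "summable (\<lambda>n. lower_gamma_coeff s n * w ^ n)"
proof (rule summable_comparison_test_ev)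
  have "filterlim (\<lambda>n. s + of_nat n) at_infinity sequentially"
    by (rule tendsto_add_filterlim_at_infinity[OF tendsto_const tendsto_of_nat])
  then have "eventually (\<lambda>n. norm (s + of_nat n) \<ge> 1) sequentially"
    unfolding filterlim_at_infinity[OF order.refl] by (metis zero_less_one)
  then show "eventually (\<lambda>n. norm (lower_gamma_coeff s n * w ^ n) \<le> norm w ^ n / fact n) sequentially"
  proof eventually_elim
    case (elim n)
    then have "norm w ^ n / (fact n * norm (s + of_nat n)) \<le> norm w ^ n / (fact n * 1)"
      by (intro divide_left_mono mult_left_mono mult_pos_pos) auto
    then show ?case by (simp add: lower_gamma_coeff_def norm_mult norm_divide norm_power)
  qed
  show "summable (\<lambda>n. norm w ^ n / fact n)"
    using summable_exp[of "norm w"] by (simp add: divide_inverse mult.commute)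
qed

lemma diffs_lower_gamma_coeff: "diffs (lower_gamma_coeff s) n = - lower_gamma_coeff (s + 1) n"
proof -
  have d: "s + of_nat (Suc n) = s + 1 + of_nat n" by simp
  have gen: "M * (- 1 * e / ((M * F) * d)) = - (e / (F * d))" if "M \<noteq> 0" for M F d e :: complex
    using that by simp
  have "of_nat (Suc n) \<noteq> (0 :: complex)" by (rule of_nat_neq_0)
  then show ?thesis
    unfolding diffs_def lower_gamma_coeff_def fact_Suc power_Suc of_nat_mult of_nat_fact d by (rule gen)
qed

lemma has_field_derivative_lower_gamma_series:
  "(lower_gamma_series s has_field_derivative - lower_gamma_series (s + 1) w) (at w)"
proof -
  have "((\<lambda>w. \<Sum>n. lower_gamma_coeff s n * w ^ n) has_field_derivative
      (\<Sum>n. - (lower_gamma_coeff (s + 1) n * w ^ n))) (at w)"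
    using termdiffs_strong_converges_everywhere[OF summable_lower_gamma, of s w]
    unfolding diffs_lower_gamma_coeff mult_minus_left .
  then show ?thesis
    unfolding suminf_minus[OF summable_lower_gamma] lower_gamma_series_def[abs_def] .
qed

lemma continuous_on_lower_gamma_series: "continuous_on A (lower_gamma_series s)"
  by (rule DERIV_continuous_on) (rule has_field_derivative_at_within[OF has_field_derivative_lower_gamma_series])

text \<open>This is integration by parts for gamma(s + 1, w) with the powers divided out.
  Coefficient by coefficient it amounts to n + 1 = (s + n + 1) - s.\<close>

lemma lower_gamma_series_rec:
  assumes "- s \<notin> \<nat>"
  shows "w * lower_gamma_series (s + 1) w = s * lower_gamma_series s w - exp (- w)"
proof -
  have nz: "s + of_nat n \<noteq> 0" for n
    using assms by (metis add.commute minus_unique of_nat_in_Nats)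
  have "(\<lambda>n. lower_gamma_coeff (s + 1) n * w ^ n) sums lower_gamma_series (s + 1) w"
    unfolding lower_gamma_series_def by (intro summable_sums summable_lower_gamma)
  then have "(\<lambda>n. w * (lower_gamma_coeff (s + 1) n * w ^ n)) sums (w * lower_gamma_series (s + 1) w)"
    by (rule sums_mult)
  moreover have "w * (lower_gamma_coeff (s + 1) n * w ^ n)
     = s * (lower_gamma_coeff s (Suc n) * w ^ Suc n) - (- w) ^ Suc n / fact (Suc n)" for n
  proof -
    have d: "s + 1 + of_nat n = s + of_nat (Suc n)" by simp
    have gen: "w * (e / (F * d) * p) = (d - M) * ((- 1 * e) / ((M * F) * d) * (w * p)) - (- w * (e * p)) / (M * F)"
      if "d \<noteq> 0" "F \<noteq> 0" "M \<noteq> 0" for e F d p M :: complex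
      using that by (simp add: field_simps)
    have "(- w) ^ n = (-1) ^ n * w ^ n" by (rule power_minus)
    then show ?thesis
      using gen[OF nz[of "Suc n"] fact_nonzero[of n], of "of_nat (Suc n)" "(-1) ^ n" "w ^ n"]
      unfolding lower_gamma_coeff_def d fact_Suc power_Suc of_nat_mult of_nat_fact by (simp del: of_nat_Suc)
  qed
  ultimately have 1: "(\<lambda>n. s * (lower_gamma_coeff s (Suc n) * w ^ Suc n) - (- w) ^ Suc n / fact (Suc n))
      sums (w * lower_gamma_series (s + 1) w)" by simp
  have "(\<lambda>n. s * (lower_gamma_coeff s n * w ^ n) - (- w) ^ n / fact n) sums (s * lower_gamma_series s w - exp (- w))"
    using exp_converges[of "- w"] unfolding lower_gamma_series_def
    by (intro sums_diff sums_mult summable_sums summable_lower_gamma)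
       (simp add: scaleR_conv_of_real divide_inverse mult.commute)
  \<comment> \<open>The dropped term n = 0 is s / s - 1 = 0.\<close>
  then have "(\<lambda>n. s * (lower_gamma_coeff s (Suc n) * w ^ Suc n) - (- w) ^ Suc n / fact (Suc n))
      sums (s * lower_gamma_series s w - exp (- w))"
    by (subst sums_Suc_iff) (use nz[of 0] in \<open>simp add: lower_gamma_coeff_def\<close>)
  with 1 show ?thesis using sums_unique2 by blast
qed

definition lower_gamma :: "complex \<Rightarrow> complex \<Rightarrow> complex" where
  "lower_gamma s w = w powr s * lower_gamma_series s w"

lemma has_field_derivative_lower_gamma:
  assumes "- s \<notin> \<nat>" "w \<notin> \<real>\<^sub>\<le>\<^sub>0"
  shows "(lower_gamma s has_field_derivative w powr (s - 1) * exp (- w)) (at w)"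
proof -
  have "w \<noteq> 0" using assms by auto
  then have p: "w powr s = w * w powr (s - 1)" by (simp add: powr_diff)
  have "(lower_gamma s has_field_derivative
      s * w powr (s - 1) * lower_gamma_series s w - lower_gamma_series (s + 1) w * w powr s) (at w)"
    unfolding lower_gamma_def[abs_def] using assms
    by (auto intro!: derivative_eq_intros has_field_derivative_lower_gamma_series)
  also have "s * w powr (s - 1) * lower_gamma_series s w - lower_gamma_series (s + 1) w * w powr s
     = w powr (s - 1) * (s * lower_gamma_series s w - w * lower_gamma_series (s + 1) w)"
    unfolding p by (simp add: algebra_simps)
  also have "\<dots> = w powr (s - 1) * exp (- w)" by (simp add: lower_gamma_series_rec assms)
  finally show ?thesis .
qed

lemma lower_gamma_rec:
  assumes "- s \<notin> \<nat>" "w \<noteq> 0"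
  shows "lower_gamma (s + 1) w = s * lower_gamma s w - w powr s * exp (- w)"
proof -
  have "lower_gamma (s + 1) w = w powr s * (w * lower_gamma_series (s + 1) w)"
    using assms(2) by (simp add: lower_gamma_def powr_add)
  then show ?thesis
    by (simp add: lower_gamma_series_rec[OF assms(1)] lower_gamma_def right_diff_distrib mult_ac)
qed

text \<open>For Re s > 0 the function is Euler's integral cut off at x. The recurrence carries the
  limit to the left, one unit of Re s at a time, because its boundary term x^s e^(-x) vanishes at
  infinity.\<close>

lemma tendsto_lower_gamma_of_real:
  assumes "s \<notin> \<int>\<^sub>\<le>\<^sub>0"
  shows "((\<lambda>x. lower_gamma s (complex_of_real x)) \<longlongrightarrow> Gamma s) at_top"
proof -
  have base: "((\<lambda>x. lower_gamma s (complex_of_real x)) \<longlongrightarrow> Gamma s) at_top" if s: "Re s > 0" for s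
  proof -
    define f where "f t = complex_of_real t powr (s - 1) / of_real (exp t)" for t
    have ns: "- s \<notin> \<nat>" using s by (auto simp: Nats_def complex_eq_iff)
    have "f absolutely_integrable_on {0..}"
    proof -
      have "f absolutely_integrable_on {0<..}"
        using absolutely_integrable_Gamma_integral'[OF s] by (simp add: f_def[abs_def])
      then show ?thesis
        by (subst absolutely_integrable_spike_set_eq[of _ "{0<..}"]) (auto intro: negligible_subset[of "{0}"])
    qed
    then have "((\<lambda>x. LINT t:{0..x}|lebesgue. f t) \<longlongrightarrow> (LINT t:{0..}|lebesgue. f t)) at_top"
      by (intro tendsto_set_lebesgue_integral_at_top) auto
    also have "(LINT t:{0..}|lebesgue. f t) = Gamma s"
      using Gamma_integral_complex[OF s] \<open>f absolutely_integrable_on {0..}\<close>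
      by (simp add: set_lebesgue_integral_eq_integral f_def[abs_def] integral_unique)
    finally have lim: "((\<lambda>x. LINT t:{0..x}|lebesgue. f t) \<longlongrightarrow> Gamma s) at_top" .
    moreover have "(LINT t:{0..x}|lebesgue. f t) = lower_gamma s (complex_of_real x)" if "x > 0" for x
    proof -
      have "f absolutely_integrable_on {0..x}"
        by (rule set_integrable_subset[OF \<open>f absolutely_integrable_on {0..}\<close>]) auto
      moreover have "(f has_integral (lower_gamma s (complex_of_real x) - lower_gamma s (complex_of_real 0))) {0..x}"
      proof (rule fundamental_theorem_of_calculus_interior)
        have "continuous_on {0..x} (\<lambda>t. lower_gamma_series s (complex_of_real t))"
          by (rule continuous_on_compose2[OF continuous_on_lower_gamma_series[of UNIV]]) (auto intro!: continuous_intros)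
        then show "continuous_on {0..x} (\<lambda>t. lower_gamma s (complex_of_real t))"
          unfolding lower_gamma_def using s by (intro continuous_intros) auto
        show "((\<lambda>t. lower_gamma s (complex_of_real t)) has_vector_derivative f t) (at t)" if "t \<in> {0<..<x}" for t
          using has_vector_derivative_real_field[OF has_field_derivative_lower_gamma[OF ns, of "of_real t"]] that
          by (simp add: f_def exp_minus divide_inverse exp_of_real[symmetric])
      qed (use \<open>x > 0\<close> in auto)
      ultimately show ?thesis using s
        by (simp add: set_lebesgue_integral_eq_integral integral_unique lower_gamma_def)
    qed
    ultimately show ?thesis
      by (rule Lim_transform_eventually[OF _ eventually_mono[OF eventually_gt_at_top[of 0]]])
  qed
  have main: "((\<lambda>x. lower_gamma s (complex_of_real x)) \<longlongrightarrow> Gamma s) at_top"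
    if "s \<notin> \<int>\<^sub>\<le>\<^sub>0" "Re s + real n > 0" for n s
    using that
  proof (induction n arbitrary: s)
    case 0
    then show ?case by (intro base) simp
  next
    case (Suc n)
    have ns: "- s \<notin> \<nat>" using Suc.prems(1)
      by (simp add: uminus_in_Nats_iff)
    have s0: "s \<noteq> 0" using Suc.prems(1) by auto
    have "s + 1 \<notin> \<int>\<^sub>\<le>\<^sub>0" using Suc.prems(1) plus_one_in_nonpos_Ints_imp by blast
    then have "((\<lambda>x. lower_gamma (s + 1) (complex_of_real x)) \<longlongrightarrow> Gamma (s + 1)) at_top"
      using Suc.prems by (intro Suc.IH) auto
    moreover have "((\<lambda>x. complex_of_real x powr s * exp (- complex_of_real x)) \<longlongrightarrow> 0) at_top"
    proof (rule Lim_null_comparison)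
      show "eventually (\<lambda>x. norm (complex_of_real x powr s * exp (- complex_of_real x)) \<le> x powr Re s * exp (- x)) at_top"
        using eventually_gt_at_top[of 0]
        by eventually_elim (simp add: norm_mult norm_powr_real_powr)
      show "((\<lambda>x. x powr Re s * exp (- x)) \<longlongrightarrow> 0) at_top" by real_asymp
    qed
    ultimately have "((\<lambda>x. (lower_gamma (s + 1) (complex_of_real x) + complex_of_real x powr s * exp (- complex_of_real x)) / s)
        \<longlongrightarrow> (Gamma (s + 1) + 0) / s) at_top" by (intro tendsto_intros) (use s0 in auto)
    moreover have "Gamma (s + 1) = s * Gamma s" using Gamma_plus1[OF Suc.prems(1)] by simp
    ultimately have "((\<lambda>x. (lower_gamma (s + 1) (complex_of_real x) + complex_of_real x powr s * exp (- complex_of_real x)) / s)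
        \<longlongrightarrow> Gamma s) at_top" using s0 by simp
    then show ?case
    proof (rule Lim_transform_eventually)
      show "eventually (\<lambda>x. (lower_gamma (s + 1) (complex_of_real x) + complex_of_real x powr s * exp (- complex_of_real x)) / s
          = lower_gamma s (complex_of_real x)) at_top"
        using eventually_gt_at_top[of 0]
        by eventually_elim (use s0 ns in \<open>simp add: lower_gamma_rec\<close>)
    qed
  qed
  obtain n where "- Re s < real n" using reals_Archimedean2 by blast
  then have "Re s + real n > 0" by simp
  with main[OF assms] show ?thesis by blast
qed

section \<open>Horizontal rays in the cut plane\<close>

lemma horizontal_ray_away_from_zero:
  assumes "z \<notin> \<real>\<^sub>\<le>\<^sub>0"
  obtains m where "0 < m" "m \<le> 1" "\<And>u. u \<ge> 0 \<Longrightarrow> m \<le> norm (z + complex_of_real u)"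
proof (cases "Im z = 0")
  case True
  then have z: "Re z > 0" using assms by (auto simp: complex_nonpos_Reals_iff)
  have "min 1 (Re z) \<le> norm (z + complex_of_real u)" if "u \<ge> 0" for u
    using complex_Re_le_cmod[of "z + complex_of_real u"] that by simp
  then show ?thesis using z that[of "min 1 (Re z)"] by simp
next
  case False
  have "min 1 \<bar>Im z\<bar> \<le> norm (z + complex_of_real u)" for u
    using abs_Im_le_cmod[of "z + complex_of_real u"] by simp
  then show ?thesis using False that[of "min 1 \<bar>Im z\<bar>"] by simp
qed

lemma horizontal_ray_not_nonpos_Reals:
  assumes "z \<notin> \<real>\<^sub>\<le>\<^sub>0" "u \<ge> 0"
  shows "z + complex_of_real u \<notin> \<real>\<^sub>\<le>\<^sub>0"
  using assms by (auto simp: complex_nonpos_Reals_iff)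

lemma set_integrable_incGamma:
  assumes "z \<notin> \<real>\<^sub>\<le>\<^sub>0"
  shows "set_integrable lborel {0<..} (\<lambda>u. (z + complex_of_real u) powr (s - 1) * exp (- (z + complex_of_real u)))"
proof -
  obtain m where m: "0 < m" "m \<le> 1" "\<And>u. u \<ge> 0 \<Longrightarrow> m \<le> norm (z + complex_of_real u)"
    using horizontal_ray_away_from_zero[OF assms] by blast
  obtain K where K: "K > 0" "\<And>q w. norm q \<le> norm (s - 1) \<Longrightarrow> m \<le> norm w \<Longrightarrow> norm (w powr q :: complex) \<le> K * exp (norm w / 2)"
    using norm_powr_le_exp_half[OF m(1,2)] by metis
  show ?thesis
  proof (rule set_integrable_continuous_dominated)
    show "set_integrable lborel {0<..} (\<lambda>t. K * exp (norm z / 2 - Re z) * (t ^ 0 * exp (- (1 / 2) * t)))"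
      by (intro set_integrable_mult_right set_integrable_power_times_exp) auto
    show "continuous_on {0<..} (\<lambda>u. (z + complex_of_real u) powr (s - 1) * exp (- (z + complex_of_real u)))"
    proof -
      have nr: "(0 \<le> Re z + u \<or> Im z \<noteq> 0) \<and> z + complex_of_real u \<noteq> 0" if "0 < u" for u
      proof -
        have "z + complex_of_real u \<notin> \<real>\<^sub>\<le>\<^sub>0"
          using horizontal_ray_not_nonpos_Reals[OF assms, of u] that by simp
        then show ?thesis unfolding complex_nonpos_Reals_iff complex_eq_iff by simp linarith
      qed
      show ?thesis by (intro continuous_intros) (use nr in force)+
    qed
    fix u :: real assume "u > 0"
    then have u: "u \<ge> 0" by simp
    have "norm ((z + complex_of_real u) powr (s - 1) * exp (- (z + complex_of_real u)))
       \<le> K * exp (norm (z + complex_of_real u) / 2) * exp (- (Re z + u))"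
      unfolding norm_mult using K(2)[OF order.refl m(3)[OF u]] by (intro mult_mono) (use K(1) in auto)
    also have "\<dots> \<le> K * exp ((norm z + u) / 2) * exp (- (Re z + u))"
      using norm_triangle_ineq[of z "complex_of_real u"] u K(1) by (intro mult_mono) auto
    also have "\<dots> = K * exp (norm z / 2 - Re z) * (u ^ 0 * exp (- (1 / 2) * u))"
      unfolding power_0 mult_1_left mult.assoc mult_exp_exp by (simp add: field_simps)
    finally show "norm ((z + complex_of_real u) powr (s - 1) * exp (- (z + complex_of_real u)))
      \<le> K * exp (norm z / 2 - Re z) * (u ^ 0 * exp (- (1 / 2) * u))" .
  qed
qed

text \<open>The point is compared with the real point of the same abscissa. A vertical segment of
  fixed length joins them, and on it the derivative w^(s-1) e^(-w) is exponentially small.\<close>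

lemma tendsto_lower_gamma_horizontal:
  assumes s: "s \<notin> \<int>\<^sub>\<le>\<^sub>0"
  shows "((\<lambda>u. lower_gamma s (z + complex_of_real u)) \<longlongrightarrow> Gamma s) at_top"
proof -
  have ns: "- s \<notin> \<nat>" using s by (simp add: uminus_in_Nats_iff)
  obtain K where K: "K > 0" "\<And>q w. norm q \<le> norm (s - 1) \<Longrightarrow> 1 \<le> norm w \<Longrightarrow> norm (w powr q :: complex) \<le> K * exp (norm w / 2)"
    using norm_powr_le_exp_half[of 1 "norm (s - 1)"] by (metis order.refl zero_less_one)
  define v where "v u = Re z + u" for u
  have lim: "((\<lambda>u. lower_gamma s (of_real (v u))) \<longlongrightarrow> Gamma s) at_top"
    by (rule filterlim_compose[OF tendsto_lower_gamma_of_real[OF s]])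
       (unfold v_def, rule filterlim_tendsto_add_at_top[OF tendsto_const filterlim_ident])
  have "((\<lambda>u. lower_gamma s (z + complex_of_real u) - lower_gamma s (of_real (v u))) \<longlongrightarrow> 0) at_top"
  proof (rule Lim_null_comparison)
    show "eventually (\<lambda>u. norm (lower_gamma s (z + complex_of_real u) - lower_gamma s (of_real (v u)))
        \<le> K * exp (\<bar>Im z\<bar> / 2) * exp (- (v u) / 2) * \<bar>Im z\<bar>) at_top"
      using eventually_ge_at_top[of "1 - Re z"]
    proof eventually_elim
      case (elim u)
      define S where "S = {w. Re w = v u \<and> \<bar>Im w\<bar> \<le> \<bar>Im z\<bar>}"
      have v: "v u \<ge> 1" using elim by (simp add: v_def)
      have "norm (lower_gamma s (z + complex_of_real u) - lower_gamma s (of_real (v u)))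
         \<le> K * exp (\<bar>Im z\<bar> / 2) * exp (- (v u) / 2) * norm ((z + complex_of_real u) - of_real (v u))"
      proof (rule field_differentiable_bound)
        have "S = {w. Re w \<le> v u} \<inter> {w. Re w \<ge> v u} \<inter> {w. Im w \<le> \<bar>Im z\<bar>} \<inter> {w. Im w \<ge> - \<bar>Im z\<bar>}"
          by (auto simp: S_def)
        then show "convex S"
          by (simp only:) (intro convex_Int convex_halfspace_Im_le convex_halfspace_Im_ge
                                 convex_halfspace_Re_le convex_halfspace_Re_ge)
        fix w assume "w \<in> S"
        then have w: "Re w = v u" "\<bar>Im w\<bar> \<le> \<bar>Im z\<bar>" by (auto simp: S_def)
        have "w \<notin> \<real>\<^sub>\<le>\<^sub>0" using w v by (auto simp: complex_nonpos_Reals_iff)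
        then show "(lower_gamma s has_field_derivative w powr (s - 1) * exp (- w)) (at w within S)"
          by (rule has_field_derivative_at_within[OF has_field_derivative_lower_gamma[OF ns]])
        have nw: "norm w \<le> v u + \<bar>Im z\<bar>" "1 \<le> norm w"
          using cmod_le[of w] complex_Re_le_cmod[of w] w v by linarith+
        have "norm (w powr (s - 1) * exp (- w)) \<le> K * exp ((v u + \<bar>Im z\<bar>) / 2) * exp (- v u)"
          unfolding norm_mult
        proof (intro mult_mono)
          have "norm (w powr (s - 1)) \<le> K * exp (norm w / 2)" using K(2) nw by blast
          also have "\<dots> \<le> K * exp ((v u + \<bar>Im z\<bar>) / 2)" using nw K(1) by simp
          finally show "norm (w powr (s - 1)) \<le> K * exp ((v u + \<bar>Im z\<bar>) / 2)" .
        qed (use w K(1) in auto)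
        also have "\<dots> = K * exp (\<bar>Im z\<bar> / 2) * exp (- (v u) / 2)"
          unfolding power_0 mult_1_left mult.assoc mult_exp_exp by (simp add: field_simps)
        finally show "norm (w powr (s - 1) * exp (- w)) \<le> K * exp (\<bar>Im z\<bar> / 2) * exp (- (v u) / 2)" .
      qed (auto simp: S_def v_def)
      also have "(z + complex_of_real u) - of_real (v u) = \<i> * of_real (Im z)"
        by (simp add: v_def complex_eq_iff)
      finally show ?case by (simp add: norm_mult)
    qed
    show "((\<lambda>u. K * exp (\<bar>Im z\<bar> / 2) * exp (- (v u) / 2) * \<bar>Im z\<bar>) \<longlongrightarrow> 0) at_top"
      unfolding v_def by real_asymp
  qed
  from tendsto_add[OF this lim] show ?thesis by simp
qed

text \<open>Along the horizontal path in \<open>incGamma\<close>, \<open>lower_gamma s\<close> is a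
  primitive of the integrand; its value at the far end is Gamma s.\<close>

lemma incGamma_eq_Gamma_minus_lower_gamma:
  assumes s: "s \<notin> \<int>\<^sub>\<le>\<^sub>0" and z: "z \<notin> \<real>\<^sub>\<le>\<^sub>0"
  shows "incGamma s z = Gamma s - lower_gamma s z"
proof -
  have ns: "- s \<notin> \<nat>" using s by (simp add: uminus_in_Nats_iff)
  define f where "f u = (z + complex_of_real u) powr (s - 1) * exp (- (z + complex_of_real u))" for u
  have ein: "einterval 0 \<infinity> = {0<..}" by (auto simp: einterval_def zero_ereal_def)
  have der: "((\<lambda>u. lower_gamma s (z + complex_of_real u)) has_vector_derivative f u) (at u)" if "u \<ge> 0" for u
  proof -
    have shift: "((\<lambda>w. z + w) has_field_derivative 1) (at (complex_of_real u))"
      by (auto intro!: derivative_eq_intros)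
    have "((\<lambda>w. lower_gamma s (z + w)) has_field_derivative f u) (at (complex_of_real u))"
      using DERIV_chain2[OF has_field_derivative_lower_gamma[OF ns horizontal_ray_not_nonpos_Reals[OF z that]] shift]
      unfolding f_def mult_1_right .
    from has_vector_derivative_real_field[OF this] show ?thesis .
  qed
  have "(LBINT u=0..\<infinity>. f u) = Gamma s - lower_gamma s z"
  proof (rule interval_integral_FTC_integrable)
    show "((\<lambda>u. lower_gamma s (z + complex_of_real u)) has_vector_derivative f u) (at u)"
      if "0 < ereal u" "ereal u < \<infinity>" for u using der that by simp
    show "isCont f u" if "0 < ereal u" "ereal u < \<infinity>" for u
      unfolding f_def using horizontal_ray_not_nonpos_Reals[OF z, of u] that
      by (intro continuous_intros) auto
    show "set_integrable lborel (einterval 0 \<infinity>) f"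
      unfolding ein f_def by (rule set_integrable_incGamma[OF z])
    have "((\<lambda>u. lower_gamma s (z + complex_of_real u)) \<longlongrightarrow> lower_gamma s (z + complex_of_real 0)) (at 0)"
      using has_vector_derivative_continuous[OF der[of 0]] by (simp add: isCont_def)
    then have "((\<lambda>u. lower_gamma s (z + complex_of_real u)) \<longlongrightarrow> lower_gamma s z) (at_right 0)"
      by (simp add: filterlim_at_split)
    then show "(((\<lambda>u. lower_gamma s (z + complex_of_real u)) \<circ> real_of_ereal) \<longlongrightarrow> lower_gamma s z) (at_right 0)"
      unfolding zero_ereal_def by (simp add: ereal_tendsto_simps)
    show "(((\<lambda>u. lower_gamma s (z + complex_of_real u)) \<circ> real_of_ereal) \<longlongrightarrow> Gamma s) (at_left \<infinity>)"
      using tendsto_lower_gamma_horizontal[OF s, of z] by (simp add: ereal_tendsto_simps)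
  qed auto
  then show ?thesis
    by (simp add: interval_lebesgue_integral_def ein incGamma_def f_def)
qed

section \<open>The coefficients\<close>

text \<open>The i-th iterate of X d/dX applied to 1 / (1 + W(X)), where W inverts \<tau> e^\<tau>.
  For i = 0 the term n = 0 is 1, by 0^0 = 1.\<close>

definition tree_power_sum :: "nat \<Rightarrow> complex \<Rightarrow> complex" where
  "tree_power_sum i X = (\<Sum>n. of_nat n ^ i * (- of_nat n) ^ n / fact n * X ^ n)"

lemma summable_tree_power_sum:
  fixes X :: complex
  assumes "norm X < exp (-1)"
  shows "summable (\<lambda>n. norm (of_nat n ^ i * (- of_nat n) ^ n / fact n * X ^ n))"
proof (rule summable_comparison_test')
  show "summable (\<lambda>n. real n ^ i * (exp 1 * norm X) ^ n)"
    by (rule summable_power_mult_powser) (use assms in \<open>auto simp: exp_minus field_simps\<close>)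
  show "norm (norm (of_nat n ^ i * (- of_nat n) ^ n / fact n * X ^ n)) \<le> real n ^ i * (exp 1 * norm X) ^ n"
    if "n \<ge> 0" for n
  proof -
    have "norm (of_nat n ^ i * (- of_nat n) ^ n / fact n * X ^ n)
        = real n ^ i * (real n ^ n / fact n) * norm X ^ n"
      by (simp add: norm_mult norm_divide norm_power)
    also have "\<dots> \<le> real n ^ i * exp (real n) * norm X ^ n"
      by (intro mult_right_mono mult_left_mono power_div_fact_le_exp) auto
    also have "\<dots> = real n ^ i * (exp 1 * norm X) ^ n"
      using exp_of_nat_mult[of n "1::real"] by (simp add: power_mult_distrib)
    finally show ?thesis by simp
  qed
qed

text \<open>The operator X d/dX raises the index by one. The derivative D is described through X *
  D, which keeps X = 0 included.\<close>

lemma has_field_derivative_tree_power_sum: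
  assumes X: "norm X < exp (-1)"
  obtains D where "(tree_power_sum i has_field_derivative D) (at X)" "X * D = tree_power_sum (Suc i) X"
proof
  define c :: "nat \<Rightarrow> complex" where "c n = of_nat n ^ i * (- of_nat n) ^ n / fact n" for n
  have c: "summable (\<lambda>n. c n * X ^ n)" if "norm X < exp (-1)" for X :: complex
    using summable_tree_power_sum[OF that, of i] unfolding c_def by (rule summable_norm_cancel)
  show "(tree_power_sum i has_field_derivative (\<Sum>n. diffs c n * X ^ n)) (at X)"
    using termdiffs_strong'[of "exp (-1)" c, OF c X] by (simp add: tree_power_sum_def[abs_def] c_def)
  have "summable (\<lambda>n. diffs c n * X ^ n)"
    by (rule termdiff_converges[OF X c])
  from diffs_equiv[OF this] have "(\<lambda>n. X * (of_nat n * c n * X ^ (n - Suc 0))) sums (X * (\<Sum>n. diffs c n * X ^ n))"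
    by (rule sums_mult)
  moreover have "X * (of_nat n * c n * X ^ (n - Suc 0)) = of_nat n ^ Suc i * (- of_nat n) ^ n / fact n * X ^ n" for n
    by (cases n) (auto simp: c_def)
  ultimately show "X * (\<Sum>n. diffs c n * X ^ n) = tree_power_sum (Suc i) X"
    unfolding tree_power_sum_def by (simp add: sums_iff)
qed

lemma tree_power_sum_0:
  assumes "norm \<tau> * exp (norm \<tau>) < exp (-1)"
  shows "tree_power_sum 0 (\<tau> * exp \<tau>) = 1 / (1 + \<tau>)"
proof -
  have "of_nat n ^ 0 * (- of_nat n) ^ n / fact n * (\<tau> * exp \<tau>) ^ n
      = (-1) ^ n * (of_nat n * \<tau>) ^ n / fact n * exp (of_nat n * \<tau>)" for n :: nat
    by (simp add: power_minus[of "of_nat n"] power_mult_distrib exp_of_nat_mult)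
  then show ?thesis using tree_series_eq[OF assms] by (simp add: tree_power_sum_def)
qed

text \<open>Lagrange inversion in abstract form: G i is the i-th derivative of G 0 with respect to f
  used as a coordinate. For m = 0 there is a simple pole. The induction step integrates by parts,
  which trades one power of 1 / f for a step from G i to G (Suc i).\<close>

lemma contour_integral_inverse_powers:
  fixes f :: "complex \<Rightarrow> complex" and G :: "nat \<Rightarrow> complex \<Rightarrow> complex"
  assumes "0 < \<rho>" "\<rho> < r"
    and f: "\<And>t. norm t < r \<Longrightarrow> (f has_field_derivative f' t) (at t)" "f 0 = 0" "f' 0 \<noteq> 0"
    and nz: "\<And>t. norm t < r \<Longrightarrow> t \<noteq> 0 \<Longrightarrow> f t \<noteq> 0"
    and f': "f' holomorphic_on ball 0 r"
    and G: "\<And>i t. norm t < r \<Longrightarrow> (G i has_field_derivative f' t * G (Suc i) t) (at t)"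
  shows "((\<lambda>t. G i t * f' t / f t ^ Suc m) has_contour_integral 2 * pi * \<i> * G (i + m) 0 / fact m) (circlepath 0 \<rho>)"
proof (induction m arbitrary: i)
  case 0
  have fh: "f holomorphic_on ball 0 r"
    unfolding holomorphic_on_open[OF open_ball] using f(1) by (metis mem_ball_0)
  have Gh: "G i holomorphic_on ball 0 r" for i
    unfolding holomorphic_on_open[OF open_ball] using G by (metis mem_ball_0)
  \<comment> \<open>The quotient f t / t with its singularity filled in, so that the integrand
    becomes a holomorphic function divided by t.\<close>
  define K where "K t = (if t = 0 then deriv f 0 else (f t - f 0) / (t - 0))" for t
  have K: "K holomorphic_on ball 0 r"
    unfolding K_def by (rule pole_lemma[OF fh]) (use assms in auto)
  have K0: "K 0 = f' 0" using f(1)[of 0] assms by (simp add: K_def DERIV_imp_deriv)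
  have Knz: "K t \<noteq> 0" if "norm t < r" for t
    using K0 f nz[OF that] by (cases "t = 0") (auto simp: K_def)
  have "(\<lambda>t. G i t * f' t / K t) holomorphic_on cball 0 \<rho>"
    by (rule holomorphic_on_subset[where s = "ball 0 r"])
       (use Knz assms in \<open>auto intro!: holomorphic_intros K Gh f'\<close>)
  then have "((\<lambda>u. (G i u * f' u / K u) / (u - 0)) has_contour_integral 2 * of_real pi * \<i> * (G i 0 * f' 0 / K 0)) (circlepath 0 \<rho>)"
    by (rule Cauchy_integral_circlepath_simple) (use assms in auto)
  then have "((\<lambda>u. G i u * f' u / f u ^ Suc 0) has_contour_integral 2 * of_real pi * \<i> * (G i 0 * f' 0 / K 0)) (circlepath 0 \<rho>)"
    by (rule has_contour_integral_eq) (use assms f(2) in \<open>auto simp: K_def\<close>)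
  then show ?case using K0 f(3) by simp
next
  case (Suc m)
  \<comment> \<open>The derivative of G i / f^(m+1), which is single-valued on the punctured
    disc.\<close>
  let ?D = "\<lambda>t. G (Suc i) t * f' t / f t ^ Suc m - of_nat (Suc m) * (G i t * f' t / f t ^ Suc (Suc m))"
  have "(?D has_contour_integral 0) (circlepath 0 \<rho>)"
  proof (rule Cauchy_theorem_primitive)
    show "((\<lambda>t. G i t / f t ^ Suc m) has_field_derivative ?D t) (at t within ball 0 r - {0})"
      if "t \<in> ball 0 r - {0}" for t
    proof -
      have t: "norm t < r" "f t \<noteq> 0" using that nz by auto
      have "((\<lambda>t. G i t / f t ^ Suc m) has_field_derivative
         (f' t * G (Suc i) t * f t ^ Suc m - G i t * (of_nat (Suc m) * (f' t * f t ^ m))) / (f t ^ Suc m * f t ^ Suc m)) (at t)"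
        using t by (auto intro!: derivative_eq_intros f G simp del: power_Suc of_nat_Suc)
      also have "(f' t * G (Suc i) t * f t ^ Suc m - G i t * (of_nat (Suc m) * (f' t * f t ^ m))) / (f t ^ Suc m * f t ^ Suc m) = ?D t"
        using t(2) by (simp add: field_simps del: of_nat_Suc)
      finally show ?thesis by (rule has_field_derivative_at_within)
    qed
    show "path_image (circlepath 0 \<rho>) \<subseteq> ball 0 r - {0}" using assms(1,2) by auto
  qed auto
  from has_contour_integral_diff[OF Suc.IH[of "Suc i"] this]
  have "((\<lambda>t. of_nat (Suc m) * (G i t * f' t / f t ^ Suc (Suc m)))
      has_contour_integral 2 * pi * \<i> * G (Suc i + m) 0 / fact m) (circlepath 0 \<rho>)" by simp
  from has_contour_integral_lmul[OF this, of "1 / of_nat (Suc m)"]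
  show ?case by (simp add: field_simps del: of_nat_Suc power_Suc)
qed

text \<open>With f(t) = lam e^t + t - lam, the n-th derivative in \<open>b_coeff\<close> is a Cauchy
  integral of a constant times 1 / f^(n+1). For \<tau> = lam e^t one has lam e^lam e^f = \<tau>
  e^\<tau>, so that \<open>tree_power_sum 0\<close> at this point is 1 / (1 + \<tau>) = 1 / f'.
  Hence 1 / f^(n+1) is the integrand of the inversion lemma with G 0 equal to this function of t,
  and the index n arises because the derivative with respect to f acts as X d/dX.\<close>

lemma b_coeff_eq_tree_power_sum:
  fixes lam :: real
  assumes lam: "0 < lam" "lam * exp lam < exp (-1)"
  shows "b_coeff n (- complex_of_real lam)
       = (1 + complex_of_real lam) ^ (2 * n + 1) * tree_power_sum n (complex_of_real lam * exp (complex_of_real lam))"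
proof -
  define l where "l = complex_of_real lam"
  have l: "1 + l \<noteq> 0" "l \<noteq> 0" "norm l = lam"
    using lam by (auto simp: l_def complex_eq_iff)
  define f where "f t = l * exp t + t - l" for t :: complex
  define f' where "f' t = l * exp t + 1" for t :: complex
  define x where "x = l * exp l"
  define \<tau> where "\<tau> t = l * exp t" for t :: complex
  define B where "B t = norm (\<tau> t) * exp (norm (\<tau> t))" for t
  have "isCont B 0" unfolding B_def \<tau>_def by (intro continuous_intros)
  moreover have B0: "B 0 < exp (-1)" using lam l by (simp add: B_def \<tau>_def)
  ultimately have "eventually (\<lambda>t. B t < exp (-1)) (at 0)"
    unfolding isCont_def by (rule order_tendstoD(2))
  then obtain r0 where r0: "r0 > 0" "\<And>t. t \<noteq> 0 \<Longrightarrow> dist t 0 < r0 \<Longrightarrow> B t < exp (-1)"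
    unfolding eventually_at by blast
  \<comment> \<open>The bound 1 is below 2 pi, so that t = 0 is the only solution of exp t = 1 in
    the disc.\<close>
  define r where "r = min r0 1"
  have r: "0 < r" "r \<le> 1" "\<And>t. norm t < r \<Longrightarrow> B t < exp (-1)"
  proof -
    show "B t < exp (-1)" if "norm t < r" for t
      using r0(2)[of t] B0 that by (cases "t = 0") (auto simp: r_def)
  qed (use r0(1) in \<open>auto simp: r_def\<close>)
  have key: "x * exp (f t) = \<tau> t * exp (\<tau> t)" for t
    by (simp add: x_def f_def \<tau>_def exp_add exp_diff field_simps)
  have Xb: "norm (x * exp (f t)) < exp (-1)" if "norm t < r" for t
  proof -
    have "norm (x * exp (f t)) \<le> B t"
      unfolding key B_def norm_mult by (intro mult_left_mono norm_exp) auto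
    with r(3)[OF that] show ?thesis by simp
  qed
  \<comment> \<open>A second zero of f would give two values of \<tau> with the same \<tau>
    e^\<tau>. But \<open>tree_power_sum_0\<close> recovers \<tau> from this product, so that e^t =
    1.\<close>
  have nz: "f t \<noteq> 0" if t: "norm t < r" "t \<noteq> 0" for t
  proof
    assume "f t = 0"
    then have "\<tau> t * exp (\<tau> t) = \<tau> 0 * exp (\<tau> 0)" using key[of t] key[of 0] by (simp add: f_def)
    moreover have "tree_power_sum 0 (\<tau> s * exp (\<tau> s)) = 1 / (1 + \<tau> s)" if "norm s < r" for s
      by (rule tree_power_sum_0) (use r(3)[OF that] in \<open>simp add: B_def\<close>)
    ultimately have "1 / (1 + \<tau> t) = 1 / (1 + \<tau> 0)" using t r by (metis norm_zero)
    then have "exp t = 1" using l by (simp add: \<tau>_def)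
    then obtain k :: int where k: "Re t = 0" "Im t = of_int (2 * k) * pi" unfolding exp_eq_1 by blast
    have "\<bar>Im t\<bar> < 1" using abs_Im_le_cmod[of t] t r by linarith
    then have "\<bar>of_int (2 * k)\<bar> * pi < 1" unfolding k(2) by (simp add: abs_mult)
    have "k = 0"
    proof (rule ccontr)
      assume "k \<noteq> 0"
      then have "1 \<le> \<bar>real_of_int (2 * k)\<bar>" by linarith
      then have "1 * pi \<le> \<bar>of_int (2 * k)\<bar> * pi" by (intro mult_right_mono) auto
      with \<open>\<bar>of_int (2 * k)\<bar> * pi < 1\<close> pi_gt3 show False by linarith
    qed
    with k t show False by (simp add: complex_eq_iff)
  qed
  define G where "G i t = tree_power_sum i (x * exp (f t))" for i t
  have fd: "(f has_field_derivative f' t) (at t)" for t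
    unfolding f_def f'_def by (auto intro!: derivative_eq_intros)
  have Gd: "(G i has_field_derivative f' t * G (Suc i) t) (at t)" if t: "norm t < r" for i t
  proof -
    obtain D where D: "(tree_power_sum i has_field_derivative D) (at (x * exp (f t)))"
      "x * exp (f t) * D = tree_power_sum (Suc i) (x * exp (f t))"
      using has_field_derivative_tree_power_sum[OF Xb[OF t]] by metis
    have "((\<lambda>t. x * exp (f t)) has_field_derivative x * (exp (f t) * f' t)) (at t)"
      by (auto intro!: derivative_eq_intros fd)
    from DERIV_chain2[OF D(1) this]
    have "(G i has_field_derivative D * (x * (exp (f t) * f' t))) (at t)" by (simp add: G_def[abs_def])
    also have "D * (x * (exp (f t) * f' t)) = f' t * (x * exp (f t) * D)" by (simp add: mult_ac)
    finally show ?thesis unfolding D(2) G_def .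
  qed
  have G0: "G 0 t * f' t = 1" if "norm t < r" for t
  proof -
    have "G 0 t = 1 / (1 + \<tau> t)" unfolding G_def key
      by (rule tree_power_sum_0) (use r(3)[OF that] in \<open>simp add: B_def\<close>)
    moreover have "1 + \<tau> t \<noteq> 0"
    proof
      assume "1 + \<tau> t = 0"
      then have "\<tau> t = -1" by (metis add_eq_0_iff)
      then have "B t = exp 1" by (simp add: B_def)
      with r(3)[OF that] show False by simp
    qed
    ultimately show ?thesis by (simp add: f'_def \<tau>_def add.commute)
  qed
  define \<rho> where "\<rho> = r / 2"
  have \<rho>: "0 < \<rho>" "\<rho> < r" using r by (auto simp: \<rho>_def)
  have int1: "((\<lambda>t. G 0 t * f' t / f t ^ Suc n) has_contour_integral 2 * pi * \<i> * G (0 + n) 0 / fact n) (circlepath 0 \<rho>)"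
  proof (rule contour_integral_inverse_powers[where r = r])
    show "(G i has_field_derivative f' t * G (Suc i) t) (at t)" if "norm t < r" for i t by (rule Gd[OF that])
    show "f 0 = 0" "f' 0 \<noteq> 0" using l by (auto simp: f_def f'_def add.commute)
    show "f' holomorphic_on ball 0 r" unfolding f'_def by (intro holomorphic_intros)
  qed (use \<rho> fd nz in auto)
  define \<psi> where "\<psi> = (\<lambda>t. if t = 0 then 1 else ((1 + l) * t / (l * exp t + t - l)) ^ (n + 1))"
  have \<psi>h: "\<psi> holomorphic_on ball 0 r"
  proof -
    define K where "K t = (if t = 0 then deriv f 0 else (f t - f 0) / (t - 0))" for t
    have K: "K holomorphic_on ball 0 r"
      unfolding K_def
    proof (rule pole_lemma)
      show "f holomorphic_on ball 0 r" unfolding holomorphic_on_open[OF open_ball] using fd by blast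
    qed (use r in simp)
    have K0: "K 0 = 1 + l" using DERIV_imp_deriv[OF fd[of 0]] by (simp add: K_def f'_def)
    have f0: "f 0 = 0" by (simp add: f_def)
    have Knz: "K t \<noteq> 0" if "norm t < r" for t
      using K0 l f0 nz[OF that] by (cases "t = 0") (auto simp: K_def)
    have "(\<lambda>t. ((1 + l) / K t) ^ (n + 1)) holomorphic_on ball 0 r"
      using Knz by (auto intro!: holomorphic_intros K)
    then show ?thesis
    proof (rule holomorphic_transform)
      fix t :: complex assume "t \<in> ball 0 r"
      show "((1 + l) / K t) ^ (n + 1) = \<psi> t"
        using K0 l f0 by (cases "t = 0") (auto simp: \<psi>_def K_def f_def)
    qed
  qed
  have "((\<lambda>u. \<psi> u / (u - 0) ^ Suc n) has_contour_integral (2 * pi * \<i> / fact n * (deriv ^^ n) \<psi> 0)) (circlepath 0 \<rho>)"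
  proof (rule Cauchy_has_contour_integral_higher_derivative_circlepath)
    show "continuous_on (cball 0 \<rho>) \<psi>"
      by (rule continuous_on_subset[OF holomorphic_on_imp_continuous_on[OF \<psi>h]]) (use \<rho> in auto)
    show "\<psi> holomorphic_on ball 0 \<rho>"
      by (rule holomorphic_on_subset[OF \<psi>h]) (use \<rho> in auto)
  qed (use \<rho> in auto)
  moreover have "((\<lambda>u. \<psi> u / (u - 0) ^ Suc n) has_contour_integral (1 + l) ^ Suc n * (2 * pi * \<i> * G (0 + n) 0 / fact n)) (circlepath 0 \<rho>)"
  proof (rule has_contour_integral_eq[OF has_contour_integral_lmul[OF int1]])
    fix u assume "u \<in> path_image (circlepath 0 \<rho>)"
    then have u: "norm u < r" "u \<noteq> 0" using \<rho> by auto
    show "(1 + l) ^ Suc n * (G 0 u * f' u / f u ^ Suc n) = \<psi> u / (u - 0) ^ Suc n"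
      unfolding G0[OF u(1)] using u nz[OF u] by (simp add: \<psi>_def f_def power_divide power_mult_distrib del: power_Suc)
  qed
  ultimately have "2 * pi * \<i> / fact n * (deriv ^^ n) \<psi> 0 = (1 + l) ^ Suc n * (2 * pi * \<i> * G n 0 / fact n)"
    using has_contour_integral_unique by fastforce
  then have "(2 * pi * \<i> / fact n) * (deriv ^^ n) \<psi> 0 = (2 * pi * \<i> / fact n) * ((1 + l) ^ Suc n * G n 0)"
    by (simp add: mult_ac)
  then have "(deriv ^^ n) \<psi> 0 = (1 + l) ^ Suc n * G n 0"
    by (subst (asm) mult_cancel_left) auto
  moreover have "b_coeff n (- l) = (1 + l) ^ n * (deriv ^^ n) \<psi> 0"
    unfolding b_coeff_def \<psi>_def minus_minus diff_minus_eq_add add_uminus_conv_diff ..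
  moreover have "G n 0 = tree_power_sum n x" by (simp add: G_def f_def)
  ultimately have "b_coeff n (- l) = ((1 + l) ^ n * (1 + l) ^ Suc n) * tree_power_sum n x" by simp
  also have "(1 + l) ^ n * (1 + l) ^ Suc n = (1 + l) ^ (2 * n + 1)" by (simp flip: power_add add: mult_2)
  finally show ?thesis by (simp add: l_def x_def)
qed

section \<open>A uniform bound for the gamma function in the right half-plane\<close>

text \<open>Only the part t \<ge> x of Euler's integral is kept, and t powr x is replaced there by
  the smaller x powr x.\<close>

lemma Gamma_ge_power_exp:
  assumes "x > 0"
  shows "x powr x * exp (- x) \<le> Gamma (1 + x :: real)"
proof -
  have i1: "((\<lambda>t. t powr x / exp t) has_integral Gamma (1 + x)) {0..}"
    using Gamma_integral_real[of "1 + x"] assms by simp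
  have "((\<lambda>t. exp (- 1 * t)) has_integral exp (- 1 * x) / 1) {x..}"
    by (rule has_integral_exp_minus_to_infinity) simp
  then have "((\<lambda>t. x powr x * exp (- 1 * t)) has_integral x powr x * (exp (- 1 * x) / 1)) {x..}"
    by (rule has_integral_mult_right)
  then have "((\<lambda>t. if t \<in> {x..} then x powr x * exp (- 1 * t) else 0) has_integral x powr x * (exp (- 1 * x) / 1)) {0..}"
    by (subst has_integral_restrict) (use assms in auto)
  then have "x powr x * (exp (- 1 * x) / 1) \<le> Gamma (1 + x)"
  proof (rule has_integral_le[OF _ i1])
    fix t :: real assume "t \<in> {0..}"
    show "(if t \<in> {x..} then x powr x * exp (- 1 * t) else 0) \<le> t powr x / exp t"
      using powr_mono2[of x x t] assms by (auto simp: exp_minus divide_inverse intro!: mult_right_mono)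
  qed
  then show ?thesis by simp
qed

lemma Re_pos_not_nonpos_Ints: "Re z > 0 \<Longrightarrow> z \<notin> \<int>\<^sub>\<le>\<^sub>0"
  by (auto elim!: nonpos_Ints_cases)

text \<open>
  The squared modulus of the quotient is the product over \<open>j \<ge> 1\<close> of \<open>1 + y\<^sup>2 / (x + j)\<^sup>2\<close>; its logarithm
  is compared with an integral, using that the factors decrease in \<open>j\<close>.
\<close>

lemma norm_Gamma_ratio_le:
  assumes x: "x > 0"
  shows "norm (Gamma (1 + complex_of_real x)) / norm (Gamma (1 + Complex x y))
         \<le> exp (y * arctan (y / x) - x * (ln (1 + y\<^sup>2 / x\<^sup>2) / 2))"
proof -
  \<comment> \<open>The primitive of \<open>\<phi>\<close> that vanishes at infinity, where
    \<open>\<phi> X\<close> is the logarithm of sqrt (1 + y^2 / X^2). The exponent in the claim is -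
    A x.\<close>
  define A where "A X = X * (ln (1 + y\<^sup>2 / X\<^sup>2) / 2) - y * arctan (y / X)" for X
  define \<phi> where "\<phi> X = ln (1 + y\<^sup>2 / X\<^sup>2) / 2" for X
  have der: "(A has_real_derivative \<phi> X) (at X)" if "X > 0" for X
  proof -
    have pos: "1 + y\<^sup>2 / X\<^sup>2 > 0" "X\<^sup>2 + y\<^sup>2 > 0" using that by (auto simp: add_pos_nonneg)
    have d1: "((\<lambda>X. 1 + y\<^sup>2 / X\<^sup>2) has_real_derivative - (y\<^sup>2 * (2 * X)) / (X\<^sup>2)\<^sup>2) (at X)"
      using that by (auto intro!: derivative_eq_intros simp: power2_eq_square)
    have d2: "((\<lambda>X. y / X) has_real_derivative - y / X\<^sup>2) (at X)"
      using that by (auto intro!: derivative_eq_intros simp: power2_eq_square)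
    have d: "(A has_real_derivative
        (1 * (ln (1 + y\<^sup>2 / X\<^sup>2) / 2) + (1 / (1 + y\<^sup>2 / X\<^sup>2) * (- (y\<^sup>2 * (2 * X)) / (X\<^sup>2)\<^sup>2)) / 2 * X)
        - y * (inverse (1 + (y / X)\<^sup>2) * (- y / X\<^sup>2))) (at X)"
      unfolding A_def[abs_def]
      by (intro DERIV_diff DERIV_mult DERIV_cmult DERIV_ident DERIV_cdivide
            DERIV_chain2[OF DERIV_ln_divide[OF pos(1)] d1] DERIV_chain2[OF DERIV_arctan d2])
    have e: "1 + y\<^sup>2 / X\<^sup>2 = (X\<^sup>2 + y\<^sup>2) / X\<^sup>2" "1 + (y / X)\<^sup>2 = (X\<^sup>2 + y\<^sup>2) / X\<^sup>2"
      using that by (simp_all add: power_divide add_divide_distrib)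
    have "(1 / (1 + y\<^sup>2 / X\<^sup>2) * (- (y\<^sup>2 * (2 * X)) / (X\<^sup>2)\<^sup>2)) / 2 * X = y * (inverse (1 + (y / X)\<^sup>2) * (- y / X\<^sup>2))"
    proof -
      have "(1 / (Q / X\<^sup>2) * (- (y\<^sup>2 * (2 * X)) / (X\<^sup>2)\<^sup>2)) / 2 * X = y * (inverse (Q / X\<^sup>2) * (- y / X\<^sup>2))"
        if "Q \<noteq> 0" for Q
        using that \<open>X > 0\<close> by (simp add: field_simps power2_eq_square)
      then show ?thesis unfolding e using pos(2) by simp
    qed
    with d have "(A has_real_derivative ln (1 + y\<^sup>2 / X\<^sup>2) / 2) (at X)" by simp
    then show ?thesis by (simp add: \<phi>_def)
  qed
  have \<phi>_mono: "\<phi> X' \<le> \<phi> X" if "0 < X" "X \<le> X'" for X X'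
  proof -
    have "y\<^sup>2 / X'\<^sup>2 \<le> y\<^sup>2 / X\<^sup>2" using that by (intro divide_left_mono power_mono mult_pos_pos) auto
    moreover have "0 < 1 + y\<^sup>2 / X'\<^sup>2" by (simp add: add_pos_nonneg)
    ultimately show ?thesis by (simp add: \<phi>_def)
  qed
  have step: "\<phi> (x + real n + 1) \<le> A (x + real n + 1) - A (x + real n)" for n
  proof -
    have "x + real n < x + real n + 1" by simp
    from MVT2[OF this, of A \<phi>] der x
    obtain z where z: "x + real n < z" "z < x + real n + 1" "A (x + real n + 1) - A (x + real n) = \<phi> z"
      by auto
    then show ?thesis using \<phi>_mono[of z "x + real n + 1"] x by auto
  qed
  have sum_le: "(\<Sum>j<n. \<phi> (x + real j + 1)) \<le> A (x + real n) - A x" for n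
  proof (induction n)
    case (Suc n)
    then show ?case using step[of n] by (simp add: add_ac)
  qed simp
  have ratio: "norm (Gamma_series' (1 + complex_of_real x) n) / norm (Gamma_series' (1 + Complex x y) n)
      \<le> exp (A (x + real n) - A x)" for n
  proof -
    have nz: "1 + Complex x y + of_nat j \<noteq> 0" "1 + complex_of_real x + of_nat j \<noteq> 0" for j
      using x by (auto simp: complex_eq_iff)
    have "norm (Gamma_series' (1 + complex_of_real x) n) / norm (Gamma_series' (1 + Complex x y) n)
       = norm (pochhammer (1 + Complex x y) n) / norm (pochhammer (1 + complex_of_real x) n)"
      by (simp add: Gamma_series'_def norm_mult norm_divide)
    also have "\<dots> = (\<Prod>j<n. norm (1 + Complex x y + of_nat j) / norm (1 + complex_of_real x + of_nat j))"
      by (simp add: pochhammer_prod prod_norm prod_dividef atLeast0LessThan)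
    also have "\<dots> = (\<Prod>j<n. exp (\<phi> (x + real j + 1)))"
    proof (intro prod.cong refl)
      fix j
      define X where "X = x + real j + 1"
      have X: "X > 0" using x by (simp add: X_def)
      have 1: "1 + Complex x y + of_nat j = Complex X y" "1 + complex_of_real x + of_nat j = of_real X"
        by (auto simp: X_def complex_eq_iff)
      have "norm (Complex X y) / X = sqrt ((X\<^sup>2 + y\<^sup>2) / X\<^sup>2)"
        using X by (simp add: complex_norm real_sqrt_divide)
      also have "(X\<^sup>2 + y\<^sup>2) / X\<^sup>2 = 1 + y\<^sup>2 / X\<^sup>2" using X by (simp add: field_simps)
      also have "sqrt (1 + y\<^sup>2 / X\<^sup>2) = exp (\<phi> X)"
        using X by (intro real_sqrt_unique) (auto simp: \<phi>_def power2_eq_square add_pos_nonneg simp flip: exp_add)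
      finally have "norm (Complex X y) / \<bar>X\<bar> = exp (\<phi> X)" using X by simp
      then show "norm (1 + Complex x y + of_nat j) / norm (1 + complex_of_real x + of_nat j) = exp (\<phi> (x + real j + 1))"
        unfolding 1 norm_of_real X_def[symmetric] .
    qed
    also have "\<dots> = exp (\<Sum>j<n. \<phi> (x + real j + 1))" by (simp add: exp_sum)
    also have "\<dots> \<le> exp (A (x + real n) - A x)" using sum_le by simp
    finally show ?thesis .
  qed
  have "(\<lambda>n. A (x + real n)) \<longlonglongrightarrow> 0"
  proof -
    consider "y = 0" | "y > 0" | "y < 0" by linarith
    then show ?thesis
    proof cases
      case 1
      then show ?thesis by (simp add: A_def)
    qed (unfold A_def, real_asymp+)
  qed
  then have lim1: "(\<lambda>n. exp (A (x + real n) - A x)) \<longlonglongrightarrow> exp (0 - A x)" by (intro tendsto_intros)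
  have "Gamma (1 + Complex x y) \<noteq> 0"
    by (rule Gamma_nonzero, rule Re_pos_not_nonpos_Ints) (use x in simp)
  then have "(\<lambda>n. norm (Gamma_series' (1 + complex_of_real x) n) / norm (Gamma_series' (1 + Complex x y) n))
      \<longlonglongrightarrow> norm (Gamma (1 + complex_of_real x)) / norm (Gamma (1 + Complex x y))"
    by (intro tendsto_intros Gamma_series'_LIMSEQ) auto
  from LIMSEQ_le[OF this lim1] ratio show ?thesis by (auto simp: A_def)
qed

text \<open>In polar form the modulus of s^s is x^x divided by exactly the exponential that bounds
  the Gamma ratio in \<open>norm_Gamma_ratio_le\<close>. The imaginary part drops out and the real
  case \<open>Gamma_ge_power_exp\<close> remains.\<close>

lemma norm_Gamma_quotient_le_1:
  assumes s: "Re s > 0"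
  shows "norm (s powr s * exp (- s) / Gamma (1 + s)) \<le> 1"
proof -
  define x y where "x = Re s" and "y = Im s"
  have x: "x > 0" and s_eq: "s = Complex x y" using assms by (simp_all add: x_def y_def)
  have s0: "s \<noteq> 0" using s by auto
  have "norm (s powr s) = exp (x * ln (norm s) - y * Arg s)"
    using s0 by (simp add: powr_def x_def y_def Arg_eq_Im_Ln)
  also have "Arg s = arctan (y / x)" using s by (simp add: x_def y_def arg_conv_arctan)
  also have "ln (norm s) = ln x + ln (1 + y\<^sup>2 / x\<^sup>2) / 2"
  proof -
    have "x\<^sup>2 + y\<^sup>2 = x\<^sup>2 * (1 + y\<^sup>2 / x\<^sup>2)" using x by (simp add: field_simps)
    then have "norm s = x * sqrt (1 + y\<^sup>2 / x\<^sup>2)"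
      unfolding s_eq complex_norm using x by (simp add: real_sqrt_mult)
    moreover have "1 + y\<^sup>2 / x\<^sup>2 > 0" by (simp add: add_pos_nonneg)
    ultimately show ?thesis using x by (simp add: ln_mult ln_sqrt)
  qed
  also have "exp (x * (ln x + ln (1 + y\<^sup>2 / x\<^sup>2) / 2) - y * arctan (y / x))
      = x powr x / exp (y * arctan (y / x) - x * (ln (1 + y\<^sup>2 / x\<^sup>2) / 2))"
    using x by (simp add: powr_def exp_add exp_diff algebra_simps)
  finally have 1: "norm (s powr s) = x powr x / exp (y * arctan (y / x) - x * (ln (1 + y\<^sup>2 / x\<^sup>2) / 2))" (is "_ = _ / exp ?E") .
  have "norm (Gamma (1 + complex_of_real x)) = Gamma (1 + x)"
    using Gamma_complex_of_real[of "1 + x"] Gamma_real_pos[of "1 + x"] x by simp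
  with norm_Gamma_ratio_le[OF x, of y] have 2: "Gamma (1 + x) / norm (Gamma (1 + s)) \<le> exp ?E"
    by (simp add: s_eq)
  have G: "norm (Gamma (1 + s)) > 0"
    using Gamma_nonzero[OF Re_pos_not_nonpos_Ints, of "1 + s"] s by simp
  have "norm (s powr s * exp (- s) / Gamma (1 + s)) = x powr x * exp (- x) / (exp ?E * norm (Gamma (1 + s)))"
    unfolding norm_mult norm_divide 1 by (simp add: x_def)
  also have "\<dots> \<le> Gamma (1 + x) / (exp ?E * norm (Gamma (1 + s)))"
    using Gamma_ge_power_exp[OF x] G by (intro divide_right_mono) auto
  also have "\<dots> \<le> 1" using 2 G by (simp add: field_simps)
  finally show ?thesis .
qed

section \<open>Integrals along rays\<close>

text \<open>The reciprocal of sqrt (2 pi s) \<open>Gamma_star s\<close> for Re s > 0. Splitting off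
  the square root cancels the half-integral power of t in the integrands.\<close>

definition stirling_quotient :: "complex \<Rightarrow> complex" where
  "stirling_quotient s = s powr s * exp (- s) / Gamma (1 + s)"

text \<open>
  With \<open>sg = \<lambda> + ln \<lambda> + 1\<close>, \<open>exp (sg * s) * stirling_quotient s\<close> is the function \<open>h(s)\<close> of the
  introduction.
\<close>

definition ray_fun :: "real \<Rightarrow> nat \<Rightarrow> complex \<Rightarrow> complex \<Rightarrow> complex" where
  "ray_fun sg N a s = s ^ N * (exp (of_real sg * s) * stirling_quotient s) * (a / (a - s))"

definition ray_kernel :: "real \<Rightarrow> nat \<Rightarrow> complex \<Rightarrow> complex \<Rightarrow> complex" where
  "ray_kernel sg N a s = ray_fun sg N a s / (2 * \<i> * sin (of_real pi * s))"

lemma norm_stirling_quotient_le_1: "Re s > 0 \<Longrightarrow> norm (stirling_quotient s) \<le> 1"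
  unfolding stirling_quotient_def by (rule norm_Gamma_quotient_le_1)

lemma stirling_quotient_holomorphic: "stirling_quotient holomorphic_on {s. Re s > 0}"
proof -
  have "1 + s \<notin> \<int>\<^sub>\<le>\<^sub>0" "s \<notin> \<real>\<^sub>\<le>\<^sub>0" if "Re s > 0" for s
    using that Re_pos_not_nonpos_Ints[of "1 + s"] by (auto simp: complex_nonpos_Reals_iff)
  then show ?thesis
    unfolding stirling_quotient_def[abs_def] by (auto intro!: holomorphic_intros simp: Gamma_eq_zero_iff)
qed

lemma ray_fun_holomorphic: "ray_fun sg N a holomorphic_on {s. Re s > 0} - {a}"
  unfolding ray_fun_def[abs_def]
  by (intro holomorphic_intros holomorphic_on_subset[OF stirling_quotient_holomorphic]) auto

lemma norm_ray_fun_le: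
  assumes "Re s > 0"
  shows "norm (ray_fun sg N a s) \<le> norm s ^ N * exp (sg * Re s) * (norm a / norm (a - s))"
proof -
  have "norm (exp (of_real sg * s) * stirling_quotient s) \<le> exp (sg * Re s) * 1"
    unfolding norm_mult using norm_stirling_quotient_le_1[OF assms] by (intro mult_mono) auto
  then show ?thesis
    unfolding ray_fun_def norm_mult norm_power norm_divide
    by (intro mult_right_mono mult_left_mono) (auto simp: norm_mult)
qed

lemma tendsto_power_mult_exp:
  fixes c :: real
  assumes "c > 0"
  shows "((\<lambda>t. t ^ n * exp (- c * t)) \<longlongrightarrow> 0) at_top"
proof -
  have "((\<lambda>t. (c * t) ^ n / exp (c * t)) \<longlongrightarrow> 0) at_top"
    by (rule filterlim_compose[OF tendsto_power_div_exp_0])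
       (use assms in \<open>auto intro: filterlim_tendsto_pos_mult_at_top filterlim_ident\<close>)
  then have "((\<lambda>t. (1 / c ^ n) * ((c * t) ^ n / exp (c * t))) \<longlongrightarrow> (1 / c ^ n) * 0) at_top"
    by (rule tendsto_mult_left)
  moreover have "(1 / c ^ n) * ((c * t) ^ n / exp (c * t)) = t ^ n * exp (- c * t)" for t
    using assms by (simp add: power_mult_distrib exp_minus field_simps)
  ultimately show ?thesis by simp
qed

text \<open>A primitive of \<open>f\<close> on the convex set \<open>S\<close> replaces the arcs which would close the contour.\<close>

lemma ray_integral_rotate:
  fixes f :: "complex \<Rightarrow> complex" and p q :: complex
  assumes S: "open S" "convex S" "f holomorphic_on S" and c: "c > 0"
    and mem: "\<And>t u. 0 < t \<Longrightarrow> 0 \<le> u \<Longrightarrow> u \<le> 1 \<Longrightarrow> of_real t * ((1 - of_real u) * p + of_real u * q) \<in> S"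
    and bound: "\<And>t u. 0 < t \<Longrightarrow> 0 \<le> u \<Longrightarrow> u \<le> 1 \<Longrightarrow>
           norm (f (of_real t * ((1 - of_real u) * p + of_real u * q))) \<le> C * (t ^ n * exp (- c * t))"
  shows "set_integrable lborel {0<..} (\<lambda>t. f (of_real t * p))"
    and "set_integrable lborel {0<..} (\<lambda>t. f (of_real t * q))"
    and "(LBINT t:{0<..}. f (of_real t * p) * p) = (LBINT t:{0<..}. f (of_real t * q) * q)"
proof -
  have memp: "of_real t * p \<in> S" and memq: "of_real t * q \<in> S" if "t > 0" for t
    using mem[OF that, of 0] mem[OF that, of 1] by auto
  have dom: "set_integrable lborel {0<..} (\<lambda>t. C * (t ^ n * exp (- c * t)))"
    by (intro set_integrable_mult_right set_integrable_power_times_exp c)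
  have contf: "continuous_on S f" by (rule holomorphic_on_imp_continuous_on[OF S(3)])
  show ip: "set_integrable lborel {0<..} (\<lambda>t. f (of_real t * p))"
    by (rule set_integrable_continuous_dominated[OF _ dom])
       (use bound[of _ 0] memp in \<open>auto intro!: continuous_on_compose2[OF contf] continuous_intros\<close>)
  show iq: "set_integrable lborel {0<..} (\<lambda>t. f (of_real t * q))"
    by (rule set_integrable_continuous_dominated[OF _ dom])
       (use bound[of _ 1] memq in \<open>auto intro!: continuous_on_compose2[OF contf] continuous_intros\<close>)
  obtain F where F: "\<And>x. x \<in> S \<Longrightarrow> (F has_field_derivative f x) (at x within S)"
    using holomorphic_convex_primitive'[OF S(2,1,3)] by blast
  have F': "(F has_field_derivative f x) (at x)" if "x \<in> S" for x
    using F[OF that] at_within_open[OF that S(1)] by simp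
  \<comment> \<open>The integral of f over the chord from t p to t q. The length of the chord
    supplies a further factor t, so that D tends to 0 at t = 0 as well as at infinity.\<close>
  define D where "D t = F (of_real t * q) - F (of_real t * p)" for t :: real
  have Dbound: "norm (D t) \<le> C * norm (q - p) * (t ^ Suc n * exp (- c * t))" if t: "t > 0" for t
  proof -
    have "norm (D t) \<le> C * (t ^ n * exp (- c * t)) * norm (of_real t * q - of_real t * p)"
      unfolding D_def
    proof (rule field_differentiable_bound[where S = "closed_segment (of_real t * p) (of_real t * q)" and f' = f])
      fix w assume "w \<in> closed_segment (of_real t * p) (of_real t * q)"
      then obtain u where u: "0 \<le> u" "u \<le> 1" and w: "w = (1 - u) *\<^sub>R (of_real t * p) + u *\<^sub>R (of_real t * q)"
        by (auto simp: in_segment)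
      have w': "w = of_real t * ((1 - of_real u) * p + of_real u * q)"
        unfolding w by (simp add: scaleR_conv_of_real algebra_simps)
      show "norm (f w) \<le> C * (t ^ n * exp (- c * t))" unfolding w' by (rule bound[OF t u])
      show "(F has_field_derivative f w) (at w within closed_segment (of_real t * p) (of_real t * q))"
        using F'[OF mem[OF t u]] unfolding w'[symmetric] by (rule has_field_derivative_at_within)
    qed auto
    also have "of_real t * q - of_real t * p = of_real t * (q - p)" by (simp add: right_diff_distrib)
    finally show ?thesis using t by (simp add: norm_mult mult_ac)
  qed
  have lim_top: "(D \<longlongrightarrow> 0) at_top"
  proof (rule Lim_null_comparison)
    show "eventually (\<lambda>t. norm (D t) \<le> C * norm (q - p) * (t ^ Suc n * exp (- c * t))) at_top"
      using eventually_gt_at_top[of 0] by eventually_elim (rule Dbound)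
    show "((\<lambda>t. C * norm (q - p) * (t ^ Suc n * exp (- c * t))) \<longlongrightarrow> 0) at_top"
      using tendsto_mult_left[OF tendsto_power_mult_exp[OF c, of "Suc n"], of "C * norm (q - p)"] by simp
  qed
  have lim_0: "(D \<longlongrightarrow> 0) (at_right 0)"
  proof (rule Lim_null_comparison)
    show "eventually (\<lambda>t. norm (D t) \<le> C * norm (q - p) * (t ^ Suc n * exp (- c * t))) (at_right 0)"
      using eventually_at_right_less[of 0] by eventually_elim (rule Dbound)
    have "isCont (\<lambda>t. C * norm (q - p) * (t ^ Suc n * exp (- c * t))) 0" by (intro continuous_intros)
    then have "((\<lambda>t. C * norm (q - p) * (t ^ Suc n * exp (- c * t))) \<longlongrightarrow> 0) (at 0)"
      by (simp add: isCont_def)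
    then show "((\<lambda>t. C * norm (q - p) * (t ^ Suc n * exp (- c * t))) \<longlongrightarrow> 0) (at_right 0)"
      by (simp add: filterlim_at_split)
  qed
  have ein: "einterval 0 \<infinity> = {0<..}" by (auto simp: einterval_def zero_ereal_def)
  have "(LBINT t=0..\<infinity>. f (of_real t * q) * q - f (of_real t * p) * p) = 0 - 0"
  proof (rule interval_integral_FTC_integrable)
    fix t :: real assume "0 < ereal t" "ereal t < \<infinity>"
    then have t: "t > 0" by simp
    have L: "((\<lambda>w. F (w * p)) has_field_derivative f (of_real t * p) * p) (at (of_real t))" if "of_real t * p \<in> S" for p
      by (rule DERIV_chain2[where g = "\<lambda>w. w * p", OF F'[OF that]]) (auto intro!: derivative_eq_intros)
    show "(D has_vector_derivative f (of_real t * q) * q - f (of_real t * p) * p) (at t)"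
      unfolding D_def[abs_def]
      by (intro has_vector_derivative_diff has_vector_derivative_real_field L memp memq t)
    have cf: "isCont (\<lambda>t. f (of_real t * p)) t" if "of_real t * p \<in> S" for p
    proof (rule isCont_o2[where g = f])
      show "isCont (\<lambda>t. of_real t * p) t" by (intro continuous_intros)
      show "isCont f (of_real t * p)"
        using contf that S(1) continuous_on_eq_continuous_at by blast
    qed
    show "isCont (\<lambda>t. f (of_real t * q) * q - f (of_real t * p) * p) t"
      by (intro continuous_diff continuous_mult continuous_const cf memp memq t)
  next
    show "set_integrable lborel (einterval 0 \<infinity>) (\<lambda>t. f (of_real t * q) * q - f (of_real t * p) * p)"
      unfolding ein by (intro set_integral_diff set_integrable_mult_left ip iq)
    show "((D \<circ> real_of_ereal) \<longlongrightarrow> 0) (at_right 0)"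
      using lim_0 unfolding zero_ereal_def by (simp add: ereal_tendsto_simps)
    show "((D \<circ> real_of_ereal) \<longlongrightarrow> 0) (at_left \<infinity>)"
      using lim_top by (simp add: ereal_tendsto_simps)
  qed auto
  then have "(LBINT t:{0<..}. f (of_real t * q) * q - f (of_real t * p) * p) = 0"
    by (simp add: interval_lebesgue_integral_def ein)
  then show "(LBINT t:{0<..}. f (of_real t * p) * p) = (LBINT t:{0<..}. f (of_real t * q) * q)"
    by (subst (asm) set_integral_diff) (auto intro!: set_integrable_mult_left ip iq)
qed

text \<open>With e = exp (- pi i s) the terms are e (e^2)^k, and e / (1 - e^2) = 1 / (1/e - e) = 1 /
  (2 i sin (pi s)). The finite form is kept because it bounds all partial sums at once.\<close>

lemma geometric_sum_exp_sin:
  fixes s :: complex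
  assumes "sin (of_real pi * s) \<noteq> 0"
  shows "(\<Sum>k<K. exp (- (of_real ((2 * real k + 1) * pi) * \<i> * s)))
       = (1 - exp (- (of_real (2 * pi) * \<i> * s)) ^ K) / (2 * \<i> * sin (of_real pi * s))"
proof -
  define e where "e = exp (- (of_real pi * \<i> * s))"
  define E where "E = exp (of_real pi * \<i> * s)"
  have eE: "e * E = 1" by (simp add: e_def E_def flip: exp_add)
  have sin: "2 * \<i> * sin (of_real pi * s) = E - e"
    unfolding sin_exp_eq e_def E_def by (simp add: mult_ac)
  have w: "exp (- (of_real (2 * pi) * \<i> * s)) = e * e"
    by (simp add: e_def mult_ac flip: exp_add)
  have "E - e \<noteq> 0" using assms sin by auto
  have ne: "e * e \<noteq> 1" using eE \<open>E - e \<noteq> 0\<close>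
    by (metis eq_iff_diff_eq_0 mult_cancel_left mult_zero_left zero_neq_one)
  have "exp (- (of_real ((2 * real k + 1) * pi) * \<i> * s)) = e * (e * e) ^ k" for k
  proof -
    have "- (of_real ((2 * real k + 1) * pi) * \<i> * s) = - (of_real pi * \<i> * s) + of_nat k * (- (of_real (2 * pi) * \<i> * s))"
      by (simp add: algebra_simps)
    then show ?thesis by (simp only: exp_add exp_of_nat_mult w) (simp add: e_def)
  qed
  then have "(\<Sum>k<K. exp (- (of_real ((2 * real k + 1) * pi) * \<i> * s))) = e * (\<Sum>k<K. (e * e) ^ k)"
    by (simp add: sum_distrib_left)
  also have "(\<Sum>k<K. (e * e) ^ k) = (1 - (e * e) ^ K) / (1 - e * e)"
    using ne sum_gp_strict[of "e * e" K] by simp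
  also have "e * ((1 - (e * e) ^ K) / (1 - e * e)) = (1 - (e * e) ^ K) / (E - e)"
  proof -
    have "e * (E - e) = 1 - e * e" using eE by (simp add: right_diff_distrib)
    moreover have "e \<noteq> 0" by (simp add: e_def)
    ultimately show ?thesis by (metis mult_divide_mult_cancel_left times_divide_eq_right)
  qed
  finally show ?thesis by (simp only: sin w)
qed

text \<open>Dividing by the sine costs only one factor s, uniformly in the shift \<epsilon>. The
  identity |sin (pi s)|^2 = sin^2 (pi x) + sinh^2 (pi v) bounds both x and v near the origin;
  further out v alone suffices, since s stays close to a line of nonzero slope.\<close>

lemma norm_le_norm_sin:
  assumes mu: "\<mu> > 0" and e: "0 \<le> \<epsilon>" "\<epsilon> \<le> 1 / 4" and t: "t > 0"
    and s: "Re s = \<epsilon> + t" "\<bar>Im s\<bar> = \<mu> * t"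
  shows "norm s \<le> (1 + 2 / \<mu>) * norm (sin (of_real pi * s))"
proof -
  define x v where "x = Re s" and "v = \<bar>Im s\<bar>"
  have sq: "(norm (sin (of_real pi * s)))\<^sup>2 = (sin (pi * x))\<^sup>2 + (sinh (pi * v))\<^sup>2"
  proof -
    have sv: "(sinh (pi * v))\<^sup>2 = (sinh (pi * Im s))\<^sup>2" by (cases "Im s \<ge> 0") (auto simp: v_def)
    have "(norm (sin (of_real pi * s)))\<^sup>2
        = (sin (pi * x) * cosh (pi * Im s))\<^sup>2 + (cos (pi * x) * sinh (pi * Im s))\<^sup>2"
      unfolding cmod_power2 by (simp add: Re_sin Im_sin x_def cosh_def sinh_def)
    also have "\<dots> = (sin (pi * x))\<^sup>2 * (1 + (sinh (pi * Im s))\<^sup>2) + (1 - (sin (pi * x))\<^sup>2) * (sinh (pi * Im s))\<^sup>2"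
      by (simp add: power_mult_distrib cosh_square_eq cos_squared_eq add.commute)
    finally show ?thesis unfolding sv by (simp add: algebra_simps)
  qed
  have v0: "v \<ge> 0" by (simp add: v_def)
  have "pi * v \<le> sinh (pi * v)"
  proof -
    have "sinh 0 - 0 \<le> sinh (pi * v) - pi * v"
    proof (rule DERIV_nonneg_imp_nondecreasing[where f = "\<lambda>y. sinh y - y"])
      show "\<exists>d. ((\<lambda>y. sinh y - y) has_real_derivative d) (at y) \<and> 0 \<le> d" for y :: real
        by (rule exI[of _ "cosh y - 1"]) (auto intro!: derivative_eq_intros simp: cosh_real_ge_1)
    qed (use v0 in simp)
    then show ?thesis by simp
  qed
  also have "sinh (pi * v) \<le> norm (sin (of_real pi * s))"
    by (rule power2_le_imp_le) (simp_all add: sq)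
  finally have 1: "pi * v \<le> norm (sin (of_real pi * s))" .
  have 2: "\<bar>sin (pi * x)\<bar> \<le> norm (sin (of_real pi * s))"
    by (rule power2_le_imp_le) (simp_all add: sq)
  have ns: "norm s \<le> x + v" using cmod_le[of s] s e t by (simp add: x_def v_def)
  have v1: "v \<le> norm (sin (of_real pi * s)) / 3"
  proof -
    have "3 * v \<le> pi * v" using pi_gt3 v0 by (intro mult_right_mono) auto
    then show ?thesis using 1 by simp
  qed
  show ?thesis
  proof (cases "x \<le> 1 / 2")
    case True
    have x0: "x \<ge> 0" using s e t by (simp add: x_def)
    have "2 * x \<le> sin (pi * x)"
    proof -
      \<comment> \<open>Jordan's inequality: sin is concave on [0, pi], and pi x is the point with
        weight 2 x between 0 and pi / 2.\<close>
      have "convex_on {0..pi} (\<lambda>y. - sin y :: real)"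
      proof (rule f''_ge0_imp_convex)
        show "((\<lambda>y. - sin y) has_real_derivative - cos y) (at y)"
             "((\<lambda>y. - cos y) has_real_derivative sin y) (at y)" for y :: real
          by (auto intro!: derivative_eq_intros)
      qed (auto intro: sin_ge_zero)
      from convex_onD[OF this, of "2 * x" 0 "pi / 2"] show ?thesis
        using True x0 by (simp add: mult.commute)
    qed
    with 2 have "x \<le> norm (sin (of_real pi * s)) / 2" by linarith
    with ns v1 have "norm s \<le> 1 * norm (sin (of_real pi * s))"
      using norm_ge_zero[of "sin (of_real pi * s)"] by linarith
    also have "\<dots> \<le> (1 + 2 / \<mu>) * norm (sin (of_real pi * s))"
      using mu by (intro mult_right_mono) auto
    finally show ?thesis .
  next
    case False
    \<comment> \<open>Here t > 1/4 \<ge> \<epsilon>, so that the real part is controlled by t and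
      hence by |Im s| = \<mu> t.\<close>
    then have "x \<le> 2 * t" using s e by (simp add: x_def)
    also have "\<dots> = 2 / \<mu> * v" using mu s by (simp add: v_def)
    finally have "norm s \<le> (1 + 2 / \<mu>) * v" using ns by (simp add: algebra_simps)
    also have "\<dots> \<le> (1 + 2 / \<mu>) * norm (sin (of_real pi * s))"
      using v1 v0 mu by (intro mult_left_mono) auto
    finally show ?thesis .
  qed
qed

text \<open>The setting of the first series. It asks for only one side of the sector, so that the
  second series is the same locale at \<open>cnj a\<close>; N > 0 pays for the zero of the sine at
  0.\<close>

locale lower_sector =
  fixes sg :: real and N :: nat and a :: complex
  assumes sg: "sg < 0" and N: "N > 0" and a_side: "Im a + pi / (- sg) * Re a > 0"
begin

text \<open>
  \<open>dir\<close> is the direction of the ray with \<open>k = 0\<close>, scaled to real part \<open>1\<close>. It spans the line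
  \<open>Im s + mu * Re s = 0\<close>, and \<open>a\<close> lies strictly above this line.
\<close>

definition mu :: real where "mu = pi / (- sg)"
definition side :: real where "side = Im a + mu * Re a"
definition dir :: complex where "dir = Complex 1 (- mu)"
definition dist_const :: real where "dist_const = norm a * (2 * (1 + mu) / side)"

lemma mu_pos: "mu > 0"
  using sg by (simp add: mu_def field_simps)

lemma side_pos: "side > 0"
  using a_side by (simp add: side_def mu_def)

lemma dist_const_nonneg: "dist_const \<ge> 0"
  using mu_pos side_pos by (simp add: dist_const_def)

lemma Re_Im_dir [simp]: "Re dir = 1" "Im dir = - mu"
  by (simp_all add: dir_def)

lemma norm_dir_le: "norm dir \<le> 1 + mu"
  using cmod_le[of dir] mu_pos by simp

text \<open>The linear form Im + mu Re is at least side / 2 at a - s, while its norm is at most 1 +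
  mu. Allowing side / 2 instead of 0 leaves room for rays that start at a small \<epsilon> >
  0.\<close>

lemma norm_quotient_le:
  assumes "Im s + mu * Re s \<le> side / 2"
  shows "norm a / norm (a - s) \<le> dist_const" "a \<noteq> s"
proof -
  have "Im (a - s) + mu * Re (a - s) = side - (Im s + mu * Re s)"
    by (simp add: side_def algebra_simps)
  with assms have "side / 2 \<le> Im (a - s) + mu * Re (a - s)" by linarith
  also have "\<dots> \<le> norm (a - s) + mu * norm (a - s)"
    using mu_pos complex_Re_le_cmod[of "a - s"] abs_Im_le_cmod[of "a - s"]
    by (intro add_mono mult_left_mono) auto
  finally have 1: "side \<le> 2 * (1 + mu) * norm (a - s)" by (simp add: algebra_simps)
  then have pos: "norm (a - s) > 0" using side_pos mu_pos
    by (metis less_le_trans mult_zero_right norm_ge_zero order_le_less)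
  then show "a \<noteq> s" by auto
  have "1 / norm (a - s) \<le> 2 * (1 + mu) / side"
    using 1 pos side_pos mu_pos by (simp add: field_simps)
  from mult_left_mono[OF this, of "norm a"] show "norm a / norm (a - s) \<le> dist_const"
    by (simp add: dist_const_def)
qed

definition branch :: "nat \<Rightarrow> complex \<Rightarrow> complex" where
  "branch k s = ray_fun sg N a s * exp (- (of_real ((2 * real k + 1) * pi) * \<i> * s))"

text \<open>Between the directions q and \<open>dir\<close> the points stay below the line through
  \<open>dir\<close>, hence away from a, and in the right half-plane. There exp (sg s) is bounded
  because sg < 0, and the factor exp (-(2k+1) pi i s) decays because Im s is negative and
  proportional to t.\<close>

lemma branch_rotate:
  assumes q: "Re q > 0" "Im q + mu * Re q \<le> 0"
  shows "set_integrable lborel {0<..} (\<lambda>t. branch k (of_real t * q))"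
    and "set_integrable lborel {0<..} (\<lambda>t. branch k (of_real t * dir))"
    and "(LBINT t:{0<..}. branch k (of_real t * q) * q) = (LBINT t:{0<..}. branch k (of_real t * dir) * dir)"
proof -
  define S where "S = {s. Re s > 0} \<inter> {s. Im s + mu * Re s < side}"
  \<comment> \<open>At t = 1 the imaginary part is at most - m on the whole segment from q to
    \<open>dir\<close>.\<close>
  define m where "m = min (- Im q) mu"
  define M where "M = norm q + norm dir"
  have Imq: "Im q < 0" using q mu_pos by (smt (verit) mult_pos_pos)
  then have m: "m > 0" using mu_pos by (simp add: m_def)
  have S_inner: "S = {s. Re s > 0} \<inter> {s. inner (Complex mu 1) s < side}"
    by (auto simp: S_def inner_complex_def add.commute)
  have S: "open S" "convex S"
    unfolding S_inner by (intro open_Int open_halfspace_Re_gt open_halfspace_lt convex_Int convex_halfspace_Re_gt convex_halfspace_lt)+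
  have sub: "S \<subseteq> {s. Re s > 0} - {a}" by (auto simp: S_def side_def)
  have holo: "branch k holomorphic_on S"
    unfolding branch_def[abs_def]
    by (intro holomorphic_intros holomorphic_on_subset[OF ray_fun_holomorphic] sub)
  have pt: "0 < Re s" "Im s + mu * Re s \<le> 0" "Im s \<le> - m * t" "norm s \<le> t * M"
    if t: "0 < t" and u: "0 \<le> u" "u \<le> 1" and s: "s = of_real t * ((1 - of_real u) * q + of_real u * dir)" for t u s
  proof -
    have Re: "Re s = t * ((1 - u) * Re q + u)" and Im: "Im s = t * ((1 - u) * Im q - u * mu)"
      unfolding s by simp_all
    have "(1 - u) * Re q + u > 0"
      using q(1) u by (cases "u = 0") (auto intro: add_nonneg_pos)
    then show "0 < Re s" unfolding Re using t by simp
    have "Im s + mu * Re s = t * ((1 - u) * (Im q + mu * Re q))"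
      unfolding Re Im by (simp add: algebra_simps)
    also have "\<dots> \<le> 0" using t u q(2) by (simp add: mult_le_0_iff mult_nonneg_nonpos)
    finally show "Im s + mu * Re s \<le> 0" .
    have "(1 - u) * Im q - u * mu \<le> (1 - u) * (- m) - u * m"
      using u by (intro diff_mono mult_left_mono) (auto simp: m_def)
    then have "t * ((1 - u) * Im q - u * mu) \<le> t * (- m)"
      using t by (intro mult_left_mono) (auto simp: algebra_simps)
    then show "Im s \<le> - m * t" unfolding Im by (simp add: mult.commute)
    have "norm ((1 - of_real u) * q + of_real u * dir) \<le> (1 - u) * norm q + u * norm dir"
      using norm_triangle_ineq[of "(1 - of_real u) * q" "of_real u * dir"] u
      by (simp add: norm_mult) (metis abs_of_nonneg diff_ge_0_iff_ge norm_of_real of_real_1 of_real_diff)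
    also have "\<dots> \<le> 1 * norm q + 1 * norm dir" using u by (intro add_mono mult_right_mono) auto
    finally show "norm s \<le> t * M" unfolding s norm_mult M_def using t by simp
  qed
  have bound: "norm (branch k s) \<le> dist_const * M ^ N * (t ^ N * exp (- (pi * m) * t))"
    if t: "0 < t" and u: "0 \<le> u" "u \<le> 1" and s: "s = of_real t * ((1 - of_real u) * q + of_real u * dir)" for t u s
  proof -
    note p = pt[OF that]
    have "norm (ray_fun sg N a s) \<le> norm s ^ N * exp (sg * Re s) * (norm a / norm (a - s))"
      by (rule norm_ray_fun_le[OF p(1)])
    also have "\<dots> \<le> (t * M) ^ N * 1 * dist_const"
      using p sg side_pos
      by (intro mult_mono power_mono norm_quotient_le) (auto simp: mult_nonpos_nonneg M_def t order_less_imp_le)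
    finally have 1: "norm (ray_fun sg N a s) \<le> dist_const * M ^ N * t ^ N"
      by (simp add: power_mult_distrib mult_ac)
    have "(2 * real k + 1) * pi * Im s \<le> 1 * pi * (- m * t)"
    proof -
      have "1 * pi * (m * t) \<le> (2 * real k + 1) * pi * (- Im s)"
        using p(3) m t by (intro mult_mono) auto
      then show ?thesis by simp
    qed
    then have 2: "norm (exp (- (of_real ((2 * real k + 1) * pi) * \<i> * s))) \<le> exp (- (pi * m) * t)"
      by (simp add: mult_ac)
    have "norm (branch k s) \<le> (dist_const * M ^ N * t ^ N) * exp (- (pi * m) * t)"
      unfolding branch_def norm_mult
      by (intro mult_mono 1 2) (use t dist_const_nonneg in \<open>auto simp: M_def\<close>)
    then show ?thesis by (simp add: mult_ac)
  qed
  have mem: "of_real t * ((1 - of_real u) * q + of_real u * dir) \<in> S" if "0 < t" "0 \<le> u" "u \<le> 1" for t u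
    using pt[OF that refl] side_pos by (simp add: S_def)
  note R = ray_integral_rotate[OF S holo mult_pos_pos[OF pi_gt_zero m] mem bound[OF _ _ _ refl]]
  show "set_integrable lborel {0<..} (\<lambda>t. branch k (of_real t * q))"
    and "set_integrable lborel {0<..} (\<lambda>t. branch k (of_real t * dir))"
    and "(LBINT t:{0<..}. branch k (of_real t * q) * q) = (LBINT t:{0<..}. branch k (of_real t * dir) * dir)"
    by (rule R; assumption)+
qed

lemma sin_nonzero_on_ray:
  assumes "0 \<le> \<epsilon>" "\<epsilon> \<le> 1 / 4" "t > 0"
  shows "sin (of_real pi * (of_real \<epsilon> + of_real t * dir)) \<noteq> 0"
proof
  assume "sin (of_real pi * (of_real \<epsilon> + of_real t * dir)) = 0"
  with norm_le_norm_sin[OF mu_pos assms, of "of_real \<epsilon> + of_real t * dir"] mu_pos assms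
  have "of_real \<epsilon> + of_real t * dir = 0" by (simp add: abs_mult)
  then show False using assms by (auto simp: complex_eq_iff)
qed

lemma kernel_continuous:
  assumes "0 \<le> \<epsilon>" "\<epsilon> \<le> 1 / 4" "\<epsilon> * mu \<le> side / 2"
  shows "continuous_on {0<..} (\<lambda>t. ray_kernel sg N a (of_real \<epsilon> + of_real t * dir))"
proof -
  have "of_real \<epsilon> + of_real t * dir \<in> {s. Re s > 0} - {a}" if "t > 0" for t
    using norm_quotient_le(2)[of "of_real \<epsilon> + of_real t * dir"] assms that by (auto simp: algebra_simps)
  then show ?thesis
    unfolding ray_kernel_def using sin_nonzero_on_ray[OF assms(1,2)]
    by (intro continuous_intros continuous_on_compose2[OF holomorphic_on_imp_continuous_on[OF ray_fun_holomorphic]]) auto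
qed

text \<open>The majorant must not depend on the shift \<epsilon>: it serves both for the ray from 0
  and for the sides of the triangles that shrink towards it.\<close>

lemma kernel_dominated:
  obtains W where "set_integrable lborel {0<..} W"
    "\<And>\<epsilon> t. 0 \<le> \<epsilon> \<Longrightarrow> \<epsilon> \<le> 1 / 4 \<Longrightarrow> \<epsilon> * mu \<le> side / 2 \<Longrightarrow> t > 0 \<Longrightarrow>
       norm (ray_kernel sg N a (of_real \<epsilon> + of_real t * dir)) \<le> W t"
proof
  \<comment> \<open>One of the N powers of s is spent against the sine; the other n only produce
    polynomial growth.\<close>
  define n where "n = N - 1"
  have Nn: "N = Suc n" using N by (simp add: n_def)
  define K where "K = dist_const * (1 + 2 / mu) / 2 * (2 * (1 + mu)) ^ n"
  have K: "K \<ge> 0" using mu_pos dist_const_nonneg by (simp add: K_def)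
  define W where "W t = K * (t ^ 0 * exp (- (- sg) * t) + t ^ n * exp (- (- sg) * t))" for t :: real
  show "set_integrable lborel {0<..} W"
    unfolding W_def using sg
    by (intro set_integrable_mult_right set_integral_add set_integrable_power_times_exp) auto
  fix \<epsilon> t :: real
  assume e: "0 \<le> \<epsilon>" "\<epsilon> \<le> 1 / 4" "\<epsilon> * mu \<le> side / 2" and t: "t > 0"
  define s where "s = of_real \<epsilon> + of_real t * dir"
  have s: "Re s = \<epsilon> + t" "Im s = - (mu * t)" by (simp_all add: s_def)
  have Re: "Re s > 0" using s e t by simp
  have side: "Im s + mu * Re s \<le> side / 2" using e by (simp add: s algebra_simps)
  have sin: "norm s \<le> (1 + 2 / mu) * norm (sin (of_real pi * s))"
    by (rule norm_le_norm_sin[OF mu_pos e(1,2) t]) (use s mu_pos t in \<open>simp_all add: abs_mult\<close>)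
  have sin0: "norm (sin (of_real pi * s)) > 0" using sin_nonzero_on_ray[OF e(1,2) t] by (simp add: s_def)
  have ns: "norm s \<le> (1 + mu) * (1 + t)"
  proof -
    have "norm s \<le> \<epsilon> + t * norm dir"
      using norm_triangle_ineq[of "of_real \<epsilon>" "of_real t * dir"] e t by (simp add: s_def norm_mult)
    also have "\<dots> \<le> 1 + t * (1 + mu)" using e t norm_dir_le by (intro add_mono mult_left_mono) auto
    also have "\<dots> \<le> (1 + mu) * (1 + t)" using mu_pos t by (simp add: algebra_simps)
    finally show ?thesis .
  qed
  have "norm (ray_kernel sg N a s) = norm (ray_fun sg N a s) / (2 * norm (sin (of_real pi * s)))"
    by (simp add: ray_kernel_def norm_divide norm_mult)
  also have "\<dots> \<le> (norm s ^ N * exp (sg * Re s) * dist_const) / (2 * norm (sin (of_real pi * s)))"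
  proof (intro divide_right_mono)
    have "norm (ray_fun sg N a s) \<le> norm s ^ N * exp (sg * Re s) * (norm a / norm (a - s))"
      by (rule norm_ray_fun_le[OF Re])
    also have "\<dots> \<le> norm s ^ N * exp (sg * Re s) * dist_const"
      by (intro mult_left_mono norm_quotient_le side) auto
    finally show "norm (ray_fun sg N a s) \<le> norm s ^ N * exp (sg * Re s) * dist_const" .
  qed auto
  also have "\<dots> = (norm s ^ n * exp (sg * Re s) * dist_const / 2) * (norm s / norm (sin (of_real pi * s)))"
    by (simp add: Nn mult_ac)
  also have "\<dots> \<le> (((1 + mu) * (1 + t)) ^ n * exp (sg * t) * dist_const / 2) * (1 + 2 / mu)"
  proof (intro mult_mono divide_right_mono power_mono ns)
    show "exp (sg * Re s) \<le> exp (sg * t)" using s e sg by (simp add: mult_left_mono_neg)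
    show "norm s / norm (sin (of_real pi * s)) \<le> 1 + 2 / mu"
      using sin sin0 by (simp add: divide_le_eq)
  qed (use mu_pos dist_const_nonneg t in auto)
  also have "\<dots> = dist_const * (1 + 2 / mu) / 2 * (1 + mu) ^ n * exp (sg * t) * (1 + t) ^ n"
    by (simp add: power_mult_distrib mult_ac)
  also have "\<dots> \<le> dist_const * (1 + 2 / mu) / 2 * (1 + mu) ^ n * exp (sg * t) * (2 ^ n * (1 + t ^ n))"
  proof (rule mult_left_mono)
    show "(1 + t) ^ n \<le> 2 ^ n * (1 + t ^ n)"
    proof (cases "t \<le> 1")
      case True
      then have "(1 + t) ^ n \<le> 2 ^ n" using t by (intro power_mono) auto
      also have "\<dots> \<le> 2 ^ n * (1 + t ^ n)" using t by simp
      finally show ?thesis .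
    next
      case False
      then have "(1 + t) ^ n \<le> (2 * t) ^ n" using t by (intro power_mono) auto
      also have "\<dots> \<le> 2 ^ n * (1 + t ^ n)" by (simp add: power_mult_distrib)
      finally show ?thesis .
    qed
  qed (use mu_pos dist_const_nonneg in auto)
  also have "\<dots> = W t"
  proof -
    have "C * P * E * (Q * (1 + T)) = C * (Q * P) * (E + T * E)" for C P E Q T :: real
      by (simp add: algebra_simps)
    then show ?thesis unfolding W_def K_def power_mult_distrib minus_minus power_0 mult_1_left .
  qed
  finally show "norm (ray_kernel sg N a (of_real \<epsilon> + of_real t * dir)) \<le> W t" by (simp add: s_def)
qed

lemma kernel_integrable: "set_integrable lborel {0<..} (\<lambda>t. ray_kernel sg N a (of_real t * dir))"
proof -
  obtain W where W: "set_integrable lborel {0<..} W"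
    "\<And>\<epsilon> t. 0 \<le> \<epsilon> \<Longrightarrow> \<epsilon> \<le> 1 / 4 \<Longrightarrow> \<epsilon> * mu \<le> side / 2 \<Longrightarrow> t > 0 \<Longrightarrow>
       norm (ray_kernel sg N a (of_real \<epsilon> + of_real t * dir)) \<le> W t"
    using kernel_dominated by blast
  show ?thesis
    using kernel_continuous[of 0] W(2)[of 0] side_pos
    by (intro set_integrable_continuous_dominated[OF _ W(1)]) auto
qed

text \<open>The partial sums are the kernel times 1 - w^K with |w| < 1, since the ray runs below the
  real axis. Twice the modulus of the kernel therefore dominates them all.\<close>

lemma branch_sums_kernel:
  "(\<lambda>k. LBINT t:{0<..}. branch k (of_real t * dir)) sums (LBINT t:{0<..}. ray_kernel sg N a (of_real t * dir))"
proof -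
  let ?g = "\<lambda>t. ray_kernel sg N a (of_real t * dir)"
  define w where "w t = exp (- (of_real (2 * pi) * \<i> * (of_real t * dir)))" for t
  have nw: "norm (w t) < 1" if "t > 0" for t
    using that mu_pos by (simp add: w_def)
  have int: "set_integrable lborel {0<..} (\<lambda>t. branch k (of_real t * dir))" for k
    by (rule branch_rotate(2)[of dir]) auto
  have partial: "(\<Sum>k<K. branch k (of_real t * dir)) = ?g t * (1 - w t ^ K)"
    if "t > 0" for t K
    using geometric_sum_exp_sin[of "of_real t * dir" K] sin_nonzero_on_ray[of 0 t] that
    by (simp add: branch_def ray_kernel_def w_def flip: sum_distrib_left)
  have "(\<lambda>K. LBINT t:{0<..}. ?g t * (1 - w t ^ K))
      \<longlonglongrightarrow> (LBINT t:{0<..}. ?g t)"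
  proof (rule set_integral_tendsto_dominated)
    have "continuous_on {0<..} (\<lambda>t. ?g t)"
      using kernel_continuous[of 0] side_pos by simp
    then show "set_borel_measurable lborel {0<..} (\<lambda>t. ?g t)"
      "set_borel_measurable lborel {0<..} (\<lambda>t. ?g t * (1 - w t ^ K))" for K
      unfolding set_borel_measurable_def measurable_lborel2 w_def
      by (intro borel_measurable_continuous_on_indicator continuous_intros; simp)+
    show "set_integrable lborel {0<..} (\<lambda>t. 2 * norm (?g t))"
      using kernel_integrable by (intro set_integrable_mult_right set_integrable_norm)
    fix t :: real assume t: "t > 0"
    have "(\<lambda>K. ?g t * (1 - w t ^ K)) \<longlonglongrightarrow> ?g t * (1 - 0)"
      by (intro tendsto_intros LIMSEQ_power_zero nw t)
    then show "(\<lambda>K. ?g t * (1 - w t ^ K)) \<longlonglongrightarrow> ?g t"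
      by simp
    fix K
    have "norm (1 - w t ^ K) \<le> 1 + norm (w t) ^ K"
      using norm_triangle_ineq4[of 1 "w t ^ K"] by (simp add: norm_power)
    also have "\<dots> \<le> 2" using nw[OF t] power_le_one[of "norm (w t)" K] by simp
    finally have "norm (?g t) * norm (1 - w t ^ K)
        \<le> norm (?g t) * 2" by (intro mult_left_mono) auto
    then show "norm (?g t * (1 - w t ^ K)) \<le> 2 * norm (?g t)"
      by (simp add: norm_mult mult.commute)
  qed
  moreover have "(LBINT t:{0<..}. ?g t * (1 - w t ^ K))
      = (\<Sum>k<K. LBINT t:{0<..}. branch k (of_real t * dir))" for K
  proof -
    have "(LBINT t:{0<..}. ?g t * (1 - w t ^ K))
        = (LBINT t:{0<..}. (\<Sum>k<K. branch k (of_real t * dir)))"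
      by (rule set_lebesgue_integral_cong) (auto simp: partial)
    also have "\<dots> = (\<Sum>k<K. LBINT t:{0<..}. branch k (of_real t * dir))"
      using int unfolding set_lebesgue_integral_def set_integrable_def
      by (subst scaleR_sum_right) (rule Bochner_Integration.integral_sum, simp)
    finally show ?thesis .
  qed
  ultimately show ?thesis by (simp add: sums_def)
qed

end

section \<open>Residues of the summed kernel\<close>

lemma contour_integral_linepath_ray:
  fixes f :: "complex \<Rightarrow> complex"
  assumes T: "T > 0" and f: "continuous_on (closed_segment z (z + of_real T * d)) f"
  shows "contour_integral (linepath z (z + of_real T * d)) f = (LBINT t:{0..T}. f (z + of_real t * d) * d)"
proof -
  define h where "h t = f (z + of_real t * d) * d" for t
  have "z + of_real t * d \<in> closed_segment z (z + of_real T * d)" if "t \<in> {0..T}" for t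
    unfolding in_segment using that T
    by (intro exI[of _ "t / T"]) (auto simp: scaleR_conv_of_real field_simps)
  then have h: "continuous_on {0..T} h"
    unfolding h_def by (intro continuous_intros continuous_on_compose2[OF f]) auto
  then have hi: "set_integrable lborel {0..T} h"
    unfolding set_integrable_def by (rule borel_integrable_compact[OF compact_Icc])
  have "(h has_integral (LBINT t:{0..T}. h t)) {0..T}"
    using set_borel_integral_eq_integral[OF hi] by (simp add: has_integral_integral)
  from has_integral_stretch_real[OF this, of T] T
  have "((\<lambda>x. h (T * x)) has_integral (1 / T) *\<^sub>R (LBINT t:{0..T}. h t)) {0..1}" by simp
  from has_integral_mult_right[OF this, of "of_real T"]
  have "((\<lambda>x. of_real T * h (T * x)) has_integral (LBINT t:{0..T}. h t)) {0..1}"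
    using T by (simp add: scaleR_conv_of_real)
  moreover have "of_real T * h (T * x) = f (linepath z (z + of_real T * d) x) * ((z + of_real T * d) - z)" for x
  proof -
    have "linepath z (z + of_real T * d) x = z + of_real (T * x) * d"
      by (simp add: linepath_def scaleR_conv_of_real algebra_simps)
    then show ?thesis by (simp add: h_def mult_ac)
  qed
  ultimately have "(f has_contour_integral (LBINT t:{0..T}. h t)) (linepath z (z + of_real T * d))"
    by (simp add: has_contour_integral_linepath)
  then show ?thesis by (simp add: contour_integral_unique h_def)
qed

lemma residue_div_sin_nat:
  fixes F :: "complex \<Rightarrow> complex" and n :: nat
  assumes S: "open S" "of_nat n \<in> S" and F: "F holomorphic_on S"
    and nz: "\<And>w. w \<in> S \<Longrightarrow> w \<noteq> of_nat n \<Longrightarrow> sin (of_real pi * w) \<noteq> 0"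
  shows "residue (\<lambda>w. F w / (2 * \<i> * sin (of_real pi * w))) (of_nat n) = (-1) ^ n * F (of_nat n) / (2 * pi * \<i>)"
proof (rule residue_simple'[OF S])
  show "(\<lambda>w. F w / (2 * \<i> * sin (of_real pi * w))) holomorphic_on (S - {of_nat n})"
    using nz by (intro holomorphic_intros holomorphic_on_subset[OF F]) auto
  have cosn: "cos (of_real pi * of_nat n :: complex) = (-1) ^ n"
    using cos_npi[of n] cos_of_real[of "pi * real n"] by (simp add: mult.commute)
  have sinn: "sin (of_real pi * of_nat n :: complex) = 0"
    using sin_npi[of n] sin_of_real[of "pi * real n"] by (simp add: mult.commute)
  have "((\<lambda>w. sin (of_real pi * w)) has_field_derivative cos (of_real pi * of_nat n) * of_real pi) (at (of_nat n :: complex))"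
    by (auto intro!: derivative_eq_intros)
  then have "((\<lambda>w. sin (of_real pi * w) / (w - of_nat n)) \<longlongrightarrow> (-1) ^ n * of_real pi) (at (of_nat n :: complex))"
    unfolding has_field_derivative_iff by (simp add: cosn sinn)
  moreover have "(F \<longlongrightarrow> F (of_nat n)) (at (of_nat n))"
    using holomorphic_on_imp_continuous_on[OF F] S continuous_on_eq_continuous_at isContD by blast
  ultimately have "((\<lambda>w. F w / (2 * \<i> * (sin (of_real pi * w) / (w - of_nat n)))) \<longlongrightarrow> F (of_nat n) / (2 * \<i> * ((-1) ^ n * of_real pi))) (at (of_nat n))"
    by (intro tendsto_intros) auto
  moreover have "F (of_nat n) / (2 * \<i> * ((-1) ^ n * of_real pi)) = (-1) ^ n * F (of_nat n) / (2 * pi * \<i>)"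
    by (cases "even n") auto
  ultimately show "((\<lambda>w. F w / (2 * \<i> * sin (of_real pi * w)) * (w - of_nat n)) \<longlongrightarrow> (-1) ^ n * F (of_nat n) / (2 * pi * \<i>)) (at (of_nat n))"
    by simp
qed

text \<open>The sign comes from the factor 2 i. The upper side of the wedge is thereby read off from
  the lower side for \<open>cnj a\<close>.\<close>

lemma ray_kernel_cnj:
  assumes "Re s > 0"
  shows "cnj (ray_kernel sg N a s) = - ray_kernel sg N (cnj a) (cnj s)"
proof -
  have "cnj (stirling_quotient s) = stirling_quotient (cnj s)"
    unfolding stirling_quotient_def using assms by (simp add: cnj_powr cnj_Gamma exp_cnj)
  then show ?thesis by (simp add: ray_kernel_def ray_fun_def exp_cnj cnj_sin)
qed

context lower_sector
begin

text \<open>Since the majorant is independent of the shift, dominated convergence moves the starting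
  point to 0 and the length to infinity in one limit.\<close>

lemma kernel_segment_tendsto:
  assumes e: "\<epsilon> \<longlonglongrightarrow> 0" "\<And>K. 0 < \<epsilon> K" "\<And>K. \<epsilon> K \<le> 1 / 4" "\<And>K. \<epsilon> K * mu \<le> side / 2"
    and T: "filterlim T at_top sequentially"
  shows "(\<lambda>K. LBINT t:{0..T K}. ray_kernel sg N a (of_real (\<epsilon> K) + of_real t * dir) * dir)
     \<longlonglongrightarrow> (LBINT t:{0<..}. ray_kernel sg N a (of_real t * dir) * dir)"
proof -
  let ?F = "\<lambda>K t. ray_kernel sg N a (of_real (\<epsilon> K) + of_real t * dir) * dir"
  let ?G = "\<lambda>t. ray_kernel sg N a (of_real t * dir) * dir"
  obtain W where W: "set_integrable lborel {0<..} W"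
    "\<And>\<epsilon> t. 0 \<le> \<epsilon> \<Longrightarrow> \<epsilon> \<le> 1 / 4 \<Longrightarrow> \<epsilon> * mu \<le> side / 2 \<Longrightarrow> t > 0 \<Longrightarrow>
       norm (ray_kernel sg N a (of_real \<epsilon> + of_real t * dir)) \<le> W t"
    using kernel_dominated by blast
  have ptS: "of_real \<epsilon>' + of_real t * dir \<in> {s. Re s > 0} - {a}"
    if "0 \<le> \<epsilon>'" "\<epsilon>' * mu \<le> side / 2" "t \<ge> 0" "\<epsilon>' + t > 0" for \<epsilon>' t
    using norm_quotient_le(2)[of "of_real \<epsilon>' + of_real t * dir"] that by (auto simp: algebra_simps)
  have meas: "set_borel_measurable lborel {0..T K} (\<lambda>t. ?F K t)" for K
    unfolding set_borel_measurable_def measurable_lborel2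
  proof (rule borel_measurable_continuous_on_indicator)
    \<comment> \<open>At t = 0, outside the range of \<open>sin_nonzero_on_ray\<close>, the point is
      the shift itself, which lies strictly between 0 and 1.\<close>
    have sin0: "sin (of_real pi * (of_real (\<epsilon> K) + of_real t * dir)) \<noteq> 0" if "t \<ge> 0" for t
    proof (cases "t = 0")
      case True
      have "sin (pi * \<epsilon> K) > 0"
        using e(2)[of K] e(3)[of K] by (intro sin_gt_zero) auto
      then have "complex_of_real (sin (pi * \<epsilon> K)) \<noteq> 0" by simp
      then show ?thesis using True by (simp only: sin_of_real[symmetric]) simp
    next
      case False
      then show ?thesis using sin_nonzero_on_ray[of "\<epsilon> K" t] e(2)[of K] e(3)[of K] that by simp
    qed
    have pt: "of_real (\<epsilon> K) + of_real t * dir \<in> {s. Re s > 0} - {a}" if "t \<ge> 0" for t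
      using ptS[of "\<epsilon> K" t] e(2)[of K] e(4)[of K] that by simp
    have "continuous_on {0..T K} (\<lambda>t. ray_fun sg N a (of_real (\<epsilon> K) + of_real t * dir))"
    proof (rule continuous_on_compose2[OF holomorphic_on_imp_continuous_on[OF ray_fun_holomorphic]])
      show "continuous_on {0..T K} (\<lambda>t. of_real (\<epsilon> K) + of_real t * dir)" by (intro continuous_intros)
      show "(\<lambda>t. of_real (\<epsilon> K) + of_real t * dir) ` {0..T K} \<subseteq> {s. Re s > 0} - {a}"
        using pt by (simp add: image_subset_iff)
    qed
    moreover have "continuous_on {0..T K} (\<lambda>t. 2 * \<i> * sin (of_real pi * (of_real (\<epsilon> K) + of_real t * dir)))"
      by (intro continuous_intros)
    ultimately show "continuous_on {0..T K} (\<lambda>t. ?F K t)"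
      unfolding ray_kernel_def
      by (intro continuous_on_mult_right continuous_on_divide) (use sin0 in simp_all)
  qed simp
  have fun_cont: "isCont (ray_kernel sg N a) (of_real t * dir)" if t: "t > 0" for t
  proof -
    have "open ({s. Re s > 0} - {a})" by (intro open_Diff open_halfspace_Re_gt) auto
    moreover have "of_real t * dir \<in> {s. Re s > 0} - {a}" using ptS[of 0 t] t side_pos by simp
    ultimately have "isCont (ray_fun sg N a) (of_real t * dir)"
      using holomorphic_on_imp_continuous_on[OF ray_fun_holomorphic] continuous_on_eq_continuous_at by blast
    moreover have "isCont (\<lambda>s. 2 * \<i> * sin (of_real pi * s)) (of_real t * dir)"
      by (intro continuous_intros)
    moreover have "2 * \<i> * sin (of_real pi * (of_real t * dir)) \<noteq> 0"
      using sin_nonzero_on_ray[of 0 t] t by simp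
    ultimately show ?thesis
      unfolding ray_kernel_def[abs_def] by (rule isCont_divide)
  qed
  show ?thesis
    unfolding set_lebesgue_integral_def
  proof (rule integral_dominated_convergence[where w = "\<lambda>t. norm dir * norm (indicator {0<..} t *\<^sub>R W t)"])
    show "(\<lambda>t. indicator {0<..} t *\<^sub>R ?G t) \<in> borel_measurable lborel"
      unfolding measurable_lborel2
      using kernel_continuous[of 0] side_pos by (intro borel_measurable_continuous_on_indicator continuous_intros) auto
    show "(\<lambda>t. indicator {0..T K} t *\<^sub>R ?F K t) \<in> borel_measurable lborel" for K
      using meas[of K] by (simp add: set_borel_measurable_def)
    show "integrable lborel (\<lambda>t. norm dir * norm (indicator {0<..} t *\<^sub>R W t))"
      using W(1) unfolding set_integrable_def by (intro integrable_mult_right integrable_norm)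
    \<comment> \<open>The point t = 0 belongs to the closed intervals but not to the limit set, and
      is discarded as a null set.\<close>
    show "AE t in lborel. (\<lambda>K. indicator {0..T K} t *\<^sub>R ?F K t)
        \<longlonglongrightarrow> indicator {0<..} t *\<^sub>R ?G t"
      using AE_lborel_singleton[of 0]
    proof eventually_elim
      case (elim t)
      show ?case
      proof (cases "t > 0")
        case True
        have ev: "eventually (\<lambda>K. t \<le> T K) sequentially"
          using T by (simp add: filterlim_at_top)
        have "(\<lambda>K. of_real (\<epsilon> K) + of_real t * dir) \<longlonglongrightarrow> of_real 0 + of_real t * dir"
          by (intro tendsto_intros e(1))
        then have "(\<lambda>K. of_real (\<epsilon> K) + of_real t * dir) \<longlonglongrightarrow> of_real t * dir" by simp
        from isCont_tendsto_compose[OF fun_cont[OF True] this]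
        have "(\<lambda>K. ?F K t) \<longlonglongrightarrow> ?G t"
          by (intro tendsto_intros)
        then have "(\<lambda>K. indicator {0..T K} t *\<^sub>R ?F K t)
            \<longlonglongrightarrow> ?G t"
          by (rule Lim_transform_eventually) (use ev True in \<open>auto elim!: eventually_mono\<close>)
        then show ?thesis using True by simp
      next
        case False
        then show ?thesis using elim by simp
      qed
    qed
    show "AE t in lborel. norm (indicator {0..T K} t *\<^sub>R ?F K t)
        \<le> norm dir * norm (indicator {0<..} t *\<^sub>R W t)" for K
      using AE_lborel_singleton[of 0]
    proof eventually_elim
      case (elim t)
      show ?case
      proof (cases "t > 0")
        case True
        have "norm (ray_kernel sg N a (of_real (\<epsilon> K) + of_real t * dir)) \<le> \<bar>W t\<bar>"
          using W(2)[of "\<epsilon> K" t] e(2-4)[of K] True by (simp add: order.trans[OF _ abs_ge_self] less_imp_le)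
        then show ?thesis using True
          by (auto simp: norm_mult indicator_def mult.commute[of _ "norm dir"] intro!: mult_left_mono)
      next
        case False
        then show ?thesis using elim by simp
      qed
    qed
  qed
qed

end

section \<open>Residues and the limit of the triangles\<close>

definition ray_integral :: "real \<Rightarrow> nat \<Rightarrow> complex \<Rightarrow> complex" where
  "ray_integral sg N a =
     (LBINT t:{0<..}. ray_kernel sg N a (of_real t * Complex 1 (- (pi / (- sg)))) * Complex 1 (- (pi / (- sg))))"

lemma sin_pi_eq_0E:
  fixes w :: complex
  assumes "sin (of_real pi * w) = 0"
  obtains m :: int where "w = of_int m"
proof -
  from assms obtain m :: int where "of_real pi * w = of_real (of_int m * pi)" unfolding sin_eq_0 by auto
  then show ?thesis using that[of m] by (auto simp: mult.commute)
qed

lemma residue_ray_kernel_nat: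
  fixes a :: complex
  assumes "a \<notin> \<nat>" "n \<ge> 1"
  shows "residue (ray_kernel sg N a) (of_nat n) = (-1) ^ n * ray_fun sg N a (of_nat n) / (2 * pi * \<i>)"
proof -
  \<comment> \<open>A disc of this radius contains no other integer, does not contain a, and stays
    in the right half-plane because n \<ge> 1.\<close>
  define r where "r = min (1 / 2) (dist (of_nat n) a)"
  have "dist (of_nat n) a > 0" using assms by auto
  then have r: "r > 0" by (simp add: r_def)
  have "ray_fun sg N a holomorphic_on ball (of_nat n) r"
  proof (rule holomorphic_on_subset[OF ray_fun_holomorphic])
    show "ball (of_nat n) r \<subseteq> {s. 0 < Re s} - {a}"
    proof
      fix w :: complex assume "w \<in> ball (of_nat n) r"
      then have w: "dist (of_nat n) w < 1 / 2" "dist (of_nat n) w < dist (of_nat n) a"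
        by (auto simp: r_def)
      have "\<bar>real n - Re w\<bar> < 1 / 2"
        using w(1) abs_Re_le_cmod[of "of_nat n - w"] by (simp add: dist_norm)
      moreover have "real n \<ge> 1" using assms by simp
      ultimately have "0 < Re w" by linarith
      then show "w \<in> {s. 0 < Re s} - {a}" using w(2) by auto
    qed
  qed
  moreover have "sin (of_real pi * w) \<noteq> 0" if w: "w \<in> ball (of_nat n) r" "w \<noteq> of_nat n" for w :: complex
  proof
    assume "sin (of_real pi * w) = 0"
    then obtain m :: int where m: "w = of_int m" by (rule sin_pi_eq_0E)
    have "\<bar>real n - Re w\<bar> < 1 / 2"
      using w(1) abs_Re_le_cmod[of "of_nat n - w"] by (simp add: dist_norm r_def)
    then have "\<bar>of_int (int n - m) :: real\<bar> < 1" by (simp add: m)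
    then have "m = int n" by linarith
    with m w show False by simp
  qed
  ultimately show ?thesis
    unfolding ray_kernel_def[abs_def] using r by (intro residue_div_sin_nat[of "ball (of_nat n) r"]) auto
qed

lemma residue_ray_kernel_at:
  assumes a: "a \<notin> \<nat>" "Re a > 0"
  shows "residue (ray_kernel sg N a) a
       = - (a ^ Suc N * (exp (of_real sg * a) * stirling_quotient a)) / (2 * \<i> * sin (of_real pi * a))"
proof -
  define G where "G w = - (w ^ N * (exp (of_real sg * w) * stirling_quotient w) * a) / (2 * \<i> * sin (of_real pi * w))" for w
  define S where "S = {w. Re w > 0} \<inter> {w. sin (of_real pi * w) \<noteq> 0}"
  have "sin (of_real pi * a) \<noteq> 0"
  proof
    assume "sin (of_real pi * a) = 0"
    then obtain m :: int where m: "a = of_int m" by (rule sin_pi_eq_0E)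
    with a(2) have "m > 0" by simp
    then have "a = of_nat (nat m)" using m by simp
    with a(1) show False by auto
  qed
  with a have "a \<in> S" by (simp add: S_def)
  moreover have "open S"
    unfolding S_def by (intro open_Int open_halfspace_Re_gt open_Collect_neq continuous_intros)
  moreover have "G holomorphic_on S"
    unfolding G_def[abs_def]
    by (intro holomorphic_intros holomorphic_on_subset[OF stirling_quotient_holomorphic]) (auto simp: S_def)
  ultimately have "residue (\<lambda>w. G w / (w - a)) a = G a" by (intro residue_simple)
  moreover have "ray_kernel sg N a = (\<lambda>w. G w / (w - a))"
  proof
    fix w
    have "a / (a - w) = - a / (w - a)" using minus_divide_divide[of a "a - w"] by simp
    then show "ray_kernel sg N a w = G w / (w - a)" by (simp add: ray_kernel_def ray_fun_def G_def mult_ac)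
  qed
  ultimately show ?thesis by (simp add: G_def mult_ac)
qed

lemma set_integral_cnj:
  "(LBINT t:A. cnj (f t)) = cnj (LBINT t:A. f t)" for f :: "real \<Rightarrow> complex"
proof -
  have "(LBINT t:A. cnj (f t)) = (LBINT t. cnj (indicator A t *\<^sub>R f t))"
    by (simp add: set_lebesgue_integral_def)
  also have "\<dots> = cnj (LBINT t. indicator A t *\<^sub>R f t)" by (rule Bochner_Integration.integral_cnj)
  finally show ?thesis by (simp add: set_lebesgue_integral_def)
qed

lemma closed_segment_ray:
  fixes z d s :: complex
  assumes "T > 0" "s \<in> closed_segment z (z + of_real T * d)"
  obtains t where "0 \<le> t" "t \<le> T" "s = z + of_real t * d"
proof -
  from assms(2) obtain u where u: "0 \<le> u" "u \<le> 1" "s = (1 - u) *\<^sub>R z + u *\<^sub>R (z + of_real T * d)"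
    by (auto simp: in_segment)
  show thesis
  proof (rule that[of "u * T"])
    show "u * T \<le> T" using u assms(1) by (simp add: mult_left_le_one_le)
    show "s = z + of_real (u * T) * d" unfolding u(3) by (simp add: scaleR_conv_of_real algebra_simps mult.left_commute)
  qed (use u assms in auto)
qed

text \<open>
  The kernel has a branch point at \<open>0\<close>, so the residue theorem is applied to triangles whose left
  vertex \<open>\<epsilon> K\<close> tends to \<open>0\<close> while the opposite side, at real part \<open>K + 1/2\<close>, moves to infinity.
\<close>

lemma kernel_residue_sum:
  assumes sg: "sg < 0" and N: "N > 0" and a: "Re a > 0" "\<bar>Im a\<bar> < pi / (- sg) * Re a" "a \<notin> \<nat>"
  shows "(\<lambda>K. \<Sum>n=1..K. (-1) ^ n * ray_fun sg N a (of_nat n)) \<longlonglongrightarrow>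
      ray_integral sg N a + cnj (ray_integral sg N (cnj a))
        + of_real pi * (a ^ Suc N * (exp (of_real sg * a) * stirling_quotient a)) / sin (of_real pi * a)"
proof -
  interpret L: lower_sector sg N a by unfold_locales (use assms in auto)
  interpret U: lower_sector sg N "cnj a" by unfold_locales (use assms in auto)
  define mu where "mu = pi / (- sg)"
  define dir where "dir = Complex 1 (- mu)"
  have Lmu: "L.mu = mu" "U.mu = mu" "L.dir = dir" "U.dir = dir"
    by (simp_all add: L.mu_def U.mu_def mu_def L.dir_def U.dir_def dir_def)
  have mu: "mu > 0" using L.mu_pos Lmu by simp
  \<comment> \<open>Small enough for both sides of the wedge: the bounds with \<open>side\<close>
    use the room left by \<open>norm_quotient_le\<close>, and 1/4 is what the estimate of the sine
    allows.\<close>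
  define e0 where "e0 = min (1 / 4) (min (L.side / (2 * mu)) (U.side / (2 * mu)))"
  have e0: "0 < e0" "e0 \<le> 1 / 4" "e0 * mu \<le> L.side / 2" "e0 * mu \<le> U.side / 2"
  proof -
    show "0 < e0" using mu L.side_pos U.side_pos by (simp add: e0_def)
    have "e0 \<le> L.side / (2 * mu)" "e0 \<le> U.side / (2 * mu)" by (simp_all add: e0_def)
    then show "e0 * mu \<le> L.side / 2" "e0 * mu \<le> U.side / 2" using mu by (simp_all add: field_simps)
  qed (simp add: e0_def)
  define \<epsilon> where "\<epsilon> K = e0 / (real K + 1)" for K :: nat
  \<comment> \<open>Half-integers, because on Re s = X K the modulus of sin (pi s) is cosh (pi Im s)
    \<ge> 1.\<close>
  define X where "X K = real K + 1 / 2" for K :: nat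
  define T where "T K = X K - \<epsilon> K" for K :: nat
  have eps: "0 < \<epsilon> K" "\<epsilon> K \<le> 1 / 4" "\<epsilon> K * mu \<le> L.side / 2" "\<epsilon> K * mu \<le> U.side / 2" for K
  proof -
    show pos: "0 < \<epsilon> K" using e0 by (simp add: \<epsilon>_def)
    have le: "\<epsilon> K \<le> e0" unfolding \<epsilon>_def using e0 by (simp add: divide_le_eq)
    then show "\<epsilon> K \<le> 1 / 4" using e0 by simp
    have "\<epsilon> K * mu \<le> e0 * mu" using le mu by simp
    then show "\<epsilon> K * mu \<le> L.side / 2" "\<epsilon> K * mu \<le> U.side / 2" using e0 by linarith+
  qed
  have eps0: "\<epsilon> \<longlonglongrightarrow> 0" unfolding \<epsilon>_def by real_asymp
  have Tpos: "T K > 0" and XT: "X K = \<epsilon> K + T K" for K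
    using eps(2)[of K] by (simp_all add: T_def X_def)
  have Ttop: "filterlim T at_top sequentially"
    unfolding T_def X_def \<epsilon>_def by real_asymp
  define g where "g = ray_kernel sg N a"
  define b c where "b K = of_real (\<epsilon> K) + of_real (T K) * dir"
    and "c K = of_real (\<epsilon> K) + of_real (T K) * cnj dir" for K
  define S where "S K = {s. Re s > 0} \<inter> {s. Re s < real K + 1}" for K :: nat
  define pts where "pts K = insert a (of_nat ` {1..K})" for K :: nat
  have oS: "open (S K)" "convex (S K)" for K
    unfolding S_def by (intro open_Int open_halfspace_Re_gt open_halfspace_Re_lt convex_Int convex_halfspace_Re_gt convex_halfspace_Re_lt)+
  have ghol: "g holomorphic_on S K - pts K" for K
    unfolding g_def ray_kernel_def[abs_def]
  proof (intro holomorphic_intros holomorphic_on_subset[OF ray_fun_holomorphic])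
    show "S K - pts K \<subseteq> {s. 0 < Re s} - {a}" by (auto simp: S_def pts_def)
    fix s assume s: "s \<in> S K - pts K"
    have "sin (of_real pi * s) \<noteq> 0"
    proof
      assume "sin (of_real pi * s) = 0"
      then obtain m :: int where m: "s = of_int m" by (rule sin_pi_eq_0E)
      have "0 < m" "m < int K + 1" using s by (auto simp: S_def m)
      then have "s = of_nat (nat m)" "nat m \<in> {1..K}" by (auto simp: m)
      then show False using s by (auto simp: pts_def)
    qed
    then show "2 * \<i> * sin (of_real pi * s) \<noteq> 0" by simp
  qed
  have not_nat: "s \<notin> of_nat ` {1..K}" if "Im s = 0 \<Longrightarrow> Re s < 1" for s and K :: nat
    using that by auto
  have low: "s \<in> S K - pts K" if ss: "s \<in> closed_segment (of_real (\<epsilon> K)) (b K)" for s K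
  proof -
    obtain t where t: "0 \<le> t" "t \<le> T K" "s = of_real (\<epsilon> K) + of_real t * dir"
      using closed_segment_ray[OF Tpos ss[unfolded b_def]] by blast
    have s: "Re s = \<epsilon> K + t" "Im s = - (mu * t)" by (simp_all add: t dir_def)
    have "a \<noteq> s"
      by (rule L.norm_quotient_le(2)) (use eps(3)[of K] in \<open>simp add: Lmu s algebra_simps\<close>)
    moreover have "s \<in> S K" using eps(1)[of K] t(1,2) XT[of K] by (simp add: S_def s X_def)
    moreover have "s \<notin> of_nat ` {1..K}"
      by (rule not_nat) (use mu eps(2)[of K] in \<open>simp add: s\<close>)
    ultimately show ?thesis by (simp add: pts_def)
  qed
  have up: "s \<in> S K - pts K" if ss: "s \<in> closed_segment (of_real (\<epsilon> K)) (c K)" for s K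
  proof -
    obtain t where t: "0 \<le> t" "t \<le> T K" "s = of_real (\<epsilon> K) + of_real t * cnj dir"
      using closed_segment_ray[OF Tpos ss[unfolded c_def]] by blast
    have s: "Re s = \<epsilon> K + t" "Im s = mu * t" by (simp_all add: t dir_def)
    have "cnj a \<noteq> cnj s"
      by (rule U.norm_quotient_le(2)) (use eps(4)[of K] in \<open>simp add: Lmu s algebra_simps\<close>)
    then have "a \<noteq> s" by auto
    moreover have "s \<in> S K" using eps(1)[of K] t(1,2) XT[of K] by (simp add: S_def s X_def)
    moreover have "s \<notin> of_nat ` {1..K}"
      by (rule not_nat) (use mu eps(2)[of K] in \<open>simp add: s\<close>)
    ultimately show ?thesis by (simp add: pts_def)
  qed
  have vert: "Re s = X K" "\<bar>Im s\<bar> \<le> mu * T K" if s: "s \<in> closed_segment (b K) (c K)" for s K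
  proof -
    from s obtain u where u: "0 \<le> u" "u \<le> 1" "s = (1 - u) *\<^sub>R b K + u *\<^sub>R c K"
      by (auto simp: in_segment)
    show "Re s = X K" unfolding u(3) XT by (simp add: b_def c_def dir_def algebra_simps)
    have "Im s = (2 * u - 1) * (mu * T K)" unfolding u(3) by (simp add: b_def c_def dir_def algebra_simps)
    then have "\<bar>Im s\<bar> = \<bar>2 * u - 1\<bar> * (mu * T K)" using mu Tpos[of K] by (simp add: abs_mult)
    also have "\<dots> \<le> 1 * (mu * T K)" using u mu Tpos[of K] by (intro mult_right_mono) auto
    finally show "\<bar>Im s\<bar> \<le> mu * T K" by simp
  qed
  have vertS: "s \<in> S K - pts K" if s: "s \<in> closed_segment (b K) (c K)" and K: "real K > Re a + 1" for s K
  proof -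
    have "s \<notin> of_nat ` {1..K}"
    proof
      assume "s \<in> of_nat ` {1..K}"
      then obtain n :: nat where "s = of_nat n" by blast
      then have "real (2 * n) = real (2 * K + 1)" using vert(1)[OF s] by (simp add: X_def)
      then show False unfolding of_nat_eq_iff by presburger
    qed
    then show ?thesis using vert(1)[OF s] K by (auto simp: S_def pts_def X_def)
  qed
  define \<gamma> where "\<gamma> K = linepath (of_real (\<epsilon> K)) (b K) +++ linepath (b K) (c K) +++ linepath (c K) (of_real (\<epsilon> K))" for K
  have path: "path_image (\<gamma> K) \<subseteq> S K - pts K" if K: "real K > Re a + 1" for K
    using low[of _ K] up[of _ K] vertS[OF _ K]
    by (auto simp: \<gamma>_def path_image_join closed_segment_commute[of "c K"])
  have wind: "winding_number (\<gamma> K) z = 1" if K: "real K > Re a + 1" and z: "z \<in> pts K" for K z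
  proof -
    \<comment> \<open>The open triangle; being an open subset of the hull it lies in the interior,
      where the winding number of a triangle is known.\<close>
    define V where "V = {z. \<epsilon> K < Re z} \<inter> {z. Re z < X K} \<inter> {z. \<bar>Im z\<bar> < mu * (Re z - \<epsilon> K)}"
    have "open V" unfolding V_def by (intro open_Int open_Collect_less continuous_intros)
    moreover have "V \<subseteq> convex hull {of_real (\<epsilon> K), b K, c K}"
    proof
      fix z assume z: "z \<in> V"
      define \<tau> where "\<tau> = Re z - \<epsilon> K"
      define y where "y = Im z / mu"
      have ty: "0 < \<tau>" "\<tau> < T K" "\<bar>y\<bar> < \<tau>"
        using z mu XT[of K] by (auto simp: V_def \<tau>_def y_def abs_divide divide_less_eq mult.commute)
      \<comment> \<open>The barycentric weights of \<open>b K\<close> and, below, of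
        \<open>c K\<close>.\<close>
      define v where "v = (\<tau> - y) / (2 * T K)"
      define w where "w = (\<tau> + y) / (2 * T K)"
      have vw: "v \<ge> 0" "w \<ge> 0" "v + w \<le> 1" and vwT: "v * T K + w * T K = \<tau>" "w * T K - v * T K = y"
        using ty Tpos[of K] by (auto simp: v_def w_def field_simps)
      have "z = (1 - v - w) *\<^sub>R of_real (\<epsilon> K) + v *\<^sub>R b K + w *\<^sub>R c K"
      proof (rule complex_eqI)
        show "Re z = Re ((1 - v - w) *\<^sub>R of_real (\<epsilon> K) + v *\<^sub>R b K + w *\<^sub>R c K)"
          using vwT(1) by (simp add: b_def c_def dir_def \<tau>_def algebra_simps)
        have "Im z = mu * y" using mu by (simp add: y_def)
        then show "Im z = Im ((1 - v - w) *\<^sub>R of_real (\<epsilon> K) + v *\<^sub>R b K + w *\<^sub>R c K)"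
          unfolding vwT(2)[symmetric] by (simp add: b_def c_def dir_def algebra_simps)
      qed
      moreover have "0 \<le> 1 - v - w" "(1 - v - w) + v + w = 1" using vw by auto
      ultimately show "z \<in> convex hull {of_real (\<epsilon> K), b K, c K}"
        unfolding convex_hull_3 using vw by blast
    qed
    ultimately have "V \<subseteq> interior (convex hull {of_real (\<epsilon> K), b K, c K})" by (simp add: interior_maximal)
    moreover have zV: "z \<in> V"
    proof (cases "z = a")
      case True
      have s: "L.side = Im a + mu * Re a" "U.side = - Im a + mu * Re a"
        by (simp_all add: L.side_def U.side_def Lmu)
      have "Im a < mu * Re a - \<epsilon> K * mu" "- Im a < mu * Re a - \<epsilon> K * mu"
      proof -
        have "x < y - e \<and> - x < y - e"
          if "e \<le> (x + y) / 2" "e \<le> (- x + y) / 2" "0 < x + y" "0 < - x + y" for x y e :: real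
          using that by (simp add: field_simps)
        from this[OF eps(3,4)[of K, unfolded s] L.side_pos[unfolded s] U.side_pos[unfolded s]]
        show "Im a < mu * Re a - \<epsilon> K * mu" "- Im a < mu * Re a - \<epsilon> K * mu" by blast+
      qed
      then have "\<bar>Im a\<bar> < mu * (Re a - \<epsilon> K)"
        unfolding right_diff_distrib mult.commute[of mu "\<epsilon> K"] abs_less_iff by simp
      moreover from this have "0 < Re a - \<epsilon> K" using mu
        by (metis abs_ge_zero order_le_less_trans zero_less_mult_pos)
      moreover have "Re a < X K" using K by (simp add: X_def)
      ultimately show ?thesis unfolding True V_def by simp
    next
      case False
      then obtain n where "n \<in> {1..K}" "z = of_nat n" using z by (auto simp: pts_def)
      then show ?thesis using eps(2)[of K] mu by (auto simp: V_def X_def)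
    qed
    ultimately have int: "z \<in> interior (convex hull {of_real (\<epsilon> K), b K, c K})" by blast
    \<comment> \<open>The counterclockwise orientation, which selects winding number 1.\<close>
    have "0 < Im ((b K - of_real (\<epsilon> K)) * cnj (b K - z))"
    proof -
      have "Im ((b K - of_real (\<epsilon> K)) * cnj (b K - z)) = T K * (mu * (Re z - \<epsilon> K) + Im z)"
        by (simp add: b_def dir_def algebra_simps)
      moreover have "mu * (Re z - \<epsilon> K) + Im z > 0" using zV by (auto simp: V_def)
      ultimately show ?thesis using Tpos[of K] by simp
    qed
    then show ?thesis unfolding \<gamma>_def winding_number_triangle[OF int] by simp
  qed
  define Ra where "Ra = - (a ^ Suc N * (exp (of_real sg * a) * stirling_quotient a)) / (2 * \<i> * sin (of_real pi * a))"
  have res: "contour_integral (\<gamma> K) g = (\<Sum>n=1..K. (-1) ^ n * ray_fun sg N a (of_nat n)) + 2 * pi * \<i> * Ra"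
    if K: "real K > Re a + 1" for K
  proof -
    have "contour_integral (\<gamma> K) g = 2 * pi * \<i> * (\<Sum>p\<in>pts K. winding_number (\<gamma> K) p * residue g p)"
    proof (rule Residue_theorem[OF oS(1) convex_connected[OF oS(2)] _ ghol _ _ path[OF K]])
      show "\<forall>z. z \<notin> S K \<longrightarrow> winding_number (\<gamma> K) z = 0"
        using path[OF K]
        by (auto intro!: winding_number_zero_outside[OF _ oS(2)] simp: \<gamma>_def valid_path_imp_path)
    qed (auto simp: pts_def \<gamma>_def)
    also have "(\<Sum>p\<in>pts K. winding_number (\<gamma> K) p * residue g p) = (\<Sum>p\<in>pts K. residue g p)"
      using wind[OF K] by (intro sum.cong) auto
    also have "\<dots> = residue g a + (\<Sum>p\<in>of_nat ` {1..K}. residue g p)"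
      unfolding pts_def using a(3) by (subst sum.insert) auto
    also have "(\<Sum>p\<in>of_nat ` {1..K}. residue g p) = (\<Sum>n=1..K. residue g (of_nat n))"
      by (subst sum.reindex) (auto simp: inj_on_def)
    also have "\<dots> = (\<Sum>n=1..K. (-1) ^ n * ray_fun sg N a (of_nat n) / (2 * pi * \<i>))"
      unfolding g_def using a(3) by (intro sum.cong residue_ray_kernel_nat) auto
    also have "residue g a = Ra" unfolding g_def Ra_def by (rule residue_ray_kernel_at[OF a(3,1)])
    finally show ?thesis by (simp add: distrib_left sum_distrib_left)
  qed
  have gcont: "continuous_on A g" if "A \<subseteq> S K - pts K" for A K
    by (rule continuous_on_subset[OF holomorphic_on_imp_continuous_on[OF ghol] that])
  let ?G2 = "\<lambda>K t. ray_kernel sg N (cnj a) (of_real (\<epsilon> K) + of_real t * dir) * dir"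
  define I1 where "I1 K = (LBINT t:{0..T K}. ray_kernel sg N a (of_real (\<epsilon> K) + of_real t * dir) * dir)" for K
  define I2 where "I2 K = (LBINT t:{0..T K}. ray_kernel sg N (cnj a) (of_real (\<epsilon> K) + of_real t * dir) * dir)" for K
  define Vi where "Vi K = contour_integral (linepath (b K) (c K)) g" for K
  \<comment> \<open>The side through \<open>c K\<close> is traversed towards its left end. This sign
    and the one in \<open>ray_kernel_cnj\<close> cancel, so that the conjugate enters with a
    plus.\<close>
  have split: "contour_integral (\<gamma> K) g = I1 K + Vi K + cnj (I2 K)" if K: "real K > Re a + 1" for K
  proof -
    have c1: "continuous_on (closed_segment (of_real (\<epsilon> K)) (b K)) g"
      by (rule gcont[of _ K]) (use low in blast)
    have c2: "continuous_on (closed_segment (b K) (c K)) g"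
      by (rule gcont[of _ K]) (use vertS[OF _ K] in blast)
    have c3: "continuous_on (closed_segment (of_real (\<epsilon> K)) (c K)) g"
      by (rule gcont[of _ K]) (use up in blast)
    have i1: "contour_integral (linepath (of_real (\<epsilon> K)) (b K)) g = I1 K"
      unfolding b_def I1_def g_def
      by (rule contour_integral_linepath_ray[OF Tpos c1[unfolded b_def g_def]])
    have "contour_integral (linepath (of_real (\<epsilon> K)) (c K)) g
        = (LBINT t:{0..T K}. g (of_real (\<epsilon> K) + of_real t * cnj dir) * cnj dir)"
      unfolding c_def by (rule contour_integral_linepath_ray[OF Tpos c3[unfolded c_def]])
    also have "\<dots> = (LBINT t:{0..T K}. cnj (- ?G2 K t))"
    proof (rule set_lebesgue_integral_cong)
      show "\<forall>t. t \<in> {0..T K} \<longrightarrow> g (of_real (\<epsilon> K) + of_real t * cnj dir) * cnj dir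
         = cnj (- ?G2 K t)"
      proof (intro allI impI)
        fix t assume "t \<in> {0..T K}"
        then have "Re (of_real (\<epsilon> K) + of_real t * dir) > 0" using eps(1)[of K] by (simp add: dir_def)
        from ray_kernel_cnj[OF this, of sg N "cnj a"]
        show "g (of_real (\<epsilon> K) + of_real t * cnj dir) * cnj dir
         = cnj (- ?G2 K t)"
          by (simp add: g_def)
      qed
    qed simp
    also have "\<dots> = cnj (LBINT t:{0..T K}. - ?G2 K t)"
      by (rule set_integral_cnj)
    also have "\<dots> = - cnj (I2 K)"
      unfolding I2_def set_lebesgue_integral_def scaleR_minus_right
      by (simp only: Bochner_Integration.integral_minus complex_cnj_minus)
    finally have i3: "contour_integral (linepath (of_real (\<epsilon> K)) (c K)) g = - cnj (I2 K)" .
    have ci3: "g contour_integrable_on linepath (c K) (of_real (\<epsilon> K))"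
      by (rule contour_integrable_continuous_linepath) (use c3 in \<open>simp add: closed_segment_commute\<close>)
    have "contour_integral (linepath (c K) (of_real (\<epsilon> K))) g = cnj (I2 K)"
      using contour_integral_reverse_linepath[OF c3] i3 by simp
    then show ?thesis
      unfolding \<gamma>_def Vi_def using i1 contour_integrable_continuous_linepath[OF c1]
        contour_integrable_continuous_linepath[OF c2] ci3
      by (simp add: contour_integrable_joinI)
  qed
  have limI1: "I1 \<longlonglongrightarrow> ray_integral sg N a"
    using L.kernel_segment_tendsto[OF eps0 eps(1,2) _ Ttop] eps(3)
    by (simp add: Lmu I1_def[abs_def] ray_integral_def dir_def mu_def)
  have limI2: "I2 \<longlonglongrightarrow> ray_integral sg N (cnj a)"
    using U.kernel_segment_tendsto[OF eps0 eps(1,2) _ Ttop] eps(4)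
    by (simp add: Lmu I2_def[abs_def] ray_integral_def dir_def mu_def)
  have limV: "Vi \<longlonglongrightarrow> 0"
  proof (rule Lim_null_comparison)
    define B where "B = (1 + mu) ^ N * norm a * (2 * mu)"
    show "eventually (\<lambda>K. norm (Vi K) \<le> B * (X K ^ Suc N * exp (- (- sg) * X K))) sequentially"
      using filterlim_at_top_dense[THEN iffD1, OF filterlim_real_sequentially, rule_format, of "Re a + 1"]
    proof eventually_elim
      case (elim K)
      have XK: "X K > 0" by (simp add: X_def)
      have TX: "T K \<le> X K" using eps(1)[of K] by (simp add: T_def)
      have "norm (Vi K) \<le> ((1 + mu) ^ N * norm a * (X K ^ N * exp (sg * X K))) * norm (c K - b K)"
      proof (rule has_contour_integral_bound_linepath)
        have "continuous_on (closed_segment (b K) (c K)) g"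
          by (rule gcont[of _ K]) (use vertS elim in blast)
        then show "(g has_contour_integral Vi K) (linepath (b K) (c K))"
          unfolding Vi_def by (intro has_contour_integral_integral contour_integrable_continuous_linepath)
        fix s assume s: "s \<in> closed_segment (b K) (c K)"
        note v = vert[OF s]
        have "norm (sin (of_real pi * s)) \<ge> \<bar>Re (sin (of_real pi * s))\<bar>" by (rule abs_Re_le_cmod)
        moreover have "\<bar>Re (sin (of_real pi * s))\<bar> \<ge> 1"
        proof -
          have "sin (pi * X K) = cos (pi * real K)"
            unfolding X_def by (simp add: distrib_left sin_add)
          then have "\<bar>sin (pi * X K)\<bar> = 1" using cos_npi[of K] by (simp add: mult.commute)
          moreover have "Re (sin (of_real pi * s)) = sin (pi * X K) * cosh (pi * Im s)"
            by (simp add: Re_sin v cosh_def)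
          ultimately show ?thesis using cosh_real_ge_1[of "pi * Im s"] by (simp add: abs_mult)
        qed
        ultimately have sin: "norm (sin (of_real pi * s)) \<ge> 1" by linarith
        have Res: "Re s > 0" using v XK by simp
        \<comment> \<open>The vertical side has passed a by more than 1, since K > Re a + 1.\<close>
        have as: "norm (a - s) \<ge> 1"
          using abs_Re_le_cmod[of "a - s"] v(1) elim by (simp add: X_def)
        have ns: "norm s \<le> (1 + mu) * X K"
        proof -
          have "norm s \<le> X K + mu * T K" using cmod_le[of s] v XK by linarith
          also have "\<dots> \<le> X K + mu * X K" using TX mu by simp
          finally show ?thesis by (simp add: algebra_simps)
        qed
        have "norm (g s) = norm (ray_fun sg N a s) / (2 * norm (sin (of_real pi * s)))"
          by (simp add: g_def ray_kernel_def norm_divide norm_mult)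
        also have "\<dots> \<le> norm (ray_fun sg N a s) / 1"
          using sin by (intro divide_left_mono) auto
        also have "\<dots> \<le> norm s ^ N * exp (sg * Re s) * (norm a / norm (a - s))"
          using norm_ray_fun_le[OF Res] by simp
        also have "\<dots> \<le> ((1 + mu) * X K) ^ N * exp (sg * X K) * (norm a / 1)"
          using as ns v(1) mu XK by (intro mult_mono power_mono divide_left_mono) auto
        finally show "norm (g s) \<le> (1 + mu) ^ N * norm a * (X K ^ N * exp (sg * X K))"
          by (simp add: power_mult_distrib mult_ac)
      qed (use mu XK in auto)
      also have "norm (c K - b K) = 2 * mu * T K"
      proof -
        have "c K - b K = of_real (2 * mu * T K) * \<i>"
          by (simp add: b_def c_def dir_def complex_eq_iff)
        then show ?thesis using mu Tpos[of K] by (simp add: norm_mult)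
      qed
      also have "((1 + mu) ^ N * norm a * (X K ^ N * exp (sg * X K))) * (2 * mu * T K)
          \<le> ((1 + mu) ^ N * norm a * (X K ^ N * exp (sg * X K))) * (2 * mu * X K)"
        using TX mu XK by (intro mult_left_mono) auto
      also have "\<dots> = B * (X K ^ Suc N * exp (- (- sg) * X K))" by (simp add: B_def mult_ac)
      finally show ?case .
    qed
    have "filterlim X at_top sequentially" unfolding X_def by real_asymp
    from filterlim_compose[OF tendsto_power_mult_exp[of "- sg" "Suc N"] this] sg
    have "(\<lambda>K. X K ^ Suc N * exp (- (- sg) * X K)) \<longlonglongrightarrow> 0" by simp
    from tendsto_mult_left[OF this, of B]
    show "(\<lambda>K. B * (X K ^ Suc N * exp (- (- sg) * X K))) \<longlonglongrightarrow> 0" by simp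
  qed
  have "(\<lambda>K. I1 K + Vi K + cnj (I2 K) - 2 * pi * \<i> * Ra)
      \<longlonglongrightarrow> ray_integral sg N a + 0 + cnj (ray_integral sg N (cnj a)) - 2 * pi * \<i> * Ra"
    by (intro tendsto_intros limI1 limI2 limV)
  moreover have "ray_integral sg N a + 0 + cnj (ray_integral sg N (cnj a)) - 2 * pi * \<i> * Ra
     = ray_integral sg N a + cnj (ray_integral sg N (cnj a))
        + of_real pi * (a ^ Suc N * (exp (of_real sg * a) * stirling_quotient a)) / sin (of_real pi * a)"
    by (simp add: Ra_def)
  ultimately have "(\<lambda>K. I1 K + Vi K + cnj (I2 K) - 2 * pi * \<i> * Ra) \<longlonglongrightarrow>
     ray_integral sg N a + cnj (ray_integral sg N (cnj a))
        + of_real pi * (a ^ Suc N * (exp (of_real sg * a) * stirling_quotient a)) / sin (of_real pi * a)" by (simp only:)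
  then show ?thesis
  proof (rule Lim_transform_eventually)
    show "eventually (\<lambda>K. I1 K + Vi K + cnj (I2 K) - 2 * pi * \<i> * Ra
        = (\<Sum>n=1..K. (-1) ^ n * ray_fun sg N a (of_nat n))) sequentially"
      using filterlim_at_top_dense[THEN iffD1, OF filterlim_real_sequentially, rule_format, of "Re a + 1"]
    proof eventually_elim
      case (elim K)
      show ?case using res[OF elim] split[OF elim] by simp
    qed
  qed
qed

section \<open>The two series in terms of the summed kernel\<close>

lemma lambertW_exp_minus_1_bound:
  assumes "0 < lam" "lam < lambertW (exp (-1))"
  shows "lam * exp lam < exp (-1)"
proof -
  have mono: "u * exp u < v * exp v" if "0 < u" "u < v" for u v :: real
    using that by (intro mult_strict_mono) auto
  have "\<exists>w\<ge>0. w \<le> 1 \<and> w * exp w = exp (- 1 :: real)"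
    by (rule IVT') (auto intro!: continuous_intros)
  then obtain w :: real where w: "w \<ge> 0" "w * exp w = exp (-1)" by blast
  \<comment> \<open>Every solution is positive because the right side is, and x e^x is strictly
    increasing there; so the definite description in \<open>lambertW\<close> has a value.\<close>
  have pos: "v > 0" if "v * exp v = exp (-1)" for v :: real
    using that by (metis exp_gt_zero zero_less_mult_pos2)
  have "(THE w. w \<ge> -1 \<and> w * exp w = exp (- 1)) = w"
  proof (rule the_equality)
    fix v :: real assume v: "v \<ge> -1 \<and> v * exp v = exp (- 1)"
    show "v = w"
      using mono[of v w] mono[of w v] pos[of v] pos[of w] v w by (cases v w rule: linorder_cases) auto
  qed (use w in auto)
  then have "lambertW (exp (-1)) = w" by (simp add: lambertW_def)
  with assms mono[of lam w] w show ?thesis by simp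
qed

lemma critical_exponent_neg:
  fixes lam :: real
  assumes "0 < lam" "lam * exp lam < exp (-1)"
  shows "lam + ln lam + 1 < 0"
proof -
  have "exp (lam + ln lam) < exp (-1)" using assms by (simp add: exp_add mult.commute)
  then show ?thesis by simp
qed

text \<open>The ray of direction e^(i (pi - omega)) has slope pi / (- sg). For A = |Arg a| the angle
  omega + A lies strictly between 0 and pi, and expanding sin (omega + A) > 0 gives the slope
  inequality.\<close>

lemma sector_of_Arg:
  assumes sg: "sg < 0" and a: "a \<noteq> 0" and arg: "\<bar>Arg a\<bar> < pi - Arg (Complex sg pi)"
  shows "Re a > 0" "\<bar>Im a\<bar> < pi / (- sg) * Re a"
proof -
  define u where "u = Complex sg pi"
  define A where "A = \<bar>Arg a\<bar>"
  have u0: "u \<noteq> 0" using sg by (simp add: u_def complex_eq_iff)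
  have u: "cos (Arg u) = sg / norm u" "sin (Arg u) = pi / norm u"
    using cis_Arg[OF u0] by (simp_all add: complex_eq_iff sgn_div_norm u_def divide_inverse mult.commute)
  have nu: "norm u > 0" using u0 by simp
  have Arg_u: "0 < Arg u" "Arg u \<le> pi"
  proof -
    show "Arg u \<le> pi" using Arg_bounded[of u] by simp
    have "sin (Arg u) > 0" using u(2) nu by simp
    then show "0 < Arg u" using Arg_bounded[of u]
      by (metis minus_less_iff neg_less_iff_less not_less_iff_gr_or_eq order_less_asym sin_gt_zero sin_minus sin_zero neg_0_less_iff_less)
  qed
  have A: "0 \<le> A" "A < pi - Arg u" using arg by (auto simp: A_def u_def)
  have Re: "Re a = norm a * cos A" and Im: "\<bar>Im a\<bar> = norm a * sin A"
  proof -
    have "sin A \<ge> 0" using A Arg_u by (intro sin_ge_zero) auto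
    moreover have "a = of_real (norm a) * cis (Arg a)" using cis_Arg[OF a] a by (simp add: sgn_div_norm scaleR_conv_of_real)
    from arg_cong[OF this, of Re] arg_cong[OF this, of Im]
    have "Re a = norm a * cos (Arg a)" "Im a = norm a * sin (Arg a)" by simp_all
    moreover have "cos A = cos (Arg a)" "sin (Arg a) = (if Arg a \<ge> 0 then sin A else - sin A)"
      by (auto simp: A_def abs_if)
    ultimately show "Re a = norm a * cos A" "\<bar>Im a\<bar> = norm a * sin A"
      by (simp_all add: abs_mult split: if_splits)
  qed
  have "cos (pi - Arg u) < cos A" using A Arg_u by (intro cos_monotone_0_pi) auto
  moreover have "cos (pi - Arg u) > 0" using u(1) sg nu by (simp add: cos_diff divide_neg_pos)
  ultimately have "cos A > 0" by simp
  then show "Re a > 0" unfolding Re using a by simp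
  have "0 < sin (Arg u + A)" using A Arg_u by (intro sin_gt_zero) auto
  then have "0 < (pi * cos A + sg * sin A) / norm u"
    by (simp add: sin_add u add_divide_distrib)
  then have "0 < pi * cos A + sg * sin A" using nu by (simp add: zero_less_divide_iff)
  then have "sin A < pi / (- sg) * cos A" using sg by (simp add: field_simps)
  then have "norm a * sin A < norm a * (pi / (- sg) * cos A)"
    using a by (intro mult_strict_left_mono) auto
  then show "\<bar>Im a\<bar> < pi / (- sg) * Re a" unfolding Re Im by (simp add: mult_ac)
qed

text \<open>The factor s in Gamma(1 + s) = s Gamma(s) is written as s^(1/2) s^(1/2); one half enters
  the power s - 1/2 of \<open>Gamma_star\<close>.\<close>

lemma inverse_Gamma_star:
  assumes "Re s > 0"
  shows "1 / Gamma_star s = of_real (sqrt (2 * pi)) * s powr (1 / 2) * stirling_quotient s"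
proof -
  have s0: "s \<noteq> 0" using assms by auto
  have "s \<notin> \<int>\<^sub>\<le>\<^sub>0" by (rule Re_pos_not_nonpos_Ints[OF assms])
  then have G: "Gamma (1 + s) = s * Gamma s" using Gamma_plus1[of s] by (simp add: add.commute)
  have p: "s powr s * s powr (1 / 2) = s powr (s - 1 / 2) * s"
  proof -
    have "s powr s = s powr (s - 1 / 2) * s powr (1 / 2)" by (simp flip: powr_add)
    moreover have "s powr (1 / 2) * s powr (1 / 2) = s" using s0 by (simp flip: powr_add)
    ultimately show ?thesis by (simp only: mult.assoc)
  qed
  show ?thesis
    unfolding Gamma_star_def stirling_quotient_def G using s0 p by (simp add: field_simps)
qed


text \<open>The positive real part keeps the argument of \<open>Gamma_star\<close> off the cut,
  where the principal power commutes with conjugation.\<close>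

lemma integrand_minus_eq_cnj:
  assumes "t > 0" "Re (exp (\<i> * of_real (omega lam k - pi))) > 0"
  shows "integrand_minus N a lam k t = cnj (integrand_plus N (cnj a) lam k t)"
proof -
  define s where "s = of_real t * exp (\<i> * complex_of_real (omega lam k - pi))"
  have s: "Re s > 0" unfolding s_def using assms by simp
  have cnj_s: "of_real t * exp (- \<i> * complex_of_real (omega lam k - pi)) = cnj s"
    by (simp add: s_def exp_cnj)
  have "cnj (Gamma_star s) = Gamma_star (cnj s)"
    unfolding Gamma_star_def using s by (simp add: cnj_Gamma cnj_powr exp_cnj)
  moreover have "cmod (complex_of_real (lam + ln lam + 1) - complex_of_real ((2 * real k + 1) * pi) * \<i>)
     = cmod (complex_of_real (lam + ln lam + 1) + complex_of_real ((2 * real k + 1) * pi) * \<i>)"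
    unfolding cmod_def by simp
  ultimately show ?thesis
    unfolding integrand_minus_def integrand_plus_def cnj_s
    by (simp only: s_def[symmetric]) (simp add: exp_cnj)
qed

section \<open>Evaluation of the two series for a fixed lambda\<close>

locale tree_parameter =
  fixes lam :: real and N :: nat
  assumes lam_pos: "0 < lam" and lam_bound: "lam * exp lam < exp (-1)" and N_pos: "N > 0"
begin

definition sg :: real where "sg = lam + ln lam + 1"

definition crit :: "nat \<Rightarrow> complex" where "crit k = Complex sg ((2 * real k + 1) * pi)"

text \<open>This is e^(i (omega_k - pi)). It is the direction of steepest descent of exp (cnj (crit
  k) s): on the ray the exponent is - t norm (crit k), the one in the integrands.\<close>

definition ray_dir :: "nat \<Rightarrow> complex" where "ray_dir k = - crit k / norm (crit k)"

lemma sg_neg: "sg < 0"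
  unfolding sg_def by (rule critical_exponent_neg[OF lam_pos lam_bound])

lemma crit_nonzero: "crit k \<noteq> 0"
  using sg_neg by (simp add: crit_def complex_eq_iff)

lemma omega_eq_Arg_crit: "omega lam k = Arg (crit k)"
proof -
  have "complex_of_real (lam + ln lam + 1) + complex_of_real ((2 * real k + 1) * pi) * \<i> = crit k"
    by (simp add: crit_def sg_def complex_eq_iff)
  then show ?thesis by (simp add: omega_def)
qed

lemma exp_omega: "exp (\<i> * of_real (omega lam k)) = crit k / norm (crit k)"
  using cis_Arg[OF crit_nonzero[of k]]
  by (simp add: omega_eq_Arg_crit cis_conv_exp sgn_div_norm scaleR_conv_of_real divide_inverse mult.commute)

lemma exp_omega_pi: "exp (\<i> * of_real (omega lam k - pi)) = ray_dir k"
proof -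
  have "exp (\<i> * of_real (omega lam k - pi)) = exp (\<i> * of_real (omega lam k)) / exp (\<i> * of_real pi)"
    by (simp add: right_diff_distrib exp_diff)
  then show ?thesis unfolding exp_omega by (simp add: ray_dir_def mult.commute)
qed

lemma ray_dir: "Re (ray_dir k) > 0" "Im (ray_dir k) + pi / (- sg) * Re (ray_dir k) \<le> 0"
proof -
  have n: "norm (crit k) > 0" using crit_nonzero by simp
  have Re: "Re (ray_dir k) = - sg / norm (crit k)" and Im: "Im (ray_dir k) = - ((2 * real k + 1) * pi) / norm (crit k)"
    by (simp_all add: ray_dir_def crit_def)
  show "Re (ray_dir k) > 0" unfolding Re using sg_neg n by (simp add: divide_neg_pos)
  have "pi / (- sg) * Re (ray_dir k) = pi / norm (crit k)" unfolding Re using sg_neg by simp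
  then have "Im (ray_dir k) + pi / (- sg) * Re (ray_dir k) = - (2 * real k * pi) / norm (crit k)"
    unfolding Im by (simp add: add_divide_distrib[symmetric] algebra_simps)
  then show "Im (ray_dir k) + pi / (- sg) * Re (ray_dir k) \<le> 0" using n by simp
qed

lemma integrand_plus_eq:
  assumes t: "t > 0" and a: "a \<noteq> 0"
  shows "integrand_plus N a lam k t =
     of_real (sqrt (2 * pi)) * ray_dir k powr (1 / 2) / ray_dir k ^ N *
       (ray_fun sg N a (of_real t * ray_dir k) * exp (- (of_real ((2 * real k + 1) * pi) * \<i> * (of_real t * ray_dir k))))"
proof -
  define q where "q = ray_dir k"
  define s where "s = of_real t * q"
  define r where "r = norm (crit k)"
  have r: "r > 0" using crit_nonzero by (simp add: r_def)
  have q0: "q \<noteq> 0" "Re q > 0" using ray_dir(1)[of k] by (auto simp: q_def)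
  have s: "Re s > 0" using q0 t by (simp add: s_def)
  have norm_crit: "cmod (complex_of_real (lam + ln lam + 1) - complex_of_real ((2 * real k + 1) * pi) * \<i>) = r"
    unfolding r_def crit_def sg_def cmod_def by simp
  have e1: "exp (of_real sg * s) * exp (- (of_real ((2 * real k + 1) * pi) * \<i> * s)) = of_real (exp (- t * r))"
  proof -
    have "cnj (crit k) * crit k = of_real (r ^ 2)"
      unfolding r_def by (simp add: complex_norm_square[symmetric] mult.commute)
    moreover have "cnj (crit k) = of_real sg - of_real ((2 * real k + 1) * pi) * \<i>"
      by (simp add: crit_def complex_eq_iff)
    then have "of_real sg * s + - (of_real ((2 * real k + 1) * pi) * \<i> * s) = cnj (crit k) * s"
      by (simp only: left_diff_distrib) simp
    moreover have "s = - of_real (t / r) * crit k"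
      by (simp add: s_def q_def ray_dir_def r_def)
    ultimately have "of_real sg * s + - (of_real ((2 * real k + 1) * pi) * \<i> * s) = - of_real (t / r) * of_real (r ^ 2)"
      by (metis mult.left_commute)
    also have "\<dots> = of_real (- t * r)" using r by (simp add: power2_eq_square)
    finally have "of_real sg * s + - (of_real ((2 * real k + 1) * pi) * \<i> * s) = of_real (- t * r)" .
    then show ?thesis unfolding mult_exp_exp by (simp only: exp_of_real)
  qed
  have sp: "s powr (1 / 2) = of_real (sqrt t) * q powr (1 / 2)"
  proof -
    have "Ln s = of_real (ln t) + Ln q" unfolding s_def using t q0 by (simp add: Ln_times_of_real Ln_of_real)
    moreover have "exp (of_real (ln t) / 2) = complex_of_real (sqrt t)"
    proof -
      have "exp (ln t / 2) = sqrt t" using t by (simp add: ln_sqrt[symmetric])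
      then show ?thesis by (metis exp_of_real of_real_divide of_real_numeral)
    qed
    ultimately show ?thesis using s q0 by (auto simp: powr_def add_divide_distrib exp_add)
  qed
  \<comment> \<open>The half power in the integrand and the square root split off from 1 /
    \<open>Gamma_star\<close> combine to the t^N in \<open>ray_fun\<close>.\<close>
  have tp: "t powr (real N - 1 / 2) * sqrt t = t ^ N"
    using t by (simp add: powr_diff powr_half_sqrt powr_realpow)
  have den: "1 / (1 + complex_of_real t * exp (\<i> * complex_of_real (omega lam k)) / a) = a / (a - s)"
  proof -
    have "complex_of_real t * exp (\<i> * complex_of_real (omega lam k)) = - s"
      unfolding exp_omega s_def q_def ray_dir_def by simp
    then show ?thesis using a by (simp add: field_simps)
  qed
  have Gs: "1 / Gamma_star (complex_of_real t * exp (\<i> * complex_of_real (omega lam k - pi)))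
     = of_real (sqrt (2 * pi)) * (of_real (sqrt t) * q powr (1 / 2)) * stirling_quotient s"
    unfolding exp_omega_pi q_def[symmetric] s_def[symmetric] inverse_Gamma_star[OF s] sp ..
  have "integrand_plus N a lam k t
     = of_real (t powr (real N - 1 / 2) * exp (- t * r)) * (a / (a - s))
        * (of_real (sqrt (2 * pi)) * (of_real (sqrt t) * q powr (1 / 2)) * stirling_quotient s)"
    unfolding integrand_plus_def norm_crit den[symmetric] Gs[symmetric] times_divide_eq_right mult_1_right ..
  also have "\<dots> = of_real (sqrt (2 * pi)) * q powr (1 / 2) * of_real (t powr (real N - 1 / 2) * sqrt t)
        * of_real (exp (- t * r)) * (a / (a - s)) * stirling_quotient s"
    by (simp add: mult_ac)
  also have "\<dots> = of_real (sqrt (2 * pi)) * q powr (1 / 2) / q ^ N * (s ^ N * (exp (of_real sg * s) * stirling_quotient s) * (a / (a - s))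
        * exp (- (of_real ((2 * real k + 1) * pi) * \<i> * s)))"
  proof -
    have gen: "C * h * T * (E1 * E2) * A * S = C * h / Q * ((T * Q) * (E1 * S) * A * E2)"
      if "Q \<noteq> 0" for C h T E1 E2 A S Q :: complex
      using that by simp
    have "s ^ N = of_real (t ^ N) * q ^ N" by (simp add: s_def power_mult_distrib)
    moreover have "q ^ N \<noteq> 0" using q0 by simp
    ultimately show ?thesis unfolding tp e1[symmetric] by (simp only: gen)
  qed
  finally show ?thesis by (simp add: ray_fun_def s_def q_def)
qed

text \<open>With q = e^(i (w - pi)) the angle w occurs with total weight N + 1/2 + 1/2 - (N + 1) =
  0, so that the phase does not depend on k. The multiples of pi, with 1/i = e^(-i pi / 2), add up
  to N pi.\<close>

lemma phase_eq:
  "exp (of_real ((real N + 1 / 2) * omega lam k) * \<i>) / \<i> * (ray_dir k powr (1 / 2) / ray_dir k ^ Suc N) = (-1) ^ N"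
proof -
  define w where "w = omega lam k"
  have q: "ray_dir k = exp (\<i> * of_real (w - pi))" using exp_omega_pi by (simp add: w_def)
  have w: "- pi < w" "w \<le> pi" using Arg_bounded[of "crit k"] by (auto simp: w_def omega_eq_Arg_crit)
  \<comment> \<open>Needed for the principal logarithm of e^(i (w - pi)) to be i (w - pi): at w = 0
    the angle would be - pi.\<close>
  have "w > 0"
  proof (rule ccontr)
    assume "\<not> w > 0"
    then have "sin (- w) \<ge> 0" using w by (intro sin_ge_zero) auto
    moreover have "Im (exp (\<i> * of_real w)) > 0"
      unfolding w_def exp_omega using crit_nonzero[of k] by (simp add: crit_def)
    ultimately show False by (simp add: Im_exp)
  qed
  then have "Ln (ray_dir k) = \<i> * of_real (w - pi)" unfolding q using w by (intro Ln_exp) auto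
  then have half: "ray_dir k powr (1 / 2) = exp (\<i> * of_real ((w - pi) / 2))"
    using q by (simp add: powr_def)
  have pw: "ray_dir k ^ Suc N = exp (\<i> * of_real (real (Suc N) * (w - pi)))"
    unfolding q by (subst exp_of_nat_mult[symmetric]) (simp add: mult_ac)
  have ii: "\<i> = exp (\<i> * of_real (pi / 2))" by (simp add: exp_eq_polar cis_conv_exp[symmetric])
  have "exp (of_real ((real N + 1 / 2) * w) * \<i>) / exp (\<i> * of_real (pi / 2)) * (exp (\<i> * of_real ((w - pi) / 2)) / exp (\<i> * of_real (real (Suc N) * (w - pi))))
     = exp (\<i> * of_real (real N * pi))"
    unfolding exp_diff[symmetric] mult_exp_exp
    by (rule arg_cong[of _ _ exp]) (simp add: algebra_simps add_divide_distrib diff_divide_distrib)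
  also have "exp (\<i> * of_real (real N * pi)) = (-1) ^ N"
  proof -
    have "exp (\<i> * of_real (real N * pi)) = exp (of_nat N * (\<i> * of_real pi))" by (simp add: mult_ac)
    also have "\<dots> = (-1) ^ N" by (subst exp_of_nat_mult) (simp add: mult.commute)
    finally show ?thesis .
  qed
  finally show ?thesis unfolding half pw w_def[symmetric] ii[symmetric] .
qed

lemma plus_series:
  assumes a: "a \<noteq> 0" "Im a + pi / (- sg) * Re a > 0"
  shows "set_integrable lborel {0<..} (integrand_plus N a lam k)"
    and "series_term_plus N a lam sums ((-1) ^ N * ray_integral sg N a)"
proof -
  interpret L: lower_sector sg N a by unfold_locales (use sg_neg N_pos a in auto)
  define c where "c k = of_real (sqrt (2 * pi)) * ray_dir k powr (1 / 2) / ray_dir k ^ N" for k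
  have eq: "integrand_plus N a lam k t = c k * L.branch k (of_real t * ray_dir k)" if "t > 0" for k t
    using integrand_plus_eq[OF that a(1)] by (simp add: L.branch_def c_def)
  have rd: "Re (ray_dir k) > 0" "Im (ray_dir k) + L.mu * Re (ray_dir k) \<le> 0" for k
    using ray_dir[of k] by (auto simp: L.mu_def)
  note rot = L.branch_rotate[OF rd]
  show "set_integrable lborel {0<..} (integrand_plus N a lam k)"
  proof -
    have "set_integrable lborel {0<..} (\<lambda>t. c k * L.branch k (of_real t * ray_dir k))"
      by (intro set_integrable_mult_right rot)
    then show ?thesis by (subst set_integrable_cong[OF refl refl eq]) auto
  qed
  have "series_term_plus N a lam = (\<lambda>k. (-1) ^ N * (LBINT t:{0<..}. L.branch k (of_real t * L.dir) * L.dir))"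
  proof
    fix k
    have r0: "ray_dir k \<noteq> 0" using rd(1)[of k] by auto
    \<comment> \<open>The factor ray_dir k turns dt into ds; dividing by it gives the exponent Suc N
      in \<open>phase_eq\<close>.\<close>
    have "(LBINT t:{0<..}. integrand_plus N a lam k t) = (LBINT t:{0<..}. c k / ray_dir k * (L.branch k (of_real t * ray_dir k) * ray_dir k))"
      by (rule set_lebesgue_integral_cong) (use eq r0 in auto)
    also have "\<dots> = c k / ray_dir k * (LBINT t:{0<..}. L.branch k (of_real t * L.dir) * L.dir)"
      by (simp only: set_integral_mult_right rot(3))
    finally have "series_term_plus N a lam k
       = (exp (of_real ((real N + 1 / 2) * omega lam k) * \<i>) / \<i> * (ray_dir k powr (1 / 2) / ray_dir k ^ Suc N))
          * (LBINT t:{0<..}. L.branch k (of_real t * L.dir) * L.dir)"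
      unfolding series_term_plus_def c_def by (simp add: mult_ac)
    then show "series_term_plus N a lam k = (-1) ^ N * (LBINT t:{0<..}. L.branch k (of_real t * L.dir) * L.dir)"
      unfolding phase_eq .
  qed
  moreover have "(\<lambda>k. (-1) ^ N * (LBINT t:{0<..}. L.branch k (of_real t * L.dir) * L.dir)) sums ((-1) ^ N * ray_integral sg N a)"
  proof (rule sums_mult)
    have "ray_integral sg N a = (LBINT t:{0<..}. ray_kernel sg N a (of_real t * L.dir)) * L.dir"
      unfolding ray_integral_def L.dir_def[unfolded L.mu_def, symmetric] by (rule set_integral_mult_left)
    then show "(\<lambda>k. LBINT t:{0<..}. L.branch k (of_real t * L.dir) * L.dir) sums ray_integral sg N a"
      using sums_mult2[OF L.branch_sums_kernel, of L.dir] by (simp only: set_integral_mult_left)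
  qed
  ultimately show "series_term_plus N a lam sums ((-1) ^ N * ray_integral sg N a)" by (simp only:)
qed

text \<open>Conjugation exchanges the two integrands together with a and \<open>cnj a\<close>, and
  the remaining factor 1 / i accounts for the sign.\<close>

lemma minus_series:
  assumes a: "a \<noteq> 0" "- Im a + pi / (- sg) * Re a > 0"
  shows "set_integrable lborel {0<..} (integrand_minus N a lam k)"
    and "series_term_minus N a lam sums (- ((-1) ^ N * cnj (ray_integral sg N (cnj a))))"
proof -
  have a': "cnj a \<noteq> 0" "Im (cnj a) + pi / (- sg) * Re (cnj a) > 0" using a by auto
  have eq: "integrand_minus N a lam k t = cnj (integrand_plus N (cnj a) lam k t)" if "t > 0" for t k
    by (rule integrand_minus_eq_cnj[OF that]) (use ray_dir(1)[of k] in \<open>simp only: exp_omega_pi\<close>)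
  show "set_integrable lborel {0<..} (integrand_minus N a lam k)"
  proof -
    have "integrable lborel (\<lambda>t. cnj (indicator {0<..} t *\<^sub>R integrand_plus N (cnj a) lam k t))"
      using plus_series(1)[OF a', of k] unfolding set_integrable_def by (intro integrable_cnj)
    then have "set_integrable lborel {0<..} (\<lambda>t. cnj (integrand_plus N (cnj a) lam k t))"
      unfolding set_integrable_def by simp
    then show ?thesis by (subst set_integrable_cong[OF refl refl eq]) auto
  qed
  have "series_term_minus N a lam = (\<lambda>k. - cnj (series_term_plus N (cnj a) lam k))"
  proof
    fix k
    have "(LBINT t:{0<..}. integrand_minus N a lam k t) = (LBINT t:{0<..}. cnj (integrand_plus N (cnj a) lam k t))"
      by (rule set_lebesgue_integral_cong) (use eq in auto)
    then show "series_term_minus N a lam k = - cnj (series_term_plus N (cnj a) lam k)"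
      unfolding series_term_minus_def series_term_plus_def set_integral_cnj by (simp add: exp_cnj)
  qed
  moreover have "(\<lambda>k. - cnj (series_term_plus N (cnj a) lam k)) sums (- cnj ((-1) ^ N * ray_integral sg N (cnj a)))"
    using plus_series(2)[OF a'] by (intro sums_minus) (simp only: sums_cnj)
  ultimately show "series_term_minus N a lam sums (- ((-1) ^ N * cnj (ray_integral sg N (cnj a))))" by simp
qed

end

section \<open>The remainder\<close>

lemma inverse_diff_geometric:
  fixes a w :: complex
  assumes "a \<noteq> 0" "a \<noteq> w"
  shows "1 / (a - w) - (\<Sum>n<N. w ^ n / a ^ Suc n) = w ^ N / (a ^ N * (a - w))"
proof (induction N)
  case (Suc N)
  have "1 / (a - w) - (\<Sum>n<Suc N. w ^ n / a ^ Suc n) = w ^ N / (a ^ N * (a - w)) - w ^ N / a ^ Suc N"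
    using Suc by (simp add: diff_diff_eq[symmetric])
  also have "\<dots> = w ^ Suc N / (a ^ Suc N * (a - w))" using assms by (simp add: field_simps)
  finally show ?case .
qed simp

section \<open>Continuity in a along the positive real axis\<close>

lemma tendsto_incGamma_scaled:
  fixes lam :: real and \<alpha> :: "nat \<Rightarrow> real"
  assumes lam: "lam > 0" and b: "b > 0" and \<alpha>: "\<alpha> \<longlonglongrightarrow> b" "\<And>j. b \<le> \<alpha> j" "\<And>j. \<alpha> j \<le> b + 1"
  shows "(\<lambda>j. incGamma (- of_real (\<alpha> j)) (of_real (lam * \<alpha> j))) \<longlonglongrightarrow> incGamma (- of_real b) (of_real (lam * b))"
proof -
  \<comment> \<open>All paths start at or to the right of lam b, so that m bounds their distance to
    0 from below.\<close>
  define m where "m = min 1 (lam * b)"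
  have m: "0 < m" "m \<le> 1" using lam b by (auto simp: m_def)
  obtain K where K: "K > 0" "\<And>s w. norm s \<le> b + 2 \<Longrightarrow> m \<le> norm w \<Longrightarrow> norm (w powr s :: complex) \<le> K * exp (norm w / 2)"
    using norm_powr_le_exp_half[OF m] by metis
  define f where "f c u = (complex_of_real (lam * c) + complex_of_real u) powr (- complex_of_real c - 1)
      * exp (- (complex_of_real (lam * c) + complex_of_real u))" for c u :: real
  have bound: "norm (f c u) \<le> K * (u ^ 0 * exp (- (1 / 2) * u))" if c: "b \<le> c" "c \<le> b + 1" and u: "u > 0" for c u
  proof -
    define v where "v = lam * c + u"
    have "lam * b \<le> lam * c" using lam c by simp
    moreover have "0 < lam * b" "m \<le> lam * b" using lam b by (simp_all add: m_def)
    ultimately have v: "v \<ge> m" "v \<ge> u" "v > 0" using u unfolding v_def by linarith+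
    have fe: "f c u = complex_of_real v powr (- complex_of_real c - 1) * exp (- complex_of_real v)"
      by (simp add: f_def v_def)
    have "norm (- complex_of_real c - 1) = c + 1"
    proof -
      have "- complex_of_real c - 1 = complex_of_real (- c - 1)" by simp
      moreover have "\<bar>- c - 1\<bar> = c + 1" using b c by simp
      ultimately show ?thesis by (simp only: norm_of_real)
    qed
    then have "norm (complex_of_real v powr (- complex_of_real c - 1)) \<le> K * exp (v / 2)"
      using K(2)[of "- complex_of_real c - 1" "complex_of_real v"] c v by simp
    then have "norm (f c u) \<le> K * exp (v / 2) * exp (- v)"
      unfolding fe norm_mult by (intro mult_mono) (use K in auto)
    also have "\<dots> = K * exp (- (v / 2))" unfolding mult.assoc mult_exp_exp by simp
    also have "\<dots> \<le> K * exp (- (u / 2))" using v K by simp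
    finally show ?thesis by simp
  qed
  have meas: "set_borel_measurable lborel {0<..} (f c)" if "c \<ge> b" for c
  proof -
    have "lam * c > 0" using lam b that by simp
    then have "complex_of_real (lam * c) \<notin> \<real>\<^sub>\<le>\<^sub>0"
      unfolding nonpos_Reals_of_real_iff by simp
    from set_integrable_incGamma[OF this, of "- complex_of_real c"]
    show ?thesis unfolding set_integrable_def set_borel_measurable_def f_def by (rule borel_measurable_integrable)
  qed
  have "(\<lambda>j. LBINT u:{0<..}. f (\<alpha> j) u) \<longlonglongrightarrow> (LBINT u:{0<..}. f b u)"
  proof (rule set_integral_tendsto_dominated)
    show "set_borel_measurable lborel {0<..} (f (\<alpha> j))" "set_borel_measurable lborel {0<..} (f b)" for j
      by (rule meas, use \<alpha>(2) in simp)+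
    show "set_integrable lborel {0<..} (\<lambda>u. K * (u ^ 0 * exp (- (1 / 2) * u)))"
      by (intro set_integrable_mult_right set_integrable_power_times_exp) simp
    fix u :: real assume u: "u > 0"
    then show "norm (f (\<alpha> j) u) \<le> K * (u ^ 0 * exp (- (1 / 2) * u))" for j
      by (intro bound \<alpha>)
    have "lam * b > 0" using lam b by simp
    then have "complex_of_real (lam * b) + complex_of_real u \<notin> \<real>\<^sub>\<le>\<^sub>0"
      unfolding of_real_add[symmetric] nonpos_Reals_of_real_iff using u by simp
    then show "(\<lambda>j. f (\<alpha> j) u) \<longlonglongrightarrow> f b u"
      unfolding f_def by (intro tendsto_intros \<alpha>(1)) auto
  qed
  then show ?thesis by (simp only: incGamma_def f_def)
qed

text \<open>The parameter enters the kernel only through a / (a - s). The kernels at c and b differ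
  by the factor c (b - s) / (b (c - s)), which is bounded uniformly for b \<le> c \<le> b + 1, so
  that a multiple of the limit kernel is the majorant.\<close>

lemma tendsto_ray_integral:
  fixes \<alpha> :: "nat \<Rightarrow> real"
  assumes sg: "sg < 0" and N: "N > 0" and b: "b > 0"
    and \<alpha>: "\<alpha> \<longlonglongrightarrow> b" "\<And>j. b \<le> \<alpha> j" "\<And>j. \<alpha> j \<le> b + 1"
  shows "(\<lambda>j. ray_integral sg N (of_real (\<alpha> j))) \<longlonglongrightarrow> ray_integral sg N (of_real b)"
proof -
  have loc: "lower_sector sg N (of_real c)" if "c > 0" for c
    by unfold_locales (use sg N that in \<open>auto simp: divide_neg_neg divide_pos_neg mult_pos_pos\<close>)
  interpret B: lower_sector sg N "of_real b" by (rule loc[OF b])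
  define mu where "mu = pi / (- sg)"
  have mu: "mu > 0" using B.mu_pos by (simp add: B.mu_def mu_def)
  \<comment> \<open>The value of \<open>dist_const\<close> for a positive real parameter; it does
    not depend on the parameter because \<open>side\<close> scales with it.\<close>
  define D where "D = 2 * (1 + mu) / mu"
  have D: "D > 0" using mu by (simp add: D_def)
  define dir where "dir = Complex 1 (- mu)"
  have dist: "c / norm (of_real c - of_real t * dir) \<le> D" "of_real c \<noteq> of_real t * dir" if c: "c > 0" and t: "t > 0" for c t :: real
  proof -
    interpret C: lower_sector sg N "of_real c" by (rule loc[OF c])
    have "Im (of_real t * dir) + C.mu * Re (of_real t * dir) \<le> C.side / 2"
      using C.side_pos by (simp add: dir_def C.mu_def mu_def)
    note nq = C.norm_quotient_le[OF this]
    have Cmu: "C.mu = mu" by (simp only: C.mu_def mu_def)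
    have Cside: "C.side = mu * c" by (simp add: C.side_def Cmu)
    have "C.dist_const = D" unfolding C.dist_const_def Cside Cmu D_def using c mu by (simp add: field_simps)
    with nq show "c / norm (of_real c - of_real t * dir) \<le> D" "of_real c \<noteq> of_real t * dir"
      using c by simp_all
  qed
  define g where "g c t = ray_kernel sg N (of_real c) (of_real t * dir) * dir" for c t :: real
  have gint: "set_integrable lborel {0<..} (g c)" if "c > 0" for c
  proof -
    interpret C: lower_sector sg N "of_real c" by (rule loc[OF that])
    show ?thesis
      using set_integrable_mult_left[OF C.kernel_integrable, of dir] unfolding g_def[abs_def]
      by (simp add: C.dir_def C.mu_def dir_def mu_def)
  qed
  have pos: "\<alpha> j > 0" for j using \<alpha>(2)[of j] b by simp
  define M where "M = (b + 1 + D) / b"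
  have bound: "norm (g c t) \<le> M * norm (g b t)" if c: "b \<le> c" "c \<le> b + 1" and t: "t > 0" for c t
  proof -
    define s where "s = of_real t * dir"
    have c0: "c > 0" using c b by simp
    have cs: "complex_of_real c - s \<noteq> 0" "complex_of_real b - s \<noteq> 0"
      using dist(2)[OF c0 t] dist(2)[OF b t] by (simp_all add: s_def)
    have rel: "g c t = (of_real c * (of_real b - s) / (of_real b * (of_real c - s))) * g b t"
    proof -
      have gen: "F * x / Q * d = r * (F * y / Q * d)" if "x = r * y" for F x y Q d r :: complex
        using that by simp
      show ?thesis
        unfolding g_def ray_kernel_def ray_fun_def s_def[symmetric]
        by (rule gen) (use cs b in simp)
    qed
    have "norm (of_real c * (of_real b - s) / (of_real b * (of_real c - s))) = (c / norm (of_real c - s)) * norm (of_real b - s) / b"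
      using c0 b by (simp add: norm_mult norm_divide)
    also have "\<dots> \<le> (c / norm (of_real c - s)) * (norm (of_real c - s) + (c - b)) / b"
    proof (intro divide_right_mono mult_left_mono)
      have "norm (of_real b - s) \<le> norm (of_real c - s) + norm (of_real b - complex_of_real c)"
        using norm_triangle_ineq[of "of_real c - s" "of_real b - complex_of_real c"] by simp
      also have "norm (of_real b - complex_of_real c) = c - b"
        using c by (simp only: of_real_diff[symmetric] norm_of_real)
      finally show "norm (of_real b - s) \<le> norm (of_real c - s) + (c - b)" .
    qed (use c0 b in auto)
    also have "\<dots> = (c + (c / norm (of_real c - s)) * (c - b)) / b"
      using cs by (simp add: field_simps)
    also have "\<dots> \<le> (c + D * 1) / b"
      using dist(1)[OF c0 t] c b D by (intro divide_right_mono add_left_mono mult_mono) (auto simp: s_def)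
    also have "\<dots> \<le> M" unfolding M_def using c b by (intro divide_right_mono) auto
    finally show ?thesis unfolding rel norm_mult by (rule mult_right_mono) simp
  qed
  have "(\<lambda>j. LBINT t:{0<..}. g (\<alpha> j) t) \<longlonglongrightarrow> (LBINT t:{0<..}. g b t)"
  proof (rule set_integral_tendsto_dominated)
    show "set_borel_measurable lborel {0<..} (g b)" "set_borel_measurable lborel {0<..} (g (\<alpha> j))" for j
      using gint[OF b] gint[OF pos[of j]] unfolding set_integrable_def set_borel_measurable_def
      by (auto dest: borel_measurable_integrable)
    show "set_integrable lborel {0<..} (\<lambda>t. M * norm (g b t))"
      using gint[OF b] by (intro set_integrable_mult_right set_integrable_norm)
    fix t :: real assume t: "t > 0"
    then show "norm (g (\<alpha> j) t) \<le> M * norm (g b t)" for j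
      by (intro bound \<alpha>)
    have "complex_of_real b - of_real t * dir \<noteq> 0" using dist(2)[OF b t] by simp
    then have "(\<lambda>j. complex_of_real (\<alpha> j) / (of_real (\<alpha> j) - of_real t * dir)) \<longlonglongrightarrow> complex_of_real b / (of_real b - of_real t * dir)"
      by (intro tendsto_intros \<alpha>(1))
    then show "(\<lambda>j. g (\<alpha> j) t) \<longlonglongrightarrow> g b t"
      unfolding g_def ray_kernel_def ray_fun_def divide_inverse[of _ "2 * \<i> * _"]
      by (intro tendsto_mult_right tendsto_mult_left)
  qed
  then show ?thesis by (simp only: ray_integral_def g_def dir_def mu_def)
qed

section \<open>Assembly of the remainder identity\<close>

context tree_parameter
begin

text \<open>This is (-1)^m h(m), with value 1 at m = 0. The function
  \<open>stirling_quotient\<close> gives 0 there, as 0 powr 0 = 0, so that the two are compared only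
  for m > 0.\<close>

definition tree_coeff :: "nat \<Rightarrow> complex" where
  "tree_coeff m = (-1) ^ m * (of_nat m * complex_of_real lam) ^ m / fact m * exp (of_nat m * complex_of_real lam)"

lemma tree_coeff_sums:
  "(\<lambda>m. of_nat m ^ n * tree_coeff m) sums tree_power_sum n (complex_of_real lam * exp (complex_of_real lam))"
  "summable (\<lambda>m. norm (tree_coeff m))"
proof -
  define X where "X = complex_of_real lam * exp (complex_of_real lam)"
  have X: "norm X < exp (-1)" using lam_pos lam_bound by (simp add: X_def norm_mult)
  have eq: "of_nat m ^ n * (- of_nat m) ^ m / fact m * X ^ m = of_nat m ^ n * tree_coeff m" for m n :: nat
    by (simp add: tree_coeff_def X_def power_minus[of "of_nat m"] power_mult_distrib exp_of_nat_mult)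
  have "summable (\<lambda>m. norm (of_nat m ^ n * tree_coeff m))" for n
    using summable_tree_power_sum[OF X, of n] unfolding eq .
  from this[of n] this[of 0]
  show "(\<lambda>m. of_nat m ^ n * tree_coeff m) sums tree_power_sum n (complex_of_real lam * exp (complex_of_real lam))"
    "summable (\<lambda>m. norm (tree_coeff m))"
    unfolding X_def[symmetric] tree_power_sum_def eq by (auto intro: summable_norm_cancel summable_sums)
qed

lemma exp_sg:
  "exp (of_real sg * s) * exp (- s) = of_real lam powr s * exp (of_real lam * s)" for s :: complex
proof -
  have "of_real sg * s + - s = s * of_real (ln lam) + of_real lam * s"
    by (simp add: sg_def algebra_simps)
  then have "exp (of_real sg * s) * exp (- s) = exp (s * of_real (ln lam)) * exp (of_real lam * s)"
    unfolding mult_exp_exp by (simp only:)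
  then show ?thesis using lam_pos by (simp add: powr_def Ln_of_real)
qed

lemma ray_fun_of_nat:
  assumes "m > 0"
  shows "(-1) ^ m * ray_fun sg n a (of_nat m) = of_nat m ^ n * tree_coeff m * (a / (a - of_nat m))"
proof -
  have "Gamma (1 + of_nat m :: complex) = fact m" using Gamma_fact[of m, where 'a = complex] by simp
  moreover have "of_nat m powr of_nat m = (of_nat m ^ m :: complex)" "complex_of_real lam powr of_nat m = of_real lam ^ m"
    using assms lam_pos by (simp_all add: powr_nat')
  ultimately have "exp (of_real sg * of_nat m) * stirling_quotient (of_nat m)
     = (exp (of_real sg * of_nat m) * exp (- of_nat m)) * of_nat m ^ m / fact m"
    by (simp add: stirling_quotient_def)
  also have "\<dots> = of_real lam ^ m * exp (of_real lam * of_nat m) * of_nat m ^ m / fact m"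
    unfolding exp_sg using \<open>complex_of_real lam powr of_nat m = of_real lam ^ m\<close> by simp
  finally show ?thesis
    by (simp add: ray_fun_def tree_coeff_def power_mult_distrib mult_ac)
qed

text \<open>Splitting off Gamma(-a) produces - pi h(a) / sin (pi a) by the reflection formula, which
  the residue at a in \<open>kernel_residue_sum\<close> cancels. What is left of M after N terms of
  the geometric expansion of 1 / (a - m) is the sum of the two ray integrals over a^(N+1).\<close>

lemma remainder_nonint:
  assumes a: "Re a > 0" "\<bar>Im a\<bar> < pi / (- sg) * Re a" "a \<notin> \<nat>" and z: "z = complex_of_real lam * a"
  shows "z powr a * exp z * incGamma (- a) z
       = (\<Sum>n<N. a ^ n * b_coeff n (- complex_of_real lam) / (z + a) ^ (2 * n + 1))
         + (ray_integral sg N a + cnj (ray_integral sg N (cnj a))) / a ^ Suc N"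
proof -
  define l where "l = complex_of_real lam"
  define Y where "Y n = tree_power_sum n (l * exp l)" for n
  define M where "M = (\<Sum>m. tree_coeff m / (a - of_nat m))"
  define h where "h = exp (of_real sg * a) * stirling_quotient a"
  have a0: "a \<noteq> 0" and an: "a \<noteq> of_nat n" for n using a(1,3) by auto
  have l1: "1 + l \<noteq> 0" using lam_pos by (simp add: l_def complex_eq_iff)
  have z0: "z \<noteq> 0" "z \<notin> \<real>\<^sub>\<le>\<^sub>0"
    using lam_pos a(1) by (auto simp: z complex_nonpos_Reals_iff mult_le_0_iff)
  \<comment> \<open>Since z + a = (1 + l) a, the powers of 1 + l cancel those in
    \<open>b_coeff_eq_tree_power_sum\<close>.\<close>
  have bterm: "a ^ n * b_coeff n (- complex_of_real lam) / (z + a) ^ (2 * n + 1) = Y n / a ^ Suc n" for n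
  proof -
    have za: "z + a = (1 + l) * a" by (simp add: z l_def algebra_simps)
    have "a ^ n * b_coeff n (- complex_of_real lam) / (z + a) ^ (2 * n + 1)
        = a ^ n * ((1 + l) ^ (2 * n + 1) * Y n) / ((1 + l) ^ (2 * n + 1) * a ^ (2 * n + 1))"
      unfolding b_coeff_eq_tree_power_sum[OF lam_pos lam_bound] za power_mult_distrib Y_def
      by (simp only: l_def)
    also have "\<dots> = a ^ n * Y n / a ^ (2 * n + 1)" using l1 by simp
    also have "a ^ (2 * n + 1) = a ^ n * a ^ Suc n" by (simp add: mult_2 flip: power_add)
    also have "a ^ n * Y n / (a ^ n * a ^ Suc n) = Y n / a ^ Suc n" using a0 by (simp del: power_Suc)
    finally show ?thesis .
  qed
  have Msums: "(\<lambda>m. tree_coeff m / (a - of_nat m)) sums M"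
  proof -
    obtain C where C: "\<And>m. norm (1 / (a - of_nat m)) \<le> C" using bounded_inverse_diff_nat[OF a(3)] by blast
    have "summable (\<lambda>m. tree_coeff m / (a - of_nat m))"
    proof (rule summable_comparison_test')
      show "summable (\<lambda>m. C * norm (tree_coeff m))" by (intro summable_mult tree_coeff_sums(2))
      show "norm (tree_coeff m / (a - of_nat m)) \<le> C * norm (tree_coeff m)" if "m \<ge> 0" for m
        using mult_right_mono[OF C[of m], of "norm (tree_coeff m)"] by (simp add: norm_divide)
    qed
    then show ?thesis unfolding M_def by (rule summable_sums)
  qed
  have Ysums: "(\<lambda>m. of_nat m ^ n * tree_coeff m) sums Y n" for n
    unfolding Y_def l_def by (rule tree_coeff_sums(1))
  have "(\<lambda>m. a ^ Suc N * (tree_coeff m / (a - of_nat m) - (\<Sum>n<N. of_nat m ^ n * tree_coeff m / a ^ Suc n)))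
      sums (a ^ Suc N * (M - (\<Sum>n<N. Y n / a ^ Suc n)))"
    by (intro sums_mult sums_diff Msums sums_sum sums_divide Ysums)
  moreover have "a ^ Suc N * (tree_coeff m / (a - of_nat m) - (\<Sum>n<N. of_nat m ^ n * tree_coeff m / a ^ Suc n))
     = of_nat m ^ N * tree_coeff m * (a / (a - of_nat m))" for m
  proof -
    have "tree_coeff m / (a - of_nat m) - (\<Sum>n<N. of_nat m ^ n * tree_coeff m / a ^ Suc n)
       = tree_coeff m * (1 / (a - of_nat m) - (\<Sum>n<N. of_nat m ^ n / a ^ Suc n))"
      by (simp add: right_diff_distrib sum_distrib_left mult_ac)
    also have "\<dots> = tree_coeff m * (of_nat m ^ N / (a ^ N * (a - of_nat m)))"
      by (subst inverse_diff_geometric) (use a0 an in auto)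
    finally show ?thesis using a0 by simp
  qed
  ultimately have S: "(\<lambda>m. of_nat m ^ N * tree_coeff m * (a / (a - of_nat m))) sums (a ^ Suc N * (M - (\<Sum>n<N. Y n / a ^ Suc n)))"
    by simp
  have "(\<lambda>K. \<Sum>m<Suc K. of_nat m ^ N * tree_coeff m * (a / (a - of_nat m))) \<longlonglongrightarrow> a ^ Suc N * (M - (\<Sum>n<N. Y n / a ^ Suc n))"
    using S unfolding sums_def by (rule LIMSEQ_Suc)
  moreover have "(\<Sum>m<Suc K. of_nat m ^ N * tree_coeff m * (a / (a - of_nat m))) = (\<Sum>m=1..K. (-1) ^ m * ray_fun sg N a (of_nat m))" for K
  proof -
    have "(\<Sum>m<Suc K. of_nat m ^ N * tree_coeff m * (a / (a - of_nat m))) = (\<Sum>m\<in>{1..K}. of_nat m ^ N * tree_coeff m * (a / (a - of_nat m)))"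
    proof (rule sum.mono_neutral_right)
      \<comment> \<open>The only extra index is m = 0, where 0^N = 0 because N > 0.\<close>
      show "\<forall>m\<in>{..<Suc K} - {1..K}. of_nat m ^ N * tree_coeff m * (a / (a - of_nat m)) = 0"
        using N_pos by auto
    qed auto
    also have "\<dots> = (\<Sum>m=1..K. (-1) ^ m * ray_fun sg N a (of_nat m))"
      by (intro sum.cong) (auto simp: ray_fun_of_nat)
    finally show ?thesis .
  qed
  ultimately have "(\<lambda>K. \<Sum>m=1..K. (-1) ^ m * ray_fun sg N a (of_nat m)) \<longlonglongrightarrow> a ^ Suc N * (M - (\<Sum>n<N. Y n / a ^ Suc n))"
    by simp
  from LIMSEQ_unique[OF this kernel_residue_sum[OF sg_neg N_pos a]]
  have main: "M = (\<Sum>n<N. Y n / a ^ Suc n) + (ray_integral sg N a + cnj (ray_integral sg N (cnj a))) / a ^ Suc N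
      + of_real pi * h / sin (of_real pi * a)"
    unfolding h_def[symmetric] using a0 by (simp add: field_simps del: power_Suc)
  have lower: "z powr a * exp z * lower_gamma (- a) z = - M"
  proof -
    have "lower_gamma_coeff (- a) n * z ^ n = - ((- (complex_of_real lam * a)) ^ n / (fact n * (a - of_nat n)))" for n
      using power_minus[of z n] minus_divide_right[of "(-1) ^ n * z ^ n" "fact n * (a - of_nat n)"]
      by (simp add: lower_gamma_coeff_def z[symmetric] right_diff_distrib)
    then have "lower_gamma_series (- a) z = (\<Sum>n. - ((- (complex_of_real lam * a)) ^ n / (fact n * (a - of_nat n))))"
      by (simp add: lower_gamma_series_def)
    also have "\<dots> = - (\<Sum>n. (- (complex_of_real lam * a)) ^ n / (fact n * (a - of_nat n)))"
    proof (rule suminf_minus)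
      have "summable (\<lambda>n. - (lower_gamma_coeff (- a) n * z ^ n))" by (intro summable_minus summable_lower_gamma)
      then show "summable (\<lambda>n. (- (complex_of_real lam * a)) ^ n / (fact n * (a - of_nat n)))"
        using \<open>\<And>n. lower_gamma_coeff (- a) n * z ^ n = _ n\<close> by simp
    qed
    finally have "exp z * lower_gamma_series (- a) z = - M"
      using lower_gamma_series_eq_tree_series[OF a(3) less_imp_le[OF lam_pos] lam_bound]
      by (simp add: z M_def tree_coeff_def)
    moreover have "z powr a * z powr (- a) = 1" using z0 by (simp add: powr_minus)
    moreover have "z powr a * exp z * lower_gamma (- a) z = (z powr a * z powr (- a)) * (exp z * lower_gamma_series (- a) z)"
      by (simp only: lower_gamma_def mult_ac)
    ultimately show ?thesis by simp
  qed
  have gam: "z powr a * exp z * Gamma (- a) = - (of_real pi * h / sin (of_real pi * a))"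
  proof -
    have G: "Gamma (1 + a) \<noteq> 0" by (rule Gamma_nonzero, rule Re_pos_not_nonpos_Ints) (use a in simp)
    have "Gamma (- a) * Gamma (1 + a) = of_real pi / sin (of_real pi * (- a))"
      using Gamma_reflection_complex[of "- a"] by simp
    then have Gm: "Gamma (- a) = - (of_real pi / sin (of_real pi * a)) / Gamma (1 + a)"
      by (intro eq_divide_imp[OF G]) simp
    have zp: "z powr a = of_real lam powr a * a powr a"
      unfolding z using lam_pos a0 by (simp add: powr_def Ln_times_of_real Ln_of_real distrib_left exp_add)
    have "h = (exp (of_real sg * a) * exp (- a)) * a powr a / Gamma (1 + a)"
      by (simp add: h_def stirling_quotient_def)
    then have "h = z powr a * exp z / Gamma (1 + a)" unfolding exp_sg zp by (simp add: z)
    then show ?thesis unfolding Gm by (simp add: mult_ac)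
  qed
  have "- a \<notin> \<int>\<^sub>\<le>\<^sub>0" using a(3) by (simp add: uminus_in_nonpos_Ints_iff)
  then have "incGamma (- a) z = Gamma (- a) - lower_gamma (- a) z"
    by (rule incGamma_eq_Gamma_minus_lower_gamma[OF _ z0(2)])
  then have "z powr a * exp z * incGamma (- a) z = z powr a * exp z * Gamma (- a) - z powr a * exp z * lower_gamma (- a) z"
    by (simp add: right_diff_distrib)
  also have "\<dots> = - (of_real pi * h / sin (of_real pi * a)) + M" unfolding gam lower by simp
  finally show ?thesis unfolding bterm main by simp
qed

text \<open>At a positive integer both sides of the partial fraction expansion have a pole; the identity
  survives there by continuity along the real axis.\<close>

lemma remainder_nat:
  assumes m: "m > 0" and a: "a = of_nat m" and z: "z = complex_of_real lam * a"
  shows "z powr a * exp z * incGamma (- a) z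
       = (\<Sum>n<N. a ^ n * b_coeff n (- complex_of_real lam) / (z + a) ^ (2 * n + 1))
         + (ray_integral sg N a + cnj (ray_integral sg N (cnj a))) / a ^ Suc N"
proof -
  \<comment> \<open>Strictly between m and m + 1, hence never a natural number; the summand 2 keeps
    already the first value below m + 1.\<close>
  define \<alpha> where "\<alpha> j = real m + 1 / (real j + 2)" for j
  have \<alpha>: "\<alpha> \<longlonglongrightarrow> real m" "\<And>j. real m \<le> \<alpha> j" "\<And>j. \<alpha> j \<le> real m + 1"
  proof -
    show "\<alpha> \<longlonglongrightarrow> real m" unfolding \<alpha>_def by real_asymp
    show "real m \<le> \<alpha> j" for j by (simp add: \<alpha>_def)
    have "1 / (real j + 2) \<le> 1" for j by (simp add: divide_le_eq)
    then show "\<alpha> j \<le> real m + 1" for j by (simp add: \<alpha>_def)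
  qed
  have pos: "\<alpha> j > 0" for j using \<alpha>(2)[of j] m by simp
  define c where "c j = complex_of_real (\<alpha> j)" for j
  have ca: "c \<longlonglongrightarrow> a" unfolding c_def a using \<alpha>(1) tendsto_of_real[OF \<alpha>(1), where 'a = complex] by simp
  have a_re: "a = complex_of_real (real m)" by (simp add: a)
  have nonint: "c j \<notin> \<nat>" for j
  proof
    assume "c j \<in> \<nat>"
    then obtain k :: nat where "c j = of_nat k" by (auto simp: Nats_def)
    then have "\<alpha> j = real k" unfolding c_def by (metis of_real_eq_iff of_real_of_nat_eq)
    moreover have "1 / (real j + 2) < 1" by (simp add: divide_less_eq)
    then have "real m < \<alpha> j" "\<alpha> j < real m + 1" by (simp_all add: \<alpha>_def)
    ultimately show False by simp
  qed
  have eq: "(of_real lam * c j) powr c j * exp (of_real lam * c j) * incGamma (- c j) (of_real lam * c j)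
      = (\<Sum>n<N. c j ^ n * b_coeff n (- complex_of_real lam) / (of_real lam * c j + c j) ^ (2 * n + 1))
         + (ray_integral sg N (c j) + cnj (ray_integral sg N (c j))) / c j ^ Suc N" for j
    using remainder_nonint[of "c j", OF _ _ nonint refl] pos[of j] sg_neg
    by (simp add: c_def divide_neg_neg divide_pos_neg mult_pos_pos)
  have za: "of_real lam * a + a \<noteq> 0" "of_real lam * a \<notin> \<real>\<^sub>\<le>\<^sub>0" "a \<noteq> 0"
  proof -
    have "of_real lam * a + a = of_real (lam * real m + real m)" by (simp add: a)
    moreover have "lam * real m + real m > 0" using lam_pos m by (simp add: add_pos_pos)
    ultimately show "of_real lam * a + a \<noteq> 0" by (metis less_irrefl of_real_eq_0_iff)
    have "of_real lam * a = of_real (lam * real m)" by (simp add: a)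
    moreover have "lam * real m > 0" using lam_pos m by simp
    ultimately show "of_real lam * a \<notin> \<real>\<^sub>\<le>\<^sub>0" by (metis nonpos_Reals_of_real_iff not_le)
    show "a \<noteq> 0" using m by (simp add: a)
  qed
  have inc: "(\<lambda>j. incGamma (- c j) (of_real lam * c j)) \<longlonglongrightarrow> incGamma (- a) (of_real lam * a)"
    using tendsto_incGamma_scaled[OF lam_pos _ \<alpha>] m by (simp add: c_def a)
  have ray: "(\<lambda>j. ray_integral sg N (c j)) \<longlonglongrightarrow> ray_integral sg N a"
    using tendsto_ray_integral[OF sg_neg N_pos _ \<alpha>] m unfolding c_def a_re by simp
  have L: "(\<lambda>j. (of_real lam * c j) powr c j * exp (of_real lam * c j) * incGamma (- c j) (of_real lam * c j))
      \<longlonglongrightarrow> (of_real lam * a) powr a * exp (of_real lam * a) * incGamma (- a) (of_real lam * a)"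
    by (intro tendsto_intros ca inc) (use za in auto)
  have R: "(\<lambda>j. (\<Sum>n<N. c j ^ n * b_coeff n (- complex_of_real lam) / (of_real lam * c j + c j) ^ (2 * n + 1))
         + (ray_integral sg N (c j) + cnj (ray_integral sg N (c j))) / c j ^ Suc N)
      \<longlonglongrightarrow> (\<Sum>n<N. a ^ n * b_coeff n (- complex_of_real lam) / (of_real lam * a + a) ^ (2 * n + 1))
         + (ray_integral sg N a + cnj (ray_integral sg N a)) / a ^ Suc N"
    by (intro tendsto_intros ca ray) (use za in \<open>auto simp del: power_Suc\<close>)
  have "cnj a = a" by (simp add: a)
  then show ?thesis using LIMSEQ_unique[OF L R[folded eq]] by (simp only: z)
qed

end

text \<open>Integrability and summability are part of the conclusion because integrals and infinite
  sums are total and would otherwise only have default values.\<close>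

theorem theorem1p2:
  fixes lam :: real and N :: nat and a z R :: complex
  assumes lam_pos: "0 < lam" and lam_less: "lam < lambertW (exp (-1))"
    and N_pos: "N > 0"
    and a_nz: "a \<noteq> 0"
    and z_eq: "z = complex_of_real lam * a"
    and R_eq: "incGamma (- a) z =
           z powr (- a) * exp (- z) *
           ((\<Sum>n<N. a ^ n * b_coeff n (- complex_of_real lam) / (z + a) ^ (2 * n + 1)) + R)"
    and arg_a: "\<bar>Arg a\<bar> < - omega lam 0 + pi"
  shows "(\<forall>k. set_integrable lborel {0<..} (integrand_plus N a lam k)) \<and>
         (\<forall>k. set_integrable lborel {0<..} (integrand_minus N a lam k)) \<and>
         summable (series_term_plus N a lam) \<and>
         summable (series_term_minus N a lam) \<and>
         R = (- 1) ^ N * a ^ N / (z + a) ^ (2 * N + 1) * (complex_of_real lam + 1) ^ (2 * N + 1)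
               * (\<Sum>k. series_term_plus N a lam k)
           + (- 1) ^ (N + 1) * a ^ N / (z + a) ^ (2 * N + 1) * (complex_of_real lam + 1) ^ (2 * N + 1)
               * (\<Sum>k. series_term_minus N a lam k)"
proof -
  interpret tree_parameter lam N
    by unfold_locales (use lam_pos N_pos lambertW_exp_minus_1_bound[OF lam_pos lam_less] in auto)
  have "omega lam 0 = Arg (Complex sg pi)" by (simp add: omega_eq_Arg_crit crit_def)
  with arg_a have "\<bar>Arg a\<bar> < pi - Arg (Complex sg pi)" by simp
  note sector = sector_of_Arg[OF sg_neg a_nz this]
  \<comment> \<open>The two sides of the sector, one for each series.\<close>
  have up: "Im a + pi / (- sg) * Re a > 0" and down: "- Im a + pi / (- sg) * Re a > 0"
    using sector(2) by linarith+
  define J where "J = ray_integral sg N a"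
  define J' where "J' = cnj (ray_integral sg N (cnj a))"
  have P: "series_term_plus N a lam sums ((-1) ^ N * J)"
    unfolding J_def by (rule plus_series(2)[OF a_nz up])
  have Q: "series_term_minus N a lam sums (- ((-1) ^ N * J'))"
    unfolding J'_def by (rule minus_series(2)[OF a_nz down])
  have ident: "z powr a * exp z * incGamma (- a) z
       = (\<Sum>n<N. a ^ n * b_coeff n (- complex_of_real lam) / (z + a) ^ (2 * n + 1)) + (J + J') / a ^ Suc N"
  proof (cases "a \<in> \<nat>")
    case True
    then obtain m where m: "a = of_nat m" by (auto simp: Nats_def)
    with a_nz have "m > 0" by (cases m) auto
    from remainder_nat[OF this m z_eq] show ?thesis by (simp add: J_def J'_def)
  next
    case False
    from remainder_nonint[OF sector False z_eq] show ?thesis by (simp add: J_def J'_def)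
  qed
  have "z \<noteq> 0" using a_nz lam_pos by (simp add: z_eq)
  then have 1: "z powr a * z powr (- a) = 1" "exp z * exp (- z) = 1"
    by (simp_all add: powr_minus flip: exp_add)
  have "z powr a * exp z * (z powr (- a) * exp (- z) * X) = (z powr a * z powr (- a)) * (exp z * exp (- z)) * X" for X
    by (simp only: mult_ac)
  then have cancel: "z powr a * exp z * (z powr (- a) * exp (- z) * X) = X" for X
    unfolding 1 by simp
  have "(\<Sum>n<N. a ^ n * b_coeff n (- complex_of_real lam) / (z + a) ^ (2 * n + 1)) + R
      = (\<Sum>n<N. a ^ n * b_coeff n (- complex_of_real lam) / (z + a) ^ (2 * n + 1)) + (J + J') / a ^ Suc N"
    using ident unfolding R_eq cancel .
  then have R: "R = (J + J') / a ^ Suc N" by (rule add_left_imp_eq)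
  \<comment> \<open>The common prefactor collapses to 1 / a^(N+1), as z + a = (lam + 1) a.\<close>
  define B where "B = a ^ N / (z + a) ^ (2 * N + 1) * (complex_of_real lam + 1) ^ (2 * N + 1)"
  have B: "B = 1 / a ^ Suc N"
  proof -
    have l1: "complex_of_real lam + 1 \<noteq> 0" using lam_pos by (simp add: complex_eq_iff)
    have "z + a = (complex_of_real lam + 1) * a" by (simp add: z_eq algebra_simps)
    moreover have "a ^ (2 * N + 1) = a ^ N * a ^ Suc N" by (simp add: mult_2 flip: power_add)
    ultimately show ?thesis unfolding B_def using l1 a_nz by (simp add: power_mult_distrib)
  qed
  \<comment> \<open>The sign (-1)^N in front of each series meets the (-1)^N in its value.\<close>
  have one: "(-1) ^ N * (-1) ^ N = (1 :: complex)" by (simp flip: power_mult_distrib)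
  have "(- 1) ^ N * B * ((-1) ^ N * J) + (- 1) ^ (N + 1) * B * (- ((-1) ^ N * J'))
      = ((-1) ^ N * (-1) ^ N) * (B * (J + J'))"
    by (simp add: algebra_simps)
  also have "\<dots> = R" unfolding one B R by simp
  finally have "R = (- 1) ^ N * B * ((-1) ^ N * J) + (- 1) ^ (N + 1) * B * (- ((-1) ^ N * J'))" ..
  then have "R = (- 1) ^ N * a ^ N / (z + a) ^ (2 * N + 1) * (complex_of_real lam + 1) ^ (2 * N + 1)
               * (\<Sum>k. series_term_plus N a lam k)
           + (- 1) ^ (N + 1) * a ^ N / (z + a) ^ (2 * N + 1) * (complex_of_real lam + 1) ^ (2 * N + 1)
               * (\<Sum>k. series_term_minus N a lam k)"
    unfolding sums_unique[OF P, symmetric] sums_unique[OF Q, symmetric] B_def by (simp only: times_divide_eq_right times_divide_eq_left mult.assoc)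
  then show ?thesis
    using plus_series(1)[OF a_nz up] minus_series(1)[OF a_nz down] P Q
    by (auto simp: sums_iff)
qed

end
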